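(* (1) Let $G\in\mathcal{F}(Q_3^-)$. Then the convex hull of any isometric cycle of $G$ is a gated subgraph of $G$ isomorphic to a Cartesian product of edges and even cycles. (2) Let $G\in\mathcal{S}_4$. Then the convex hull of any isometric cycle of $G$ is a gated subgraph of $G$; moreover, if this convex hull is an antipodal subgraph, then it is isomorphic to a Cartesian product of edges and even cycles.
   Context: All graphs are simple, connected, and not necessarily finite; $d$ is the shortest-path distance. The interval is $I(u,v)=\{x: d(u,x)+d(x,v)=d(u,v)\}$. An induced subgraph (or its vertex set) is convex if it contains $I(u,v)$ for any two of its vertices $u,v$; $\mathrm{conv}(S)$ is the smallest convex set containing $S$. A subgraph $H$ is isometric if distances in $H$ equal those in $G$. A subgraph $H$ is gated if for every vertex $x$ of $G$ there is a vertex $x'\in H$ (the gate of $x$) with $x'\in I(x,y)$ for all $y\in H$. An induced subgraph $S$ of $G$ is antipodal if for every vertex $x$ of $S$ there is a vertex $x^-$ of $S$ such that $S=\mathrm{conv}(x,x^-)$ in $G$. A partial cube is a graph isometrically embeddable in a hypercube. For an edge $uv$ let $W(u,v)=\{x: d(x,u)<d(x,v)\}$. In a partial cube the relation $\Theta$ on edges ($uv\,\Theta\, u'v'$ iff, up to exchanging $u'$ and $v'$, $u'\in W(u,v)$ and $v'\in W(v,u)$) is an equivalence relation, with classes $E_f$, $f\in\Lambda$. A contraction of $G$ is the partial cube obtained by contracting all edges of one class $E_f$. A partial cube $H$ is a pc-minor of $G$ if $H$ is obtained by a finite sequence of contractions from a convex subgraph of $G$. $Q_3^-$ is the 3-cube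 minus one vertex, and $\mathcal{F}(Q_3^-)$ is the class of partial cubes not having $Q_3^-$ as a pc-minor. $\mathcal{S}_4$ is the class of bipartite graphs whose geodesic convexity satisfies the separation property $S_4$: any two disjoint convex sets $A,B$ can be separated by complementary convex sets (halfspaces) $H',H''$, i.e., $A\subseteq H'$, $B\subseteq H''$. *)

theory Defs
  imports "Graph_Theory.Digraph_Isomorphism" "HOL.Hull"
begin

text \<open>
  Graphs are symmetric loop-free digraphs without parallel arcs, so that an undirected edge
  is a pair of opposite arcs; \<open>pair_bidirected_digraph\<close> imposes no finiteness.
\<close>

definition connected_graph :: "'a pair_pre_digraph \<Rightarrow> bool" where
  "connected_graph G \<longleftrightarrow> pair_bidirected_digraph G \<and> connected G"

abbreviation graph_iso :: "'a pair_pre_digraph \<Rightarrow> 'b pair_pre_digraph \<Rightarrow> bool" where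
  "graph_iso G H \<equiv> digraph_iso (with_proj G) (with_proj H)"

text \<open>Arbitrary if there is no walk from \<open>u\<close> to \<open>v\<close>; only used for connected graphs.\<close>

definition gdist :: "'a pair_pre_digraph \<Rightarrow> 'a \<Rightarrow> 'a \<Rightarrow> nat" where
  "gdist G u v = (LEAST n. (u, v) \<in> parcs G ^^ n)"

definition interval :: "'a pair_pre_digraph \<Rightarrow> 'a \<Rightarrow> 'a \<Rightarrow> 'a set" where
  "interval G u v = {x \<in> pverts G. gdist G u x + gdist G x v = gdist G u v}"

definition geo_convex :: "'a pair_pre_digraph \<Rightarrow> 'a set \<Rightarrow> bool" where
  "geo_convex G S \<longleftrightarrow> S \<subseteq> pverts G \<and> (\<forall>u\<in>S. \<forall>v\<in>S. interval G u v \<subseteq> S)"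

abbreviation conv :: "'a pair_pre_digraph \<Rightarrow> 'a set \<Rightarrow> 'a set" where
  "conv G S \<equiv> geo_convex G hull S"

definition induced :: "'a pair_pre_digraph \<Rightarrow> 'a set \<Rightarrow> 'a pair_pre_digraph" where
  "induced G S = \<lparr>pverts = S, parcs = parcs G \<inter> S \<times> S\<rparr>"

definition isometric_subgraph :: "'a pair_pre_digraph \<Rightarrow> 'a pair_pre_digraph \<Rightarrow> bool" where
  "isometric_subgraph H G \<longleftrightarrow> subgraph H G \<and> connected_graph H \<and>
     (\<forall>u\<in>pverts H. \<forall>v\<in>pverts H. gdist H u v = gdist G u v)"

definition gated :: "'a pair_pre_digraph \<Rightarrow> 'a set \<Rightarrow> bool" where
  "gated G S \<longleftrightarrow> S \<subseteq> pverts G \<and>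
     (\<forall>x\<in>pverts G. \<exists>x'\<in>S. \<forall>y\<in>S. x' \<in> interval G x y)"

definition antipodal :: "'a pair_pre_digraph \<Rightarrow> 'a set \<Rightarrow> bool" where
  "antipodal G S \<longleftrightarrow> S \<subseteq> pverts G \<and> (\<forall>x\<in>S. \<exists>x'\<in>S. S = conv G {x, x'})"


section \<open>Partial cubes\<close>

text \<open>
  For infinite \<open>X\<close> the finite subsets form one connected component of the graph on all
  subsets; all components are isomorphic.
\<close>

definition hypercube :: "'i set \<Rightarrow> 'i set pair_pre_digraph" where
  "hypercube X = \<lparr>pverts = {A. A \<subseteq> X \<and> finite A},
     parcs = {(A, B). A \<subseteq> X \<and> finite A \<and> B \<subseteq> X \<and> finite B \<and> card (A - B \<union> (B - A)) = 1}\<rparr>"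

definition isometric_embedding ::
    "('a \<Rightarrow> 'b) \<Rightarrow> 'a pair_pre_digraph \<Rightarrow> 'b pair_pre_digraph \<Rightarrow> bool" where
  "isometric_embedding f G H \<longleftrightarrow> f ` pverts G \<subseteq> pverts H \<and>
     (\<forall>u\<in>pverts G. \<forall>v\<in>pverts G. gdist H (f u) (f v) = gdist G u v)"

text \<open>
  Bounding the type of the coordinate set is no restriction: in an isometric embedding every
  coordinate that is not constant on \<open>G\<close> changes along some arc of \<open>G\<close>, and no arc
  changes two coordinates, so non-constant coordinates can be renamed to arcs.
\<close>

definition partial_cube :: "'a pair_pre_digraph \<Rightarrow> bool" where
  "partial_cube G \<longleftrightarrow> connected_graph G \<and>
     (\<exists>(X :: ('a \<times> 'a) set) f. isometric_embedding f G (hypercube X))"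

definition halfspace_W :: "'a pair_pre_digraph \<Rightarrow> 'a \<Rightarrow> 'a \<Rightarrow> 'a set" where
  "halfspace_W G u v = {x \<in> pverts G. gdist G x u < gdist G x v}"

text \<open>A class contains both arcs of each of its edges.\<close>

definition Theta :: "'a pair_pre_digraph \<Rightarrow> ('a \<times> 'a) rel" where
  "Theta G = {((u, v), (u', v')). (u, v) \<in> parcs G \<and> (u', v') \<in> parcs G \<and>
     (u' \<in> halfspace_W G u v \<and> v' \<in> halfspace_W G v u \<or> v' \<in> halfspace_W G u v \<and> u' \<in> halfspace_W G v u)}"

definition Theta_classes :: "'a pair_pre_digraph \<Rightarrow> ('a \<times> 'a) set set" where
  "Theta_classes G = parcs G // Theta G"

text \<open>Since \<open>E\<close> is symmetric, \<open>E\<^sup>*\<close> is the equivalence relation it generates.\<close>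

definition contract :: "'a pair_pre_digraph \<Rightarrow> ('a \<times> 'a) set \<Rightarrow> 'a set pair_pre_digraph" where
  "contract G E = \<lparr>pverts = pverts G // E\<^sup>*,
     parcs = {(A, B). A \<in> pverts G // E\<^sup>* \<and> B \<in> pverts G // E\<^sup>* \<and> A \<noteq> B \<and>
       (\<exists>a\<in>A. \<exists>b\<in>B. (a, b) \<in> parcs G)}\<rparr>"

text \<open>
  A contraction changes the vertex type, so each one is replaced by an isomorphic copy
  over the original type, which exists since a contraction does not have more vertices.
\<close>

inductive pc_minor :: "'a pair_pre_digraph \<Rightarrow> 'a pair_pre_digraph \<Rightarrow> bool" for G where
  convex_subgraph: "geo_convex G S \<Longrightarrow> pc_minor G (induced G S)"
| contraction: "pc_minor G H \<Longrightarrow> E \<in> Theta_classes H \<Longrightarrow> graph_iso (contract H E) K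
    \<Longrightarrow> pc_minor G K"

definition has_pc_minor :: "'a pair_pre_digraph \<Rightarrow> 'b pair_pre_digraph \<Rightarrow> bool" where
  "has_pc_minor G M \<longleftrightarrow> (\<exists>H. pc_minor G H \<and> graph_iso H M)"

definition Q3_minus :: "nat set pair_pre_digraph" where
  "Q3_minus = induced (hypercube {0, 1, 2}) (Pow {0, 1, 2} - {{0, 1, 2}})"

definition F_Q3_minus :: "'a pair_pre_digraph set" where
  "F_Q3_minus = {G. partial_cube G \<and> \<not> has_pc_minor G Q3_minus}"


section \<open>Separation by halfspaces\<close>

definition bipartite :: "'a pair_pre_digraph \<Rightarrow> bool" where
  "bipartite G \<longleftrightarrow> (\<exists>A B. A \<union> B = pverts G \<and> A \<inter> B = {} \<and> parcs G \<subseteq> A \<times> B \<union> B \<times> A)"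

definition S4 :: "'a pair_pre_digraph set" where
  "S4 = {G. connected_graph G \<and> bipartite G \<and>
     (\<forall>A B. geo_convex G A \<and> geo_convex G B \<and> A \<inter> B = {} \<longrightarrow>
       (\<exists>H' H''. geo_convex G H' \<and> geo_convex G H'' \<and> H' \<inter> H'' = {} \<and> H' \<union> H'' = pverts G \<and>
          A \<subseteq> H' \<and> B \<subseteq> H''))}"


section \<open>Cycles and Cartesian products\<close>

definition edge_graph :: "nat pair_pre_digraph" where
  "edge_graph = \<lparr>pverts = {0, 1}, parcs = {(0, 1), (1, 0)}\<rparr>"

text \<open>A cycle for \<open>n \<ge> 3\<close> only.\<close>

definition cycle_graph :: "nat \<Rightarrow> nat pair_pre_digraph" where
  "cycle_graph n = \<lparr>pverts = {..<n},
     parcs = {(i, j). i < n \<and> j < n \<and> (j = Suc i mod n \<or> i = Suc j mod n)}\<rparr>"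

definition isometric_cycle :: "'a pair_pre_digraph \<Rightarrow> 'a pair_pre_digraph \<Rightarrow> bool" where
  "isometric_cycle C G \<longleftrightarrow> isometric_subgraph C G \<and> (\<exists>n\<ge>3. graph_iso C (cycle_graph n))"

definition cartesian_product :: "'a pair_pre_digraph list \<Rightarrow> 'a list pair_pre_digraph" where
  "cartesian_product Fs =
     (let V = {xs. length xs = length Fs \<and> (\<forall>i<length Fs. xs ! i \<in> pverts (Fs ! i))}
      in \<lparr>pverts = V,
          parcs = {(xs, ys). xs \<in> V \<and> ys \<in> V \<and>
            (\<exists>i<length Fs. (xs ! i, ys ! i) \<in> parcs (Fs ! i) \<and>
               (\<forall>j<length Fs. j \<noteq> i \<longrightarrow> xs ! j = ys ! j))}\<rparr>)"

definition product_of_edges_and_even_cycles :: "'a pair_pre_digraph \<Rightarrow> bool" where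
  "product_of_edges_and_even_cycles H \<longleftrightarrow>
     (\<exists>Fs. Fs \<noteq> [] \<and> set Fs \<subseteq> {edge_graph} \<union> {cycle_graph (2 * k) | k. k \<ge> 2} \<and>
        graph_iso H (cartesian_product Fs))"

end

theory Submission
  imports Defs
begin

text \<open>A partial cube is handled through coordinates: a map \<open>f\<close> from vertices to sets such that distance
  is the number of coordinates in which two vertices differ. A coordinate gives two complementary
  halfspaces, intersections of halfspaces are convex, and contracting a class deletes a
  coordinate. A set of halfspaces is called infeasible if no vertex lies in all of its members.

  An isometric cycle of length \<open>2 * n\<close> flips \<open>n\<close> coordinates, in the same order on its two halves,
  and its hull consists of all vertices that differ from the cycle in these coordinates only.
  The cycle shows all four sign patterns on any two of its coordinates (\<open>quadrants\<close>).

  Both parts of the theorem rest on one property: if the intersections of two sets of halfspaces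
  are nonempty and disjoint, then some halfspace contains the one and misses the other
  (\<open>separable\<close>). For \<open>S4\<close> this is the definition read in coordinates
  (\<open>separable_if_convex_separation\<close>). For graphs without the minor \<open>Q3_minus\<close> the point is that no
  convex set meets exactly seven octants of three coordinates. By moving along geodesics one
  deduces that a minimal infeasible set has at most three members, and that an infeasible triple
  stays infeasible when all its members are complemented. The first fact gives separation
  (\<open>separable_if_no_seven\<close>); the second makes the hull of the cycle closed under flipping all \<open>n\<close>
  coordinates, that is, antipodal (\<open>antipode_if_no_seven\<close>).

  Gatedness (\<open>gated_hull\<close>): let \<open>x'\<close> be a vertex of the hull nearest to \<open>x\<close>. If \<open>x\<close> and \<open>x'\<close> differed
  in a coordinate \<open>i\<close> of the cycle, the interval between them would miss the part of the hull where
  \<open>i\<close> is flipped. A separating halfspace belongs to another coordinate of the cycle, and this one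
  would be determined by \<open>i\<close>, contrary to the four sign patterns. So \<open>x'\<close> agrees with \<open>x\<close> on the cycle
  coordinates, which is what a gate must do.

  Product structure: the halfspaces of an antipodal hull behave like vectors, infeasible sets
  like positive linear relations. Three halfspaces are dependent if one of their octants is
  empty. The main step is that there is no minimal infeasible set of four halfspaces
  (\<open>no_circuit4\<close>). Separating such a set in its three ways produces new halfspaces in the planes
  spanned by its pairs, and with them another minimal infeasible set of four that contains a
  narrower pair. As there are finitely many halfspaces, this cannot go on forever.
  It follows that infeasibility is always seen on three halfspaces (\<open>helly\<close>), and then that
  dependent triples with a common member lie in a common plane (\<open>dependent_merge\<close>). The
  coordinates therefore fall into disjoint planes. Within one plane the order given by the cycle
  leaves only initial and final segments as sign patterns (\<open>pos_segment\<close>), which form an even cycle,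
  or an edge if the plane has a single coordinate. By \<open>helly\<close> the patterns in different planes
  combine freely (\<open>segments_realized\<close>), so the hull is the product.\<close>

section \<open>Infeasible sets of halfspaces\<close>

lemma card_4E:
  assumes "card A = 4"
  obtains a b c d where "A = {a, b, c, d}" "a \<noteq> b" "a \<noteq> c" "a \<noteq> d" "b \<noteq> c" "b \<noteq> d" "c \<noteq> d"
proof -
  have "card A = Suc 3" using assms by simp
  then obtain a B where "A = insert a B" "a \<notin> B" "card B = 3" by (auto simp only: card_Suc_eq)
  moreover from this(3) obtain b c d where "B = {b, c, d}" "b \<noteq> c" "b \<noteq> d" "c \<noteq> d"
    by (auto simp only: card_3_iff)
  ultimately show thesis using that[of a b c d] by simp
qed

text \<open>Halfspaces are subsets of the whole type, so that complementation is set complement; only their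
  traces on the set \<open>V\<close> of vertices matter. The assumption \<open>link\<close> is what remains of isometry: on a
  geodesic from \<open>x\<close> to \<open>y\<close> the halfspaces \<open>a\<close> and \<open>b\<close> are left and entered at different steps.\<close>

locale halfspace_system =
  fixes V :: "'p set" and HH :: "'p set set"
  assumes compl: "a \<in> HH \<Longrightarrow> - a \<in> HH"
    and link: "\<lbrakk>a \<in> HH; b \<in> HH; a \<noteq> - b; x \<in> V; y \<in> V; x \<in> a; x \<notin> b; y \<notin> a; y \<in> b\<rbrakk>
      \<Longrightarrow> \<exists>z\<in>V. (\<forall>h\<in>HH. x \<in> h \<longrightarrow> y \<in> h \<longrightarrow> z \<in> h) \<and> (z \<in> a \<longleftrightarrow> z \<in> b)"
begin

definition feasible :: "'p set set \<Rightarrow> bool" where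
  "feasible \<sigma> \<longleftrightarrow> (\<exists>x\<in>V. \<forall>h\<in>\<sigma>. x \<in> h)"

lemma feasibleI: "x \<in> V \<Longrightarrow> (\<And>h. h \<in> \<sigma> \<Longrightarrow> x \<in> h) \<Longrightarrow> feasible \<sigma>"
  unfolding feasible_def by blast

lemma feasible_mono: "feasible \<tau> \<Longrightarrow> \<sigma> \<subseteq> \<tau> \<Longrightarrow> feasible \<sigma>"
  unfolding feasible_def by blast

definition minimal_infeasible :: "'p set set \<Rightarrow> bool" where
  "minimal_infeasible \<sigma> \<longleftrightarrow> \<not> feasible \<sigma> \<and> (\<forall>h\<in>\<sigma>. feasible (\<sigma> - {h}))"

lemma exists_minimal_infeasible:
  assumes "finite \<sigma>" "\<not> feasible \<sigma>"
  shows "\<exists>\<tau>\<subseteq>\<sigma>. minimal_infeasible \<tau>"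
  using assms
proof (induction "card \<sigma>" arbitrary: \<sigma> rule: less_induct)
  case less
  show ?case
  proof (cases "minimal_infeasible \<sigma>")
    case False
    then obtain h where h: "h \<in> \<sigma>" "\<not> feasible (\<sigma> - {h})"
      using less.prems unfolding minimal_infeasible_def by blast
    have "card (\<sigma> - {h}) < card \<sigma>" using h less.prems by (meson card_Diff1_less)
    then show ?thesis using less.hyps[of "\<sigma> - {h}"] h less.prems by blast
  qed blast
qed

text \<open>Start at a point that violates only \<open>c\<close> and go to one that violates only \<open>b\<close>. The point given by the
  link property cannot lie in both, so it lies in neither.\<close>

lemma flip_two:
  assumes b: "b \<in> HH" and c: "c \<in> HH" and bc: "b \<noteq> - c" and \<tau>: "\<tau> \<subseteq> HH"
    and inf: "\<not> feasible (insert b (insert c \<tau>))"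
    and fb: "feasible (insert b \<tau>)" and fc: "feasible (insert c \<tau>)"
  shows "feasible (insert (- b) (insert (- c) \<tau>))"
proof -
  obtain x where x: "x \<in> V" "x \<in> b" "\<forall>h\<in>\<tau>. x \<in> h" using fb unfolding feasible_def by blast
  obtain y where y: "y \<in> V" "y \<in> c" "\<forall>h\<in>\<tau>. y \<in> h" using fc unfolding feasible_def by blast
  have xc: "x \<notin> c" and yb: "y \<notin> b" using inf x y unfolding feasible_def by blast+
  obtain z where z: "z \<in> V" "\<forall>h\<in>HH. x \<in> h \<longrightarrow> y \<in> h \<longrightarrow> z \<in> h" "z \<in> b \<longleftrightarrow> z \<in> c"
    using link[OF b c bc x(1) y(1) x(2) xc yb y(2)] by (elim bexE conjE)
  have zt: "\<forall>h\<in>\<tau>. z \<in> h" using z(2) x(3) y(3) \<tau> by (meson subsetD)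
  then have "z \<notin> b" using inf z unfolding feasible_def by blast
  then show ?thesis using z zt unfolding feasible_def by blast
qed

lemma minimal_infeasible_drop: "minimal_infeasible \<sigma> \<Longrightarrow> h \<in> \<sigma> \<Longrightarrow> feasible (\<sigma> - {h})"
  by (simp add: minimal_infeasible_def)

lemma minimal_infeasible_flip_one:
  assumes "minimal_infeasible \<sigma>" "h \<in> \<sigma>"
  shows "feasible ({- h} \<union> (\<sigma> - {h}))"
proof -
  obtain x where x: "x \<in> V" "\<forall>k\<in>\<sigma> - {h}. x \<in> k"
    using minimal_infeasible_drop[OF assms] unfolding feasible_def by blast
  moreover have "x \<notin> h"
    using assms(1) feasibleI[OF x(1), of \<sigma>] x(2) unfolding minimal_infeasible_def by auto
  ultimately show ?thesis by (intro feasibleI[of x]) auto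
qed

lemma minimal_infeasible_neq_compl:
  assumes "minimal_infeasible \<sigma>" "b \<in> \<sigma>" "c \<in> \<sigma>" "a \<in> \<sigma>" "a \<noteq> b" "a \<noteq> c"
  shows "b \<noteq> - c"
proof
  assume "b = - c"
  obtain x where "\<forall>h\<in>\<sigma> - {a}. x \<in> h"
    using minimal_infeasible_drop[OF assms(1,4)] unfolding feasible_def by blast
  then have "x \<in> b" "x \<in> c" using assms(2,3,5,6) by auto
  with \<open>b = - c\<close> show False by simp
qed

lemma minimal_infeasible_flip_two:
  assumes min: "minimal_infeasible \<sigma>" and \<sigma>: "\<sigma> \<subseteq> HH"
    and hkg: "h \<in> \<sigma>" "k \<in> \<sigma>" "g \<in> \<sigma>" "h \<noteq> k" "g \<noteq> h" "g \<noteq> k"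
  shows "feasible ({- h, - k} \<union> (\<sigma> - {h, k}))"
proof -
  have eqs: "insert h (insert k (\<sigma> - {h, k})) = \<sigma>" "insert h (\<sigma> - {h, k}) = \<sigma> - {k}"
    "insert k (\<sigma> - {h, k}) = \<sigma> - {h}"
    using hkg by auto
  have "feasible (insert (- h) (insert (- k) (\<sigma> - {h, k})))"
  proof (rule flip_two)
    show "h \<in> HH" "k \<in> HH" "\<sigma> - {h, k} \<subseteq> HH" using hkg(1,2) \<sigma> by auto
    show "\<not> feasible (insert h (insert k (\<sigma> - {h, k})))"
      using min unfolding eqs(1) minimal_infeasible_def by simp
    show "feasible (insert h (\<sigma> - {h, k}))" "feasible (insert k (\<sigma> - {h, k}))"
      unfolding eqs(2,3) using minimal_infeasible_drop[OF min] hkg(1,2) by auto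
    show "h \<noteq> - k" by (rule minimal_infeasible_neq_compl[OF min hkg(1-3) hkg(5,6)])
  qed
  then show ?thesis by simp
qed

end


text \<open>The assumption says that no convex set meets exactly seven of the eight octants of three
  coordinates, which is how the absence of the minor \<open>Q3_minus\<close> appears in coordinates.\<close>

locale no_seven_octants = halfspace_system V HH for V :: "'p set" and HH +
  assumes seven: "\<lbrakk>a \<in> HH; b \<in> HH; c \<in> HH; \<tau> \<subseteq> HH; finite \<tau>;
      feasible ({- a, b, c} \<union> \<tau>); feasible ({a, - b, c} \<union> \<tau>); feasible ({a, b, - c} \<union> \<tau>);
      feasible ({a, - b, - c} \<union> \<tau>); feasible ({- a, b, - c} \<union> \<tau>); feasible ({- a, - b, c} \<union> \<tau>);
      feasible ({- a, - b, - c} \<union> \<tau>)\<rbrakk> \<Longrightarrow> feasible ({a, b, c} \<union> \<tau>)"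
begin

text \<open>Of the eight octants of \<open>a\<close>, \<open>b\<close>, \<open>c\<close> inside the remaining members of \<open>\<sigma>\<close>, the one belonging to \<open>\<sigma>\<close> is
  empty, and those with one or two flips are not. If the one with three flips were met as well,
  exactly seven would be.\<close>

lemma minimal_infeasible_flip_three:
  assumes min: "minimal_infeasible \<sigma>" and \<sigma>: "\<sigma> \<subseteq> HH" "finite \<sigma>"
    and abc: "a \<in> \<sigma>" "b \<in> \<sigma>" "c \<in> \<sigma>" "a \<noteq> b" "a \<noteq> c" "b \<noteq> c"
  shows "\<not> feasible ({- a, - b, - c} \<union> (\<sigma> - {a, b, c}))"
proof
  let ?\<tau> = "\<sigma> - {a, b, c}"
  assume neg: "feasible ({- a, - b, - c} \<union> ?\<tau>)"
  note one = minimal_infeasible_flip_one[OF min]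
  note two = minimal_infeasible_flip_two[OF min \<sigma>(1)]
  have "feasible ({a, b, c} \<union> ?\<tau>)"
  proof (rule seven)
    show "feasible ({- a, b, c} \<union> ?\<tau>)" by (rule feasible_mono[OF one[OF abc(1)]]) (use abc in auto)
    show "feasible ({a, - b, c} \<union> ?\<tau>)" by (rule feasible_mono[OF one[OF abc(2)]]) (use abc in auto)
    show "feasible ({a, b, - c} \<union> ?\<tau>)" by (rule feasible_mono[OF one[OF abc(3)]]) (use abc in auto)
    show "feasible ({a, - b, - c} \<union> ?\<tau>)"
      by (rule feasible_mono[OF two[OF abc(2,3,1)]]) (use abc in auto)
    show "feasible ({- a, b, - c} \<union> ?\<tau>)"
      by (rule feasible_mono[OF two[OF abc(1,3,2)]]) (use abc in auto)
    show "feasible ({- a, - b, c} \<union> ?\<tau>)"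
      by (rule feasible_mono[OF two[OF abc(1,2,3)]]) (use abc in auto)
    show "a \<in> HH" "b \<in> HH" "c \<in> HH" "?\<tau> \<subseteq> HH" "finite ?\<tau>" using abc(1-3) \<sigma> by auto
  qed (rule neg)
  moreover have "{a, b, c} \<union> ?\<tau> = \<sigma>" using abc(1-3) by auto
  ultimately show False using min unfolding minimal_infeasible_def by simp
qed

text \<open>With a fourth member \<open>d\<close> dropped, seven octants of \<open>a\<close>, \<open>b\<close>, \<open>c\<close> are met, hence also the eighth. A
  point \<open>p\<close> there lies outside all four halfspaces, because exactly three flips are impossible. But
  between \<open>p\<close> and a point outside \<open>c\<close> and \<open>d\<close> only, there is a point with exactly three flips.\<close>

lemma minimal_infeasible_card:
  assumes min: "minimal_infeasible \<sigma>" and \<sigma>: "\<sigma> \<subseteq> HH" "finite \<sigma>"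
  shows "card \<sigma> \<le> 3"
proof (rule ccontr)
  assume "\<not> card \<sigma> \<le> 3"
  then have "4 \<le> card \<sigma>" by simp
  then obtain A where A: "A \<subseteq> \<sigma>" "card A = 4" by (meson obtain_subset_with_card_n)
  from A(2) obtain a b c d where A4: "A = {a, b, c, d}"
    and ab: "a \<noteq> b" and ac: "a \<noteq> c" and ad: "a \<noteq> d" and bc: "b \<noteq> c" and bd: "b \<noteq> d" and cd: "c \<noteq> d"
    by (rule card_4E)
  note ne = ab ac ad bc bd cd
  have a: "a \<in> \<sigma>" and b: "b \<in> \<sigma>" and c: "c \<in> \<sigma>" and d: "d \<in> \<sigma>" using A(1) A4 by simp_all
  let ?\<tau> = "\<sigma> - {a, b, c, d}"
  note one = minimal_infeasible_flip_one[OF min]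
  note two = minimal_infeasible_flip_two[OF min \<sigma>(1)]
  note three = minimal_infeasible_flip_three[OF min \<sigma>]
  have "feasible ({- a, - b, - c} \<union> ?\<tau>)"
  proof (rule seven[where a="-a" and b="-b" and c="-c", unfolded double_compl])
    show "feasible ({a, - b, - c} \<union> ?\<tau>)"
      by (rule feasible_mono[OF two[OF b c a]]) (use ne a in auto)
    show "feasible ({- a, b, - c} \<union> ?\<tau>)"
      by (rule feasible_mono[OF two[OF a c b]]) (use ne b in auto)
    show "feasible ({- a, - b, c} \<union> ?\<tau>)"
      by (rule feasible_mono[OF two[OF a b c]]) (use ne c in auto)
    show "feasible ({- a, b, c} \<union> ?\<tau>)"
      by (rule feasible_mono[OF one[OF a]]) (use ne b c in auto)
    show "feasible ({a, - b, c} \<union> ?\<tau>)"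
      by (rule feasible_mono[OF one[OF b]]) (use ne a c in auto)
    show "feasible ({a, b, - c} \<union> ?\<tau>)"
      by (rule feasible_mono[OF one[OF c]]) (use ne a b in auto)
    show "feasible ({a, b, c} \<union> ?\<tau>)"
      by (rule feasible_mono[OF minimal_infeasible_drop[OF min d]]) (use ne a b c in auto)
    show "- a \<in> HH" "- b \<in> HH" "- c \<in> HH" "?\<tau> \<subseteq> HH" "finite ?\<tau>"
      using a b c \<sigma> compl by auto
  qed
  then obtain p where p: "p \<in> V" "p \<notin> a" "p \<notin> b" "p \<notin> c" "\<forall>h\<in>?\<tau>. p \<in> h"
    unfolding feasible_def by auto
  have pd: "p \<notin> d"
  proof
    assume "p \<in> d"
    then have "feasible ({- a, - b, - c} \<union> (\<sigma> - {a, b, c}))"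
      using p by (intro feasibleI[of p]) auto
    then show False using three[OF a b c ab ac bc] by blast
  qed
  obtain q where q: "q \<in> V" "q \<notin> c" "q \<notin> d" "\<forall>h\<in>\<sigma> - {c, d}. q \<in> h"
    using two[OF c d a cd ac ad] unfolding feasible_def by auto
  have qab: "q \<in> a" "q \<in> b" using q(4) a b ne by auto
  have HH: "a \<in> HH" "- b \<in> HH" "-c \<in> HH" "-d \<in> HH" using a b c d \<sigma>(1) compl by auto
  have "a \<noteq> - (- b)" using ab by simp
  then obtain z where z: "z \<in> V" "\<forall>h\<in>HH. q \<in> h \<longrightarrow> p \<in> h \<longrightarrow> z \<in> h" "z \<in> a \<longleftrightarrow> z \<in> - b"
    using link[OF HH(1,2) _ q(1) p(1) qab(1)] p(2,3) qab(2) by auto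
  have zc: "z \<notin> c" "z \<notin> d"
    using bspec[OF z(2) HH(3)] bspec[OF z(2) HH(4)] p(4) pd q(2,3) by auto
  have z\<tau>: "\<forall>h\<in>?\<tau>. z \<in> h"
    using z(2) p(5) q(4) \<sigma>(1) by (metis Diff_iff insert_iff subsetD)
  show False
  proof (cases "z \<in> a")
    case True
    then have "feasible ({- b, - c, - d} \<union> (\<sigma> - {b, c, d}))"
      using z(1,3) zc z\<tau> by (intro feasibleI[of z]) auto
    then show False using three[OF b c d bc bd cd] by blast
  next
    case False
    then have "feasible ({- a, - c, - d} \<union> (\<sigma> - {a, c, d}))"
      using z(1,3) zc z\<tau> by (intro feasibleI[of z]) auto
    then show False using three[OF a c d ac ad cd] by blast
  qed
qed

text \<open>One of the two sets contributes a single halfspace to a minimal infeasible subset of their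
  union, because that subset has at most three members. This halfspace separates.\<close>

lemma separation:
  assumes \<alpha>: "\<alpha> \<subseteq> HH" "finite \<alpha>" "feasible \<alpha>" and \<beta>: "\<beta> \<subseteq> HH" "finite \<beta>" "feasible \<beta>"
    and inf: "\<not> feasible (\<alpha> \<union> \<beta>)"
  shows "\<exists>e\<in>HH. \<not> feasible (insert (- e) \<alpha>) \<and> \<not> feasible (insert e \<beta>)"
proof -
  have "finite (\<alpha> \<union> \<beta>)" using \<alpha> \<beta> by simp
  from exists_minimal_infeasible[OF this inf]
  obtain \<tau> where \<tau>: "\<tau> \<subseteq> \<alpha> \<union> \<beta>" "minimal_infeasible \<tau>" by (elim exE conjE)
  have fin: "finite \<tau>" "\<tau> \<subseteq> HH"
    using finite_subset[OF \<tau>(1)] \<tau>(1) \<alpha>(1,2) \<beta>(1,2) by auto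
  have infe: "\<not> feasible \<tau>" using \<tau>(2) unfolding minimal_infeasible_def by simp
  have contra: "\<not> feasible (insert (- h) \<gamma>)" if "h \<in> \<gamma>" for h \<gamma>
    using that unfolding feasible_def by auto
  have "card \<tau> = card (\<tau> \<inter> \<alpha>) + card (\<tau> - \<alpha>)"
    using fin by (metis Int_Diff_Un Int_Diff_disjoint card_Un_disjoint finite_Diff finite_Int)
  then have "card (\<tau> - \<alpha>) \<le> 1 \<or> card (\<tau> \<inter> \<alpha>) \<le> 1"
    using minimal_infeasible_card[OF \<tau>(2) fin(2,1)] by linarith
  then show ?thesis
  proof
    assume "card (\<tau> - \<alpha>) \<le> 1"
    moreover have "\<tau> - \<alpha> \<noteq> {}" using infe \<alpha>(3) feasible_mono[of \<alpha> \<tau>] by auto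
    ultimately have "card (\<tau> - \<alpha>) = 1" using fin(1) by (simp add: le_Suc_eq)
    then obtain h where h: "\<tau> - \<alpha> = {h}" by (rule card_1_singletonE)
    have "\<tau> \<subseteq> insert h \<alpha>" "h \<in> \<beta>" "h \<in> HH" using h \<tau>(1) fin(2) by auto
    then show ?thesis
      using infe feasible_mono[of "insert h \<alpha>" \<tau>] contra[of h \<beta>] compl[of h]
      by (intro bexI[of _ "- h"]) auto
  next
    assume "card (\<tau> \<inter> \<alpha>) \<le> 1"
    moreover have "\<tau> \<inter> \<alpha> \<noteq> {}" using infe \<beta>(3) \<tau>(1) feasible_mono[of \<beta> \<tau>] by auto
    ultimately have "card (\<tau> \<inter> \<alpha>) = 1" using fin(1) by (simp add: le_Suc_eq)
    then obtain h where h: "\<tau> \<inter> \<alpha> = {h}" by (rule card_1_singletonE)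
    have "\<tau> \<subseteq> insert h \<beta>" "h \<in> \<alpha>" "h \<in> HH" using h \<tau>(1) fin(2) by auto
    then show ?thesis
      using infe feasible_mono[of "insert h \<beta>" \<tau>] contra[of h \<alpha>]
      by (intro bexI[of _ h]) auto
  qed
qed

lemma infeasible_uminus:
  assumes \<sigma>: "\<sigma> \<subseteq> HH" "finite \<sigma>" "\<not> feasible \<sigma>"
    and pairs: "\<And>a b. a \<in> \<sigma> \<Longrightarrow> b \<in> \<sigma> \<Longrightarrow> feasible {a, b}" and ne: "V \<noteq> {}"
  shows "\<not> feasible (uminus ` \<sigma>)"
proof -
  from exists_minimal_infeasible[OF \<sigma>(2,3)]
  obtain \<tau> where \<tau>: "\<tau> \<subseteq> \<sigma>" "minimal_infeasible \<tau>" by (elim exE conjE)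
  have fin: "finite \<tau>" "\<tau> \<subseteq> HH" using finite_subset[OF \<tau>(1)] \<tau>(1) \<sigma>(1,2) by auto
  have infe: "\<not> feasible \<tau>" using \<tau>(2) unfolding minimal_infeasible_def by simp
  have "card \<tau> \<noteq> 0" using infe ne fin(1) unfolding feasible_def by auto
  moreover have "card \<tau> \<noteq> 1"
  proof
    assume "card \<tau> = 1"
    then obtain a where "\<tau> = {a}" by (rule card_1_singletonE)
    then show False using infe pairs[of a a] \<tau>(1) by simp
  qed
  moreover have "card \<tau> \<noteq> 2"
  proof
    assume "card \<tau> = 2"
    then obtain a b where "\<tau> = {a, b}" by (auto simp: card_2_iff)
    then show False using infe pairs[of a b] \<tau>(1) by simp
  qed
  ultimately have "card \<tau> = 3"
    using minimal_infeasible_card[OF \<tau>(2) fin(2,1)] by linarith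
  then obtain a b c where abc: "\<tau> = {a, b, c}" "a \<noteq> b" "a \<noteq> c" "b \<noteq> c"
    by (auto simp: card_3_iff)
  have "\<not> feasible ({- a, - b, - c} \<union> (\<tau> - {a, b, c}))"
    using minimal_infeasible_flip_three[OF \<tau>(2) fin(2,1), of a b c] abc by simp
  then have "\<not> feasible (uminus ` \<tau>)" using abc(1) by simp
  then show ?thesis using \<tau>(1) feasible_mono[of "uminus ` \<sigma>" "uminus ` \<tau>"] by auto
qed

end

section \<open>Antipodal systems of halfspaces\<close>

text \<open>The assumption \<open>pairs\<close> expresses that halfspaces of different coordinates cross in all four ways.\<close>

locale antipodal_system = halfspace_system V HH for V :: "'p set" and HH +
  assumes finite_halfspaces: "finite HH"
    and antipode: "x \<in> V \<Longrightarrow> \<exists>y\<in>V. \<forall>h\<in>HH. y \<in> h \<longleftrightarrow> x \<notin> h"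
    and pairs: "a \<in> HH \<Longrightarrow> b \<in> HH \<Longrightarrow> a \<noteq> - b \<Longrightarrow> feasible {a, b}"
    and separating: "\<lbrakk>\<alpha> \<subseteq> HH; \<beta> \<subseteq> HH; feasible \<alpha>; feasible \<beta>; \<not> feasible (\<alpha> \<union> \<beta>)\<rbrakk>
      \<Longrightarrow> \<exists>e\<in>HH. \<not> feasible (insert (- e) \<alpha>) \<and> \<not> feasible (insert e \<beta>)"
begin

lemma feasible2: "feasible {a, b} \<longleftrightarrow> (\<exists>x\<in>V. x \<in> a \<and> x \<in> b)"
  and feasible3: "feasible {a, b, c} \<longleftrightarrow> (\<exists>x\<in>V. x \<in> a \<and> x \<in> b \<and> x \<in> c)"
  and feasible4: "feasible {a, b, c, d} \<longleftrightarrow> (\<exists>x\<in>V. x \<in> a \<and> x \<in> b \<and> x \<in> c \<and> x \<in> d)"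
  by (auto simp: feasible_def)

lemma feasible_antipode:
  assumes "feasible \<sigma>" "\<sigma> \<subseteq> HH"
  shows "feasible (uminus ` \<sigma>)"
proof -
  obtain x where x: "x \<in> V" "\<forall>h\<in>\<sigma>. x \<in> h" using assms(1) unfolding feasible_def by (elim bexE)
  obtain y where y: "y \<in> V" "\<forall>h\<in>HH. y \<in> h \<longleftrightarrow> x \<notin> h" using antipode[OF x(1)] by (elim bexE)
  have "y \<in> - h" if "h \<in> \<sigma>" for h
    using x(2) y(2) assms(2) that by (metis ComplI subsetD)
  then show ?thesis using y(1) by (intro feasibleI[of y]) auto
qed

lemma feasible3_antipode:
  assumes "a \<in> HH" "b \<in> HH" "c \<in> HH"
  shows "feasible {- a, - b, - c} \<longleftrightarrow> feasible {a, b, c}"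
  using feasible_antipode[of "{a, b, c}"] feasible_antipode[of "{- a, - b, - c}"] assms compl by auto

text \<open>The triple is meant to span at most a plane. Degenerate triples, in which two members
  belong to the same coordinate, are dependent as well, which saves case distinctions in the
  exchange arguments below.\<close>

definition dependent :: "'p set \<Rightarrow> 'p set \<Rightarrow> 'p set \<Rightarrow> bool" where
  "dependent a b c \<longleftrightarrow> (\<exists>a'\<in>{a, - a}. \<exists>b'\<in>{b, - b}. \<exists>c'\<in>{c, - c}. \<not> feasible {a', b', c'})"

lemma dependentI: "\<not> feasible {a', b', c'} \<Longrightarrow> a' \<in> {a, - a} \<Longrightarrow> b' \<in> {b, - b} \<Longrightarrow> c' \<in> {c, - c}
    \<Longrightarrow> dependent a b c"
  unfolding dependent_def by blast

lemma dependent_commute: "dependent a b c \<longleftrightarrow> dependent b a c" "dependent a b c \<longleftrightarrow> dependent a c b"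
  unfolding dependent_def by (auto simp: insert_commute)

lemma dependent_uminus [simp]:
  "dependent (- a) b c \<longleftrightarrow> dependent a b c"
  "dependent a (- b) c \<longleftrightarrow> dependent a b c"
  "dependent a b (- c) \<longleftrightarrow> dependent a b c"
  unfolding dependent_def by auto

lemma dependent_degenerate: "dependent a b b"
  by (rule dependentI[of a b "- b"]) (auto simp: feasible3)

lemma dependentE:
  assumes "dependent a b c" "a \<in> HH" "b \<in> HH" "c \<in> HH"
  obtains b' c' where "b' \<in> {b, - b}" "c' \<in> {c, - c}" "\<not> feasible {a, b', c'}"
proof -
  obtain a' b' c' where abc: "a' \<in> {a, - a}" "b' \<in> {b, - b}" "c' \<in> {c, - c}" "\<not> feasible {a', b', c'}"
    using assms(1) unfolding dependent_def by blast
  have "b' \<in> HH" "c' \<in> HH" using abc assms compl by auto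
  show thesis
  proof (cases "a' = a")
    case True
    then show thesis using abc that by blast
  next
    case False
    then have "a' = - a" using abc by simp
    then have "\<not> feasible {a, - b', - c'}"
      using feasible3_antipode[of a "- b'" "- c'"] abc(4) assms(2) compl \<open>b' \<in> HH\<close> \<open>c' \<in> HH\<close> by simp
    then show thesis using that[of "- b'" "- c'"] abc(2,3) by auto
  qed
qed

text \<open>Two planes with two common independent directions coincide. After choosing signs, \<open>q\<close> is decided
  by \<open>r\<close> and by \<open>s\<close> on the side \<open>p\<close>. If the two decisions are opposite, an octant of \<open>p\<close>, \<open>r\<close>, \<open>s\<close> is
  empty at once. If they agree, all octants being met would yield points \<open>x\<close> and \<open>y\<close> differing in
  exactly \<open>p\<close> and \<open>q\<close> among the four, both of whose intermediate patterns are empty.\<close>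

lemma dependent_exchange:
  assumes HH: "p \<in> HH" "q \<in> HH" "r \<in> HH" "s \<in> HH" and pq: "p \<noteq> q" "p \<noteq> - q"
    and r: "dependent p q r" and s: "dependent p q s"
  shows "dependent p r s"
proof (rule ccontr)
  assume free: "\<not> dependent p r s"
  obtain q1 r' where q1: "q1 \<in> {q, - q}" "r' \<in> {r, - r}" "\<not> feasible {p, q1, r'}"
    using dependentE[OF r HH(1,2,3)] .
  obtain q2 s' where q2: "q2 \<in> {q, - q}" "s' \<in> {s, - s}" "\<not> feasible {p, q2, s'}"
    using dependentE[OF s HH(1,2,4)] .
  have HH': "q1 \<in> HH" "r' \<in> HH" "s' \<in> HH" using q1 q2 HH compl by auto
  have octant: "feasible {p', r'', s''}"
    if "p' \<in> {p, - p}" "r'' \<in> {r', - r'}" "s'' \<in> {s', - s'}" for p' r'' s''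
    using free that q1(2) q2(2) dependentI[of p' r'' s'' p r s] by auto
  show False
  proof (cases "q2 = q1")
    case False
    then have "q2 = - q1" using q1 q2 by auto
    obtain x where "x \<in> V" "x \<in> p" "x \<in> r'" "x \<in> s'" using octant[of p r' s'] by (auto simp: feasible3)
    then show False using q1(3) q2(3) \<open>q2 = - q1\<close> by (auto simp: feasible3)
  next
    case True
    note q2 = q2[unfolded True]
    have q1': "\<not> feasible {- p, - q1, - r'}"
      using feasible3_antipode[of p q1 r'] HH HH' q1(3) by simp
    obtain x where x: "x \<in> V" "x \<in> p" "x \<notin> r'" "x \<in> s'"
      using octant[of p "- r'" s'] by (auto simp: feasible3)
    obtain y where y: "y \<in> V" "y \<notin> p" "y \<notin> r'" "y \<in> s'"
      using octant[of "- p" "- r'" s'] by (auto simp: feasible3)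
    have xq: "x \<notin> q1" using q2(3) x by (auto simp: feasible3)
    have yq: "y \<in> q1" using q1' y by (auto simp: feasible3)
    have "p \<noteq> - q1" using pq q1(1) by auto
    then obtain z where z: "z \<in> V" "\<forall>h\<in>HH. x \<in> h \<longrightarrow> y \<in> h \<longrightarrow> z \<in> h" "z \<in> p \<longleftrightarrow> z \<in> q1"
      using link[OF HH(1) HH'(1) _ x(1) y(1) x(2) xq y(2) yq] by auto
    have "z \<in> s'" "z \<in> - r'"
      using bspec[OF z(2) HH'(3)] bspec[OF z(2) compl[OF HH'(2)]] x y by auto
    then show False using z(1,3) q2(3) q1' by (auto simp: feasible3)
  qed
qed

definition circuit4 :: "'p set \<Rightarrow> 'p set \<Rightarrow> 'p set \<Rightarrow> 'p set \<Rightarrow> bool" where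
  "circuit4 a b c d \<longleftrightarrow> {a, b, c, d} \<subseteq> HH \<and> \<not> feasible {a, b, c, d} \<and>
     feasible {a, b, c} \<and> feasible {a, b, d} \<and> feasible {a, c, d} \<and> feasible {b, c, d}"

lemma circuit4_commute: "circuit4 a b c d \<longleftrightarrow> circuit4 b a c d" "circuit4 a b c d \<longleftrightarrow> circuit4 a c b d"
  "circuit4 a b c d \<longleftrightarrow> circuit4 a b d c"
  unfolding circuit4_def by (auto simp: insert_commute)

text \<open>Each triple inside the circuit forces the complement of the fourth member. This realizes
  every octant up to taking antipodes.\<close>

lemma circuit4_independent:
  assumes "circuit4 a b c d"
  shows "\<not> dependent a b c"
proof
  assume dep: "dependent a b c"
  have HH: "a \<in> HH" "b \<in> HH" "c \<in> HH" using assms by (auto simp: circuit4_def)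
  obtain b' c' where b'c': "b' \<in> {b, - b}" "c' \<in> {c, - c}" "\<not> feasible {a, b', c'}"
    using dependentE[OF dep HH] .
  have "feasible {a, b, c}" using assms by (simp add: circuit4_def)
  moreover have "feasible {a, b, - c}" "feasible {a, - b, c}" "feasible {- a, b, c}"
    using assms by (auto simp: circuit4_def feasible3 feasible4)
  moreover have "feasible {a, - b, - c}"
    using feasible3_antipode[of a "- b" "- c"] HH compl \<open>feasible {- a, b, c}\<close> by simp
  ultimately show False using b'c' by auto
qed

text \<open>The separating halfspace is neither of the four nor a complement, as each triple of the
  circuit is feasible.\<close>

lemma circuit4_split:
  assumes "circuit4 a b c d"
  obtains e where "e \<in> HH" "\<not> feasible {a, b, - e}" "\<not> feasible {c, d, e}"
    "e \<notin> {a, - a, b, - b, c, - c, d, - d}"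
proof -
  have pre: "{a, b} \<subseteq> HH" "{c, d} \<subseteq> HH" "feasible {a, b}" "feasible {c, d}"
    "\<not> feasible ({a, b} \<union> {c, d})"
    using assms by (auto simp: circuit4_def feasible2 feasible3 insert_commute)
  then obtain e where e: "e \<in> HH" "\<not> feasible {- e, a, b}" "\<not> feasible {e, c, d}"
    using separating[OF pre] by (elim bexE conjE)
  have "e \<notin> {a, - a, b, - b, c, - c, d, - d}"
    using assms e(2,3) by (auto simp: circuit4_def feasible3 feasible4)
  moreover have "{a, b, - e} = {- e, a, b}" "{c, d, e} = {e, c, d}" by auto
  ultimately show thesis using that[of e] e by simp
qed

text \<open>If \<open>e\<close> lies in the plane of \<open>a\<close>, \<open>b\<close> and \<open>f\<close> in the plane of \<open>a\<close>, \<open>c\<close>, then \<open>a\<close>, \<open>e\<close>, \<open>f\<close> span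
  the same space as \<open>a\<close>, \<open>b\<close>, \<open>c\<close>.\<close>

lemma independent_exchange:
  assumes HH: "a \<in> HH" "b \<in> HH" "c \<in> HH" "e \<in> HH" "f \<in> HH" and "\<not> dependent a b c"
    and e: "dependent a b e" "e \<notin> {a, - a}" and f: "dependent a c f" "f \<notin> {a, - a}"
  shows "\<not> dependent a e f"
proof
  assume "dependent a e f"
  moreover have "dependent a e b" using e dependent_commute by blast
  moreover have "a \<noteq> e" "a \<noteq> - e" "a \<noteq> f" "a \<noteq> - f" using e f by auto
  ultimately have "dependent a b f" using dependent_exchange[of a e b f] HH by blast
  then have "dependent a f b" "dependent a f c" using f dependent_commute by blast+
  then have "dependent a b c" using dependent_exchange[of a f b c] HH \<open>a \<noteq> f\<close> \<open>a \<noteq> - f\<close> by blast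
  then show False using assms by blast
qed

lemma independent_feasible:
  assumes "\<not> dependent a b c"
  shows "feasible {a, b, c}" "feasible {a, b, - c}" "feasible {a, - b, c}" "feasible {- a, b, c}"
    "feasible {a, - b, - c}" "feasible {- a, b, - c}" "feasible {- a, - b, c}" "feasible {- a, - b, - c}"
  using assms unfolding dependent_def by auto

text \<open>In terms of vectors with \<open>a + b + c + d = 0\<close> this is the circuit
  \<open>e + f + g - 2 a = 0\<close> for \<open>e = a + b\<close>, \<open>f = a + c\<close>, \<open>g = a + d\<close>.\<close>

lemma circuit4_diagonals:
  assumes C: "circuit4 a b c d" and HH: "e \<in> HH" "f \<in> HH" "g \<in> HH"
    and e: "\<not> feasible {a, b, - e}" "\<not> feasible {c, d, e}" "e \<notin> {a, - a}"
    and f: "\<not> feasible {a, c, - f}" "\<not> feasible {b, d, f}" "f \<notin> {a, - a}"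
    and g: "\<not> feasible {a, d, - g}" "\<not> feasible {b, c, g}" "g \<notin> {a, - a}"
  shows "circuit4 e f g (- a)"
proof -
  have abcd: "a \<in> HH" "b \<in> HH" "c \<in> HH" "d \<in> HH" using C by (auto simp: circuit4_def)
  have "\<not> dependent a b c" "\<not> dependent a b d" "\<not> dependent a c d"
    using circuit4_independent[of a b c d] circuit4_independent[of a b d c]
      circuit4_independent[of a c d b] C circuit4_commute by blast+
  moreover have "dependent a b e" "dependent a c f" "dependent a d g"
    using dependentI[OF e(1)] dependentI[OF f(1)] dependentI[OF g(1)] by auto
  ultimately have "\<not> dependent a e f" "\<not> dependent a e g" "\<not> dependent a f g"
    using independent_exchange[of a b c e f] independent_exchange[of a b d e g]
      independent_exchange[of a c d f g] abcd HH e(3) f(3) g(3) by simp_all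
  then have two: "feasible {- a, e, f}" "feasible {- a, e, g}" "feasible {- a, f, g}"
    using independent_feasible by blast+
  have "feasible {- e, - f, - g}"
  proof -
    have "feasible {b, c, d}" using C by (simp add: circuit4_def)
    then show ?thesis using e(2) f(2) g(2) by (auto simp: feasible3)
  qed
  then have "feasible {e, f, g}" using feasible3_antipode HH by simp
  moreover have "\<not> feasible {e, f, g, - a}"
  proof
    assume "feasible {e, f, g, - a}"
    then obtain x where x: "x \<in> V" "x \<in> e" "x \<in> f" "x \<in> g" "x \<notin> a" by (auto simp: feasible4)
    have "\<not> feasible {- a, - b, e}" "\<not> feasible {- a, - c, f}" "\<not> feasible {- a, - d, g}"
      using e(1) f(1) g(1) feasible3_antipode[of a b "- e"] feasible3_antipode[of a c "- f"]
        feasible3_antipode[of a d "- g"] abcd HH compl by simp_all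
    then have "x \<in> c" "x \<in> d" using x by (auto simp: feasible3)
    then show False using x e(2) by (auto simp: feasible3)
  qed
  moreover have "{e, f, - a} = {- a, e, f}" "{e, g, - a} = {- a, e, g}" "{f, g, - a} = {- a, f, g}"
    by auto
  ultimately show ?thesis using two HH abcd compl by (simp add: circuit4_def)
qed

text \<open>The descent. With \<open>e\<close>, \<open>f\<close>, \<open>g\<close> standing for \<open>a + b\<close>, \<open>a + c\<close>, \<open>a + d\<close> and a further \<open>k\<close> standing for
  \<open>e + f = a + e + c\<close>, the halfspaces \<open>a\<close>, \<open>e\<close>, \<open>c\<close>, \<open>- k\<close> form a circuit again. Its first pair is narrower:
  since \<open>e\<close> lies strictly between \<open>a\<close> and \<open>b\<close>, fewer halfspaces contain the intersection of \<open>a\<close> and \<open>e\<close>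
  than contain that of \<open>a\<close> and \<open>b\<close>.\<close>

lemma no_circuit4: "\<not> circuit4 a b c d"
proof (induction "card {h \<in> HH. \<not> feasible {a, b, - h}}" arbitrary: a b c d rule: less_induct)
  case less
  show ?case
  proof
    assume C: "circuit4 a b c d"
    have abcd: "a \<in> HH" "b \<in> HH" "c \<in> HH" "d \<in> HH" using C by (auto simp: circuit4_def)
    obtain e where e: "e \<in> HH" "\<not> feasible {a, b, - e}" "\<not> feasible {c, d, e}"
      "e \<notin> {a, - a, b, - b, c, - c, d, - d}"
      using circuit4_split[OF C] .
    obtain f where f: "f \<in> HH" "\<not> feasible {a, c, - f}" "\<not> feasible {b, d, f}"
      "f \<notin> {a, - a, c, - c, b, - b, d, - d}"
      using circuit4_split[of a c b d] C circuit4_commute by metis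
    have "circuit4 a d b c" using C circuit4_commute by metis
    then obtain g where g: "g \<in> HH" "\<not> feasible {a, d, - g}" "\<not> feasible {b, c, g}"
      "g \<notin> {a, - a, d, - d, b, - b, c, - c}"
      using circuit4_split[of a d b c] by metis
    have C': "circuit4 e f g (- a)"
      using circuit4_diagonals[OF C e(1) f(1) g(1) e(2,3) _ f(2,3) _ g(2,3)] e(4) f(4) g(4) by auto
    obtain k where k: "k \<in> HH" "\<not> feasible {e, f, - k}" "\<not> feasible {g, - a, k}"
      "k \<notin> {e, - e, f, - f, g, - g, - a, - (- a)}"
      using circuit4_split[OF C'] .
    have abc: "\<not> dependent a b c" using circuit4_independent[OF C] .
    have "circuit4 (- a) e f g" using C' circuit4_commute by metis
    then have aef: "\<not> dependent a e f" using circuit4_independent[of "- a" e f g] by simp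
    have efk: "dependent e f k" using dependentI[OF k(2)] by auto
    have abe: "dependent a b e" using dependentI[OF e(2)] by auto
    have acf: "dependent a c f" using dependentI[OF f(2)] by auto
    have swap: "u \<noteq> v \<and> u \<noteq> - v" if "v \<noteq> u" "v \<noteq> - u" for u v :: "'p set"
      using that by auto
    have n1: "e \<noteq> a" "e \<noteq> - a" using e(4) unfolding insert_iff by blast+
    have n2: "k \<noteq> e" "k \<noteq> - e" "k \<noteq> f" "k \<noteq> - f" using k(4) unfolding insert_iff by blast+
    have n3: "f \<noteq> c" "f \<noteq> - c" using f(4) unfolding insert_iff by blast+
    have ne: "a \<noteq> e" "a \<noteq> - e" "e \<noteq> k" "e \<noteq> - k" "f \<noteq> k" "f \<noteq> - k" "c \<noteq> f" "c \<noteq> - f"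
      using swap[of e a] swap[of k e] swap[of k f] swap[of f c] n1 n2 n3 by blast+
    have "\<not> dependent a e k"
    proof
      assume "dependent a e k"
      then have "dependent e k a" "dependent e k f" using efk dependent_commute by blast+
      then have "dependent e a f"
        using dependent_exchange[OF e(1) k(1) abcd(1) f(1) ne(3,4)] by blast
      then show False using aef dependent_commute by blast
    qed
    moreover have "\<not> dependent e c k"
    proof
      assume "dependent e c k"
      then have "dependent e k c" "dependent e k f" using efk dependent_commute by blast+
      then have "dependent e c f"
        using dependent_exchange[OF e(1) k(1) abcd(3) f(1) ne(3,4)] by blast
      then have "dependent c f e" "dependent c f a" using acf dependent_commute by blast+
      then have "dependent c e a"
        using dependent_exchange[OF abcd(3) f(1) e(1) abcd(1) ne(7,8)] by blast
      then have "dependent a e c" "dependent a e b" using abe dependent_commute by blast+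
      then have "dependent a c b"
        using dependent_exchange[OF abcd(1) e(1) abcd(3,2) ne(1,2)] by blast
      then show False using abc dependent_commute by blast
    qed
    moreover have "\<not> dependent a c k"
    proof
      assume ack: "dependent a c k"
      have "a \<noteq> c" "a \<noteq> - c"
        using abc dependent_degenerate[of a b] dependent_degenerate[of b a] dependent_commute
          dependent_uminus by metis+
      then have "dependent a k f"
        using dependent_exchange[OF abcd(1,3) k(1) f(1) _ _ ack acf] by blast
      then have "dependent f k a" "dependent f k e" using efk dependent_commute by blast+
      then have "dependent f a e"
        using dependent_exchange[OF f(1) k(1) abcd(1) e(1) ne(5,6)] by blast
      then show False using aef dependent_commute by blast
    qed
    ultimately have "feasible {a, e, - k}" "feasible {e, c, - k}" "feasible {a, c, - k}"
      using independent_feasible by blast+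
    moreover have "feasible {a, e, c}"
      using C e(2) by (auto simp: circuit4_def feasible3)
    \<comment> \<open>Here \<open>a\<close> and \<open>c\<close> force \<open>f\<close>, and \<open>e\<close> and \<open>f\<close> force \<open>k\<close>.\<close>
    moreover have "\<not> feasible {a, e, c, - k}"
      using f(2) k(2) by (auto simp: feasible3 feasible4)
    ultimately have C'': "circuit4 a e c (- k)"
      using abcd e(1) k(1) compl unfolding circuit4_def by auto
    have "{h \<in> HH. \<not> feasible {a, e, - h}} \<subset> {h \<in> HH. \<not> feasible {a, b, - h}}"
    proof
      show "{h \<in> HH. \<not> feasible {a, e, - h}} \<subseteq> {h \<in> HH. \<not> feasible {a, b, - h}}"
        using e(2) by (auto simp: feasible3)
      \<comment> \<open>Otherwise \<open>b\<close> and \<open>e\<close> would have the same trace on \<open>V\<close>.\<close>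
      have "feasible {a, e, - b}"
      proof (rule ccontr)
        assume neg: "\<not> feasible {a, e, - b}"
        then have "\<not> feasible {- a, - e, b}"
          using feasible3_antipode[of a e "- b"] abcd e(1) compl by simp
        moreover have "e \<noteq> b" using e(4) unfolding insert_iff by blast
        then have "feasible {b, - e}" using pairs[OF abcd(2) compl[OF e(1)]] by auto
        ultimately show False using e(2) by (auto simp: feasible2 feasible3)
      qed
      then have "b \<notin> {h \<in> HH. \<not> feasible {a, e, - h}}" by simp
      moreover have "b \<in> {h \<in> HH. \<not> feasible {a, b, - h}}" using abcd by (auto simp: feasible3)
      ultimately show "{h \<in> HH. \<not> feasible {a, e, - h}} \<noteq> {h \<in> HH. \<not> feasible {a, b, - h}}"
        by blast
    qed
    then have "card {h \<in> HH. \<not> feasible {a, e, - h}} < card {h \<in> HH. \<not> feasible {a, b, - h}}"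
      using finite_halfspaces by (intro psubset_card_mono) auto
    from less[OF this] C'' show False by blast
  qed
qed

text \<open>A minimal infeasible set with more than four members is shortened: separate two of its members
  from the rest by \<open>e\<close> and replace these two by \<open>e\<close>. Minimality persists because the two
  members together imply \<open>e\<close>. The descent ends at four members, a circuit.\<close>

lemma antipodal_minimal_infeasible_card:
  assumes "minimal_infeasible \<sigma>" "\<sigma> \<subseteq> HH"
  shows "card \<sigma> \<le> 3"
  using assms
proof (induction "card \<sigma>" arbitrary: \<sigma> rule: less_induct)
  case less
  have fin: "finite \<sigma>" using less.prems(2) finite_halfspaces finite_subset by blast
  have drop: "feasible \<tau>" if "\<tau> \<subseteq> \<sigma>" "h \<in> \<sigma>" "h \<notin> \<tau>" for \<tau> h
    using minimal_infeasible_drop[OF less.prems(1) that(2)] feasible_mono[of "\<sigma> - {h}" \<tau>] that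
    by blast
  show ?case
  proof (rule ccontr)
    assume big: "\<not> card \<sigma> \<le> 3"
    then have "4 \<le> card \<sigma>" by simp
    then obtain A where A: "A \<subseteq> \<sigma>" "card A = 4" by (meson obtain_subset_with_card_n)
    from A(2) obtain a b c d where A4: "A = {a, b, c, d}" and ne: "a \<noteq> b" "a \<noteq> c" "a \<noteq> d" "b \<noteq> c" "b \<noteq> d" "c \<noteq> d"
      by (rule card_4E)
    have mem: "a \<in> \<sigma>" "b \<in> \<sigma>" "c \<in> \<sigma>" "d \<in> \<sigma>" using A(1) A4 by simp_all
    have inf: "\<not> feasible \<sigma>" using less.prems by (simp add: minimal_infeasible_def)
    show False
    proof (cases "\<sigma> = A")
      case True
      have "feasible {a, b, c}" "feasible {a, b, d}" "feasible {a, c, d}" "feasible {b, c, d}"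
        using drop[of "{a, b, c}" d] drop[of "{a, b, d}" c] drop[of "{a, c, d}" b]
          drop[of "{b, c, d}" a] mem ne by auto
      then have "circuit4 a b c d"
        using True A4 inf less.prems(2) by (simp add: circuit4_def)
      then show False using no_circuit4 by blast
    next
      case False
      then have "card A < card \<sigma>" using psubset_card_mono[OF fin, of A] A by auto
      then have five: "5 \<le> card \<sigma>" using A by simp
      let ?\<beta> = "\<sigma> - {a, b}"
      have "feasible {a, b}" using drop[of "{a, b}" c] mem ne by auto
      moreover have "feasible ?\<beta>" using drop[of ?\<beta> a] mem by auto
      moreover have "{a, b} \<union> ?\<beta> = \<sigma>" using mem by auto
      ultimately obtain e where e: "e \<in> HH" "\<not> feasible (insert (- e) {a, b})" "\<not> feasible (insert e ?\<beta>)"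
        using separating[of "{a, b}" ?\<beta>] inf mem less.prems(2) by auto
      have sub: "feasible (insert e \<gamma>)" if \<gamma>: "\<gamma> \<subseteq> ?\<beta>" "h \<in> ?\<beta>" "h \<notin> \<gamma>" for \<gamma> h
      proof -
        have "feasible ({a, b} \<union> \<gamma>)" using drop[of "{a, b} \<union> \<gamma>" h] \<gamma> mem by auto
        then obtain x where x: "x \<in> V" "x \<in> a" "x \<in> b" "\<forall>h\<in>\<gamma>. x \<in> h" by (auto simp: feasible_def)
        then have "x \<in> e" using e(2) by (auto simp: feasible3)
        then show ?thesis using x by (intro feasibleI[of x]) auto
      qed
      have "e \<notin> ?\<beta>" 
      proof
        assume "e \<in> ?\<beta>"
        then have "\<not> feasible ?\<beta>" using e(3) by (simp add: insert_absorb)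
        then show False using \<open>feasible ?\<beta>\<close> by blast
      qed
      then have "minimal_infeasible (insert e ?\<beta>)"
        using e(3) sub[of "?\<beta> - {h}" h for h] \<open>feasible ?\<beta>\<close>
        unfolding minimal_infeasible_def by (auto simp: insert_Diff_if)
      moreover have c: "card (insert e ?\<beta>) = card \<sigma> - 1"
        using \<open>e \<notin> ?\<beta>\<close> fin mem ne five by (simp add: card_Diff_subset)
      ultimately have "card (insert e ?\<beta>) \<le> 3"
        using less.hyps[of "insert e ?\<beta>"] five e(1) less.prems(2) by auto
      then show False using c five by linarith
    qed
  qed
qed

lemma helly:
  assumes "\<sigma> \<subseteq> HH" "V \<noteq> {}" and three: "\<And>a b c. \<lbrakk>a \<in> \<sigma>; b \<in> \<sigma>; c \<in> \<sigma>\<rbrakk> \<Longrightarrow> feasible {a, b, c}"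
  shows "feasible \<sigma>"
proof (rule ccontr)
  assume inf: "\<not> feasible \<sigma>"
  have "finite \<sigma>" using assms finite_halfspaces finite_subset by blast
  from exists_minimal_infeasible[OF this inf]
  obtain \<tau> where \<tau>: "\<tau> \<subseteq> \<sigma>" "minimal_infeasible \<tau>" by (elim exE conjE)
  have "card \<tau> \<le> 3" using antipodal_minimal_infeasible_card[OF \<tau>(2)] \<tau>(1) assms(1) by auto
  have "finite \<tau>" using \<open>finite \<sigma>\<close> \<tau>(1) finite_subset by blast
  have infe: "\<not> feasible \<tau>" using \<tau>(2) by (simp add: minimal_infeasible_def)
  then have "\<tau> \<noteq> {}" using assms(2) by (auto simp: feasible_def)
  have "\<exists>a b c. \<tau> = {a, b, c}"
  proof -
    have "card \<tau> = 1 \<or> card \<tau> = 2 \<or> card \<tau> = 3"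
      using \<open>card \<tau> \<le> 3\<close> \<open>\<tau> \<noteq> {}\<close> \<open>finite \<tau>\<close> card_0_eq by fastforce
    then show ?thesis by (auto simp: card_1_singleton_iff card_2_iff card_3_iff)
  qed
  then obtain a b c where "\<tau> = {a, b, c}" by blast
  then show False using infe three[of a b c] \<tau>(1) by auto
qed

lemma infeasible_triple:
  assumes "\<sigma> \<subseteq> HH" "V \<noteq> {}" "\<not> feasible \<sigma>"
  obtains a b c where "{a, b, c} \<subseteq> \<sigma>" "\<not> feasible {a, b, c}"
proof (rule ccontr)
  assume "\<not> thesis"
  then have "feasible {a, b, c}" if "a \<in> \<sigma>" "b \<in> \<sigma>" "c \<in> \<sigma>" for a b c
    using \<open>\<And>a b c. {a, b, c} \<subseteq> \<sigma> \<Longrightarrow> \<not> feasible {a, b, c} \<Longrightarrow> thesis\<close>[of a b c] that by auto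
  then show False using helly[OF assms(1,2)] assms(3) by simp
qed

text \<open>Two dependent triples through \<open>a\<close> lie in one plane: with vectors \<open>b = e - a\<close> and \<open>c = f - a\<close>
  the relation \<open>e - b = f - c\<close> makes four halfspaces infeasible, and by Helly three of them.\<close>

lemma dependent_merge:
  assumes HH: "a \<in> HH" "b \<in> HH" "e \<in> HH" "c \<in> HH" "f \<in> HH"
    and e: "dependent a b e" "e \<notin> {a, - a, b, - b}" and f: "dependent a c f" "f \<notin> {a, - a, c, - c}"
  shows "dependent a b c"
proof -
  obtain b' e' where b'e': "b' \<in> {b, - b}" "e' \<in> {e, - e}" "\<not> feasible {- a, b', e'}"
    using dependentE[of "- a" b e] e(1) HH compl by (metis dependent_uminus(1))
  obtain c' f' where c'f': "c' \<in> {c, - c}" "f' \<in> {f, - f}" "\<not> feasible {a, c', f'}"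
    using dependentE[of a c f] f(1) HH by metis
  have HH': "{b', e', c', f'} \<subseteq> HH" using b'e' c'f' HH compl by auto
  have "\<not> feasible {b', e', c', f'}"
    using b'e'(3) c'f'(3) by (auto simp: feasible3 feasible4)
  moreover have "V \<noteq> {}"
  proof -
    have "feasible {a, a}" by (rule pairs) (use HH in auto)
    then show ?thesis by (auto simp: feasible_def)
  qed
  ultimately obtain x y z where xyz: "{x, y, z} \<subseteq> {b', e', c', f'}" "\<not> feasible {x, y, z}"
    using infeasible_triple[OF HH'] by metis
  have be: "b \<noteq> e" "b \<noteq> - e" and ae: "a \<noteq> e" "a \<noteq> - e" and af: "a \<noteq> f" "a \<noteq> - f" and cf: "c \<noteq> f" "c \<noteq> - f"
    using e(2) f(2) by auto
  have "dependent b e c \<or> dependent b e f \<or> dependent c f b \<or> dependent c f e"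
  proof -
    have "{x, y, z} \<subseteq> {b', e', c'} \<or> {x, y, z} \<subseteq> {b', e', f'} \<or> {x, y, z} \<subseteq> {c', f', b'}
        \<or> {x, y, z} \<subseteq> {c', f', e'}"
      using xyz(1) unfolding insert_subset by (elim conjE insertE emptyE; simp)
    then show ?thesis
    proof (elim disjE)
      assume "{x, y, z} \<subseteq> {b', e', c'}"
      then have "\<not> feasible {b', e', c'}" using xyz(2) feasible_mono by metis
      then show ?thesis using dependentI[OF _ b'e'(1,2) c'f'(1)] by simp
    next
      assume "{x, y, z} \<subseteq> {b', e', f'}"
      then have "\<not> feasible {b', e', f'}" using xyz(2) feasible_mono by metis
      then show ?thesis using dependentI[OF _ b'e'(1,2) c'f'(2)] by simp
    next
      assume "{x, y, z} \<subseteq> {c', f', b'}"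
      then have "\<not> feasible {c', f', b'}" using xyz(2) feasible_mono by metis
      then show ?thesis using dependentI[OF _ c'f'(1,2) b'e'(1)] by simp
    next
      assume "{x, y, z} \<subseteq> {c', f', e'}"
      then have "\<not> feasible {c', f', e'}" using xyz(2) feasible_mono by metis
      then show ?thesis using dependentI[OF _ c'f'(1,2) b'e'(2)] by simp
    qed
  qed
  moreover have ?thesis if "dependent b e c"
    using dependent_exchange[OF HH(2,3,4,1) be that] e(1) dependent_commute by blast
  moreover have ?thesis if "dependent b e f"
  proof -
    have "dependent b f a"
      using dependent_exchange[OF HH(2,3,5,1) be that] e(1) dependent_commute by blast
    then have "dependent a f b" "dependent a f c" using f(1) dependent_commute by blast+
    then show ?thesis using dependent_exchange[OF HH(1,5,2,4) af] by blast
  qed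
  moreover have ?thesis if "dependent c f b"
    using dependent_exchange[OF HH(4,5,2,1) cf that] f(1) dependent_commute by blast
  moreover have ?thesis if "dependent c f e"
  proof -
    have "dependent c e a"
      using dependent_exchange[OF HH(4,5,3,1) cf that] f(1) dependent_commute by blast
    then have "dependent a e b" "dependent a e c" using e(1) dependent_commute by blast+
    then show ?thesis using dependent_exchange[OF HH(1,3,2,4) ae] by blast
  qed
  ultimately show ?thesis by blast
qed

end

section \<open>Graphs with cube coordinates\<close>

lemma connected_graphI:
  assumes "parcs G \<subseteq> pverts G \<times> pverts G" "sym (parcs G)" "irrefl (parcs G)" "pverts G \<noteq> {}"
    and reach: "\<And>u v. u \<in> pverts G \<Longrightarrow> v \<in> pverts G \<Longrightarrow> (u, v) \<in> (parcs G)\<^sup>*"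
  shows "connected_graph G"
proof -
  have bi: "pair_bidirected_digraph G"
    using assms(1-3) by unfold_locales (auto simp: symmetric_def irrefl_def)
  have ms: "mk_symmetric (with_proj G) = G"
    using assms(2) by (auto simp: mk_symmetric_def sym_def intro!: pair_pre_digraph.equality)
  have wf: "wf_digraph (with_proj G)"
    using assms(1) by unfold_locales auto
  have "u \<rightarrow>\<^sup>*\<^bsub>with_proj G\<^esub> v" if "u \<in> pverts G" "v \<in> pverts G" for u v
    using reach[OF that] wf_digraph.reachable_conv[OF wf, of u v] that by auto
  then have "connected (with_proj G)"
    unfolding connected_def strongly_connected_def ms using assms(4) by auto
  with bi show ?thesis unfolding connected_graph_def by blast
qed

lemma connected_graphD:
  assumes "connected_graph G"
  shows "parcs G \<subseteq> pverts G \<times> pverts G" "sym (parcs G)" "irrefl (parcs G)" "pverts G \<noteq> {}"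
    and "\<And>u v. u \<in> pverts G \<Longrightarrow> v \<in> pverts G \<Longrightarrow> (u, v) \<in> (parcs G)\<^sup>*"
proof -
  interpret pair_bidirected_digraph G using assms unfolding connected_graph_def by blast
  show "parcs G \<subseteq> pverts G \<times> pverts G" using arc_fst_in_verts arc_snd_in_verts by force
  show S: "sym (parcs G)" using pair_sym_arcs by (auto simp: symmetric_def)
  show "irrefl (parcs G)" using pair_no_loops by (fastforce simp: irrefl_def)
  have ms: "mk_symmetric (with_proj G) = G"
    using S by (auto simp: mk_symmetric_def sym_def intro!: pair_pre_digraph.equality)
  have sc: "strongly_connected (with_proj G)"
    using assms unfolding connected_graph_def connected_def ms by blast
  then show "pverts G \<noteq> {}" by (auto simp: strongly_connected_def)
  show "(u, v) \<in> (parcs G)\<^sup>*" if "u \<in> pverts G" "v \<in> pverts G" for u v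
    using sc that Digraph.reachable_rtranclI[where G = "with_proj G" and u = u and v = v] by (auto simp: strongly_connected_def)
qed

lemma gdist_relpow:
  assumes "connected_graph G" "u \<in> pverts G" "v \<in> pverts G"
  shows "(u, v) \<in> parcs G ^^ gdist G u v"
proof -
  have "\<exists>n. (u, v) \<in> parcs G ^^ n"
    using connected_graphD(5)[OF assms] by (simp add: rtrancl_power)
  then show ?thesis unfolding gdist_def by (rule LeastI_ex)
qed

lemma gdist_le: "(u, v) \<in> parcs G ^^ n \<Longrightarrow> gdist G u v \<le> n"
  unfolding gdist_def by (rule Least_le)

lemma gdist_step:
  assumes "connected_graph G" "u \<in> pverts G" "v \<in> pverts G" "gdist G u v = Suc n"
  obtains w where "(u, w) \<in> parcs G" "w \<in> pverts G" "gdist G w v = n"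
proof -
  obtain w where w: "(u, w) \<in> parcs G" "(w, v) \<in> parcs G ^^ n"
    using gdist_relpow[OF assms(1-3)] unfolding assms(4) by (meson relpow_Suc_E2)
  have wV: "w \<in> pverts G" using connected_graphD(1)[OF assms(1)] w by blast
  have "(u, v) \<in> parcs G ^^ Suc (gdist G w v)"
    using w(1) gdist_relpow[OF assms(1) wV assms(3)] by (meson relpow_Suc_I2)
  then have "gdist G u v \<le> Suc (gdist G w v)" by (rule gdist_le)
  moreover have "gdist G w v \<le> n" using w(2) by (rule gdist_le)
  ultimately show thesis using that[OF w(1) wV] assms(4) by simp
qed

lemma gdist_eq_0_iff:
  assumes "connected_graph G" "u \<in> pverts G" "v \<in> pverts G"
  shows "gdist G u v = 0 \<longleftrightarrow> u = v"
  using gdist_relpow[OF assms] gdist_le[of u u 0 G] by auto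

lemma gdist_eq_1_iff:
  assumes "connected_graph G" "u \<in> pverts G" "v \<in> pverts G"
  shows "gdist G u v = 1 \<longleftrightarrow> (u, v) \<in> parcs G"
proof
  assume "gdist G u v = 1"
  then show "(u, v) \<in> parcs G" using gdist_relpow[OF assms] by simp
next
  assume uv: "(u, v) \<in> parcs G"
  then have "gdist G u v \<le> 1" by (intro gdist_le) simp
  moreover have "u \<noteq> v" using uv connected_graphD(3)[OF assms(1)] by (auto simp: irrefl_def)
  ultimately show "gdist G u v = 1" using gdist_eq_0_iff[OF assms] by linarith
qed

definition separators :: "('a \<Rightarrow> 'i set) \<Rightarrow> 'a \<Rightarrow> 'a \<Rightarrow> 'i set" where
  "separators f x y = {i. i \<in> f x \<longleftrightarrow> i \<notin> f y}"

lemma separators_iff: "i \<in> separators f x y \<longleftrightarrow> (i \<in> f x \<longleftrightarrow> i \<notin> f y)"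
  by (simp add: separators_def)

lemma separators_self [simp]: "separators f x x = {}"
  and separators_sym: "separators f x y = separators f y x"
  and separators_trans: "separators f x z = sym_diff (separators f x y) (separators f y z)"
  by (auto simp: separators_def)

definition cube_coords :: "'a pair_pre_digraph \<Rightarrow> ('a \<Rightarrow> 'i set) \<Rightarrow> bool" where
  "cube_coords G f \<longleftrightarrow> connected_graph G \<and> (\<forall>x\<in>pverts G. \<forall>y\<in>pverts G.
     finite (separators f x y) \<and> gdist G x y = card (separators f x y))"

text \<open>Stepping closer again and again gives a walk as long as the Hamming distance, and no walk is
  shorter, since an arc changes one coordinate only.\<close>

lemma cube_coordsI:
  assumes arcs: "\<And>x y. (x, y) \<in> parcs G \<longleftrightarrow> x \<in> pverts G \<and> y \<in> pverts G \<and> card (separators f x y) = 1"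
    and ne: "pverts G \<noteq> {}"
    and fin: "\<And>x y. x \<in> pverts G \<Longrightarrow> y \<in> pverts G \<Longrightarrow> finite (separators f x y)"
    and step: "\<And>x y. x \<in> pverts G \<Longrightarrow> y \<in> pverts G \<Longrightarrow> x \<noteq> y \<Longrightarrow>
      \<exists>z\<in>pverts G. \<exists>i\<in>separators f x y. separators f x z = {i}"
  shows "cube_coords G f"
proof -
  have walk: "(x, y) \<in> parcs G ^^ card (separators f x y)" if "x \<in> pverts G" "y \<in> pverts G" for x y
    using that
  proof (induction "card (separators f x y)" arbitrary: x)
    case 0
    then have "separators f x y = {}" using fin by (metis card_0_eq)
    then have "x = y" using step[OF 0(2,3)] by auto
    then show ?case by simp
  next
    case (Suc n)
    then have "x \<noteq> y" by auto
    then obtain z i where z: "z \<in> pverts G" "i \<in> separators f x y" "separators f x z = {i}"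
      using step Suc by blast
    have "separators f z y = separators f x y - {i}"
      using z(2,3) separators_trans[of f z y x] separators_sym[of f z x] by auto
    then have n: "card (separators f z y) = n" using Suc.hyps(2) z(2) by simp
    then have "(z, y) \<in> parcs G ^^ n" using Suc.hyps(1)[of z] Suc.prems z by simp
    moreover have "(x, z) \<in> parcs G" using arcs z Suc.prems by simp
    ultimately show ?case unfolding Suc.hyps(2)[symmetric] by (meson relpow_Suc_I2)
  qed
  have short: "card (separators f x y) \<le> n" if "(x, y) \<in> parcs G ^^ n" "x \<in> pverts G" for n x y
    using that
  proof (induction n arbitrary: x)
    case (Suc n)
    obtain z where z: "(x, z) \<in> parcs G" "(z, y) \<in> parcs G ^^ n" using Suc.prems by (meson relpow_Suc_E2)
    have xz: "z \<in> pverts G" "card (separators f x z) = 1" using z arcs by auto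
    have y: "y \<in> pverts G"
      using z xz(1) arcs by (cases n) auto
    have "separators f x y \<subseteq> separators f x z \<union> separators f z y"
      by (auto simp: separators_iff)
    then have "card (separators f x y) \<le> card (separators f x z \<union> separators f z y)"
      using fin Suc.prems xz(1) y by (intro card_mono) auto
    also have "\<dots> \<le> 1 + card (separators f z y)"
      using card_Un_le[of "separators f x z" "separators f z y"] xz(2) by simp
    also have "\<dots> \<le> Suc n" using Suc.IH[OF z(2) xz(1)] by simp
    finally show ?case .
  qed simp
  have "connected_graph G"
  proof (rule connected_graphI)
    show "sym (parcs G)" by (auto simp: sym_def arcs separators_sym)
    show "irrefl (parcs G)" by (auto simp: irrefl_def arcs)
    show "(u, v) \<in> (parcs G)\<^sup>*" if "u \<in> pverts G" "v \<in> pverts G" for u v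
      using walk[OF that] by (rule relpow_imp_rtrancl)
  qed (use arcs ne in auto)
  moreover have "gdist G x y = card (separators f x y)" if "x \<in> pverts G" "y \<in> pverts G" for x y
    unfolding gdist_def by (rule Least_equality) (use walk short that in auto)
  ultimately show ?thesis using fin by (simp add: cube_coords_def)
qed

lemma cube_coordsD:
  assumes "cube_coords G f"
  shows "connected_graph G"
    and "\<And>x y. x \<in> pverts G \<Longrightarrow> y \<in> pverts G \<Longrightarrow> finite (separators f x y)"
    and "\<And>x y. x \<in> pverts G \<Longrightarrow> y \<in> pverts G \<Longrightarrow> gdist G x y = card (separators f x y)"
  using assms by (auto simp: cube_coords_def)

lemma cube_coords_arc_iff:
  assumes "cube_coords G f"
  shows "(x, y) \<in> parcs G \<longleftrightarrow> x \<in> pverts G \<and> y \<in> pverts G \<and> card (separators f x y) = 1"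
  using gdist_eq_1_iff[of G x y] cube_coordsD[OF assms] connected_graphD(1)[of G] by auto

lemma cube_coords_inj:
  assumes "cube_coords G f" "x \<in> pverts G" "y \<in> pverts G" "separators f x y = {}"
  shows "x = y"
  using gdist_eq_0_iff[of G x y] cube_coordsD[OF assms(1)] assms by auto

lemma cube_coords_step:
  assumes C: "cube_coords G f" and xy: "x \<in> pverts G" "y \<in> pverts G" "x \<noteq> y"
  obtains z i where "z \<in> pverts G" "(x, z) \<in> parcs G" "i \<in> separators f x y" "separators f x z = {i}"
    "separators f z y = separators f x y - {i}"
proof -
  note D = cube_coordsD[OF C]
  obtain n where n: "gdist G x y = Suc n"
    using gdist_eq_0_iff[OF D(1) xy(1,2)] xy(3) by (cases "gdist G x y") auto
  obtain z where z: "(x, z) \<in> parcs G" "z \<in> pverts G" "gdist G z y = n"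
    using gdist_step[OF D(1) xy(1,2) n] .
  have "card (separators f x z) = 1" using z(1) cube_coords_arc_iff[OF C] by blast
  then obtain i where i: "separators f x z = {i}" by (rule card_1_singletonE)
  have c: "card (separators f x y) = Suc n" "card (separators f z y) = n"
    using D(3)[OF xy(1,2)] D(3)[OF z(2) xy(2)] n z(3) by simp_all
  have zy: "separators f z y = sym_diff {i} (separators f x y)"
    using separators_trans[of f z y x] i separators_sym[of f z x] by simp
  have "i \<in> separators f x y"
  proof (rule ccontr)
    assume i': "i \<notin> separators f x y"
    then have "separators f z y = insert i (separators f x y)" using zy by auto
    then show False using c D(2)[OF xy(1,2)] i' by simp
  qed
  moreover from this have "separators f z y = separators f x y - {i}" using zy by auto
  ultimately show thesis using that z i by blast
qed

lemma interval_iff_separators: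
  assumes C: "cube_coords G f" and xy: "x \<in> pverts G" "y \<in> pverts G"
  shows "z \<in> interval G x y \<longleftrightarrow> z \<in> pverts G \<and> separators f x z \<subseteq> separators f x y"
proof (cases "z \<in> pverts G")
  case True
  note D = cube_coordsD[OF C]
  let ?A = "separators f x z" and ?B = "separators f z y"
  have fin: "finite ?A" "finite ?B" using D(2) xy True by auto
  have xy_eq: "separators f x y = sym_diff ?A ?B" by (rule separators_trans)
  have "card ?A + card ?B = card (sym_diff ?A ?B) + 2 * card (?A \<inter> ?B)"
  proof -
    have "card ?A = card (?A - ?B) + card (?A \<inter> ?B)" "card ?B = card (?B - ?A) + card (?A \<inter> ?B)"
      using fin by (metis Int_Diff_Un Int_Diff_disjoint card_Un_disjoint finite_Diff finite_Int add.commute Int_commute)+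
    moreover have "card (sym_diff ?A ?B) = card (?A - ?B) + card (?B - ?A)"
      using fin by (intro card_Un_disjoint) auto
    ultimately show ?thesis by simp
  qed
  then have "z \<in> interval G x y \<longleftrightarrow> ?A \<inter> ?B = {}"
    using True fin by (auto simp: interval_def D(3) xy xy_eq)
  also have "\<dots> \<longleftrightarrow> ?A \<subseteq> separators f x y" by (auto simp: separators_def)
  finally show ?thesis using True by simp
qed (simp add: interval_def)

lemma interval_agree:
  assumes "cube_coords G f" "x \<in> pverts G" "y \<in> pverts G" "z \<in> interval G x y"
    and "i \<in> f x \<longleftrightarrow> i \<in> f y"
  shows "i \<in> f z \<longleftrightarrow> i \<in> f x"
  using assms interval_iff_separators[OF assms(1-3), of z] by (auto simp: separators_def)

text \<open>On a geodesic the coordinates \<open>i\<close> and \<open>j\<close> are switched at different steps; stop between the two.\<close>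

lemma interval_switch_one:
  assumes C: "cube_coords G f" and xy: "x \<in> pverts G" "y \<in> pverts G"
    and ij: "i \<in> separators f x y" "j \<in> separators f x y" "i \<noteq> j"
  shows "\<exists>z\<in>interval G x y. i \<in> separators f x z \<longleftrightarrow> j \<notin> separators f x z"
  using xy(1) ij
proof (induction "card (separators f x y)" arbitrary: x rule: less_induct)
  case less
  have "x \<noteq> y" using less.prems by auto
  then obtain z k where z: "z \<in> pverts G" "(x, z) \<in> parcs G" "k \<in> separators f x y"
    "separators f x z = {k}" "separators f z y = separators f x y - {k}"
    using cube_coords_step[OF C less.prems(1) xy(2)] by blast
  show ?case
  proof (cases "k \<in> {i, j}")
    case True
    then have "z \<in> interval G x y" "i \<in> separators f x z \<longleftrightarrow> j \<notin> separators f x z"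
      using interval_iff_separators[OF C less.prems(1) xy(2)] z(1,3,4) less.prems(4) by auto
    then show ?thesis by blast
  next
    case False
    have "card (separators f z y) < card (separators f x y)"
      unfolding z(5) using cube_coordsD(2)[OF C less.prems(1) xy(2)] z(3) by (rule card_Diff1_less)
    moreover have "i \<in> separators f z y" "j \<in> separators f z y"
      using z(5) False less.prems(2,3) by auto
    ultimately obtain w where w: "w \<in> interval G z y"
        "i \<in> separators f z w \<longleftrightarrow> j \<notin> separators f z w"
      using less.hyps[OF _ z(1) _ _ less.prems(4)] by blast
    have xw: "separators f x w = sym_diff {k} (separators f z w)"
      using separators_trans[of f x w z] z(4) by simp
    have "w \<in> pverts G" "separators f z w \<subseteq> separators f x y"
      using w(1) interval_iff_separators[OF C z(1) xy(2)] z(5) by auto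
    then have "w \<in> interval G x y"
      using interval_iff_separators[OF C less.prems(1) xy(2)] xw z(3) by auto
    moreover have "i \<in> separators f x w \<longleftrightarrow> j \<notin> separators f x w"
      unfolding xw using w(2) False by auto
    ultimately show ?thesis by blast
  qed
qed

lemma geo_convexD: "geo_convex G V \<Longrightarrow> u \<in> V \<Longrightarrow> v \<in> V \<Longrightarrow> x \<in> interval G u v \<Longrightarrow> x \<in> V"
  unfolding geo_convex_def by blast

definition coord_halfspaces :: "('a \<Rightarrow> 'i set) \<Rightarrow> 'i set \<Rightarrow> 'a set set" where
  "coord_halfspaces f K = (\<lambda>i. {x. i \<in> f x}) ` K \<union> (\<lambda>i. {x. i \<notin> f x}) ` K"

lemma coord_halfspacesE:
  assumes "h \<in> coord_halfspaces f K"
  obtains i b where "i \<in> K" "\<forall>x. x \<in> h \<longleftrightarrow> (i \<in> f x) = b"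
  using assms unfolding coord_halfspaces_def by auto

lemma coord_halfspaces_compl: "h \<in> coord_halfspaces f K \<Longrightarrow> - h \<in> coord_halfspaces f K"
proof -
  have "- {x. i \<in> f x} = {x. i \<notin> f x}" "- {x. i \<notin> f x} = {x. i \<in> f x}" for i by auto
  then show "h \<in> coord_halfspaces f K \<Longrightarrow> - h \<in> coord_halfspaces f K"
    unfolding coord_halfspaces_def by auto
qed

lemma halfspace_system_coords:
  assumes C: "cube_coords G f" and V: "geo_convex G V"
  shows "halfspace_system V (coord_halfspaces f K)"
proof
  fix a assume "a \<in> coord_halfspaces f K" then show "- a \<in> coord_halfspaces f K"
    by (rule coord_halfspaces_compl)
next
  fix a b x y
  assume ab: "a \<in> coord_halfspaces f K" "b \<in> coord_halfspaces f K" "a \<noteq> - b"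
    and xy: "x \<in> V" "y \<in> V" "x \<in> a" "x \<notin> b" "y \<notin> a" "y \<in> b"
  obtain i s where i: "i \<in> K" "\<forall>x. x \<in> a \<longleftrightarrow> (i \<in> f x) = s" using coord_halfspacesE[OF ab(1)] .
  obtain j t where j: "j \<in> K" "\<forall>x. x \<in> b \<longleftrightarrow> (j \<in> f x) = t" using coord_halfspacesE[OF ab(2)] .
  have xyG: "x \<in> pverts G" "y \<in> pverts G" using xy V by (auto simp: geo_convex_def)
  have "i \<noteq> j"
  proof
    assume "i = j"
    then have "a = b \<or> a = - b" using i(2) j(2) by auto
    then show False using ab xy by auto
  qed
  moreover have "i \<in> separators f x y" "j \<in> separators f x y"
    using xy i(2) j(2) by (auto simp: separators_def)
  ultimately obtain z where z: "z \<in> interval G x y" "i \<in> separators f x z \<longleftrightarrow> j \<notin> separators f x z"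
    using interval_switch_one[OF C xyG] by blast
  have "z \<in> V" using z(1) xy V by (auto simp: geo_convex_def)
  moreover have "z \<in> h" if h: "h \<in> coord_halfspaces f K" "x \<in> h" "y \<in> h" for h
  proof -
    obtain k r where k: "k \<in> K" "\<forall>x. x \<in> h \<longleftrightarrow> (k \<in> f x) = r" using coord_halfspacesE[OF h(1)] .
    then show ?thesis using interval_agree[OF C xyG z(1), of k] h by auto
  qed
  moreover have "z \<in> a \<longleftrightarrow> z \<in> b"
    using z(2) xy i(2) j(2) by (auto simp: separators_def)
  ultimately show "\<exists>z\<in>V. (\<forall>h\<in>coord_halfspaces f K. x \<in> h \<longrightarrow> y \<in> h \<longrightarrow> z \<in> h) \<and> (z \<in> a) = (z \<in> b)"
    by blast
qed

lemma geo_convex_Int_halfspaces: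
  assumes C: "cube_coords G f" and V: "geo_convex G V" and \<sigma>: "\<sigma> \<subseteq> coord_halfspaces f K"
  shows "geo_convex G {x \<in> V. \<forall>h\<in>\<sigma>. x \<in> h}"
  unfolding geo_convex_def
proof (intro conjI ballI subsetI)
  fix x assume "x \<in> {x \<in> V. \<forall>h\<in>\<sigma>. x \<in> h}"
  then show "x \<in> pverts G" using V by (auto simp: geo_convex_def)
next
  fix u v x assume uv: "u \<in> {x \<in> V. \<forall>h\<in>\<sigma>. x \<in> h}" "v \<in> {x \<in> V. \<forall>h\<in>\<sigma>. x \<in> h}" and x: "x \<in> interval G u v"
  have uvG: "u \<in> pverts G" "v \<in> pverts G" using uv V by (auto simp: geo_convex_def)
  have "x \<in> V" using geo_convexD[OF V _ _ x] uv by simp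
  moreover have "x \<in> h" if h: "h \<in> \<sigma>" for h
  proof -
    have "h \<in> coord_halfspaces f K" using h \<sigma> by blast
    then obtain k r where k: "k \<in> K" "\<forall>x. x \<in> h \<longleftrightarrow> (k \<in> f x) = r" by (rule coord_halfspacesE)
    then show ?thesis using interval_agree[OF C uvG x, of k] uv h by auto
  qed
  ultimately show "x \<in> {x \<in> V. \<forall>h\<in>\<sigma>. x \<in> h}" by blast
qed

text \<open>For a finite set \<open>K\<close> this is a convex set with finitely many coordinates, which makes the
  finite combinatorics of halfspaces applicable to infinite graphs.\<close>

definition coord_box :: "'a pair_pre_digraph \<Rightarrow> ('a \<Rightarrow> 'i set) \<Rightarrow> 'i set \<Rightarrow> 'a set" where
  "coord_box G f K = {x \<in> pverts G. f x \<subseteq> K}"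

lemma geo_convex_coord_box:
  assumes C: "cube_coords G f"
  shows "geo_convex G (coord_box G f K)"
  unfolding geo_convex_def
proof (intro conjI ballI subsetI)
  fix u v x assume uv: "u \<in> coord_box G f K" "v \<in> coord_box G f K" and x: "x \<in> interval G u v"
  have uvG: "u \<in> pverts G" "v \<in> pverts G" using uv by (auto simp: coord_box_def)
  have "i \<in> K" if "i \<in> f x" for i
    using interval_agree[OF C uvG x, of i] that uv by (auto simp: coord_box_def)
  then show "x \<in> coord_box G f K" using x by (auto simp: coord_box_def interval_def)
qed (auto simp: coord_box_def)

section \<open>Coordinates of partial cubes\<close>

text \<open>From one finite set to another one may step closer by adding or removing any element of the
  symmetric difference.\<close>

lemma hypercube_coords: "cube_coords (hypercube X) (\<lambda>A. A)"
proof (rule cube_coordsI)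
  have sd: "separators (\<lambda>A. A) A B = A - B \<union> (B - A)" for A B :: "'a set" by (auto simp: separators_def)
  show "(x, y) \<in> parcs (hypercube X) \<longleftrightarrow> x \<in> pverts (hypercube X) \<and> y \<in> pverts (hypercube X)
    \<and> card (separators (\<lambda>A. A) x y) = 1" for x y
    by (auto simp: hypercube_def sd)
  show "finite (separators (\<lambda>A. A) x y)" if "x \<in> pverts (hypercube X)" "y \<in> pverts (hypercube X)" for x y
    using that by (simp add: hypercube_def sd)
  show "\<exists>z\<in>pverts (hypercube X). \<exists>i\<in>separators (\<lambda>A. A) x y. separators (\<lambda>A. A) x z = {i}"
    if xy: "x \<in> pverts (hypercube X)" "y \<in> pverts (hypercube X)" "x \<noteq> y" for x y
  proof -
    obtain i where i: "i \<in> separators (\<lambda>A. A) x y" using xy(3) by (auto simp: sd)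
    let ?z = "if i \<in> x then x - {i} else insert i x"
    have "?z \<in> pverts (hypercube X)" "separators (\<lambda>A. A) x ?z = {i}"
      using xy i by (auto simp: hypercube_def separators_def)
    then show ?thesis using i by blast
  qed
qed (auto simp: hypercube_def)

lemma partial_cube_coords:
  fixes G :: "'a pair_pre_digraph"
  assumes "partial_cube G"
  obtains f :: "'a \<Rightarrow> ('a \<times> 'a) set" where "cube_coords G f"
proof -
  obtain X :: "('a \<times> 'a) set" and f where G: "connected_graph G" and f: "isometric_embedding f G (hypercube X)"
    using assms unfolding partial_cube_def by blast
  have "finite (separators f x y) \<and> gdist G x y = card (separators f x y)"
    if "x \<in> pverts G" "y \<in> pverts G" for x y
  proof -
    have "separators (\<lambda>A. A) (f x) (f y) = separators f x y" by (simp add: separators_def)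
    then show ?thesis
      using f that cube_coordsD(2,3)[OF hypercube_coords, of "f x" X "f y"]
      by (auto simp: isometric_embedding_def image_subset_iff)
  qed
  then have "cube_coords G f" using G by (simp add: cube_coords_def)
  then show thesis by (rule that)
qed

lemma cube_coords_rebase: "cube_coords G f \<Longrightarrow> cube_coords G (separators f b)"
proof -
  have "separators (separators f b) x y = separators f x y" for x y by (auto simp: separators_def)
  then show "cube_coords G f \<Longrightarrow> cube_coords G (separators f b)" by (simp add: cube_coords_def)
qed

section \<open>Coordinates from the separation property\<close>

lemma bipartite_walk_parity:
  assumes AB: "A \<inter> B = {}" "parcs G \<subseteq> A \<times> B \<union> B \<times> A" and xy: "(x, y) \<in> parcs G ^^ n"
  shows "(x \<in> A \<longleftrightarrow> y \<in> A) \<longleftrightarrow> even n"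
  using xy
proof (induction n arbitrary: x)
  case (Suc n)
  obtain z where z: "(x, z) \<in> parcs G" "(z, y) \<in> parcs G ^^ n" using Suc.prems by (meson relpow_Suc_E2)
  have "x \<in> A \<longleftrightarrow> z \<notin> A" using z(1) AB by blast
  then show ?case using Suc.IH[OF z(2)] by auto
qed simp

lemma gdist_triangle_arc:
  assumes G: "connected_graph G" and x: "x \<in> pverts G" and uv: "(u, v) \<in> parcs G"
  shows "gdist G x v \<le> Suc (gdist G x u)"
proof -
  have "u \<in> pverts G" using connected_graphD(1)[OF G] uv by blast
  then have "(x, v) \<in> parcs G ^^ Suc (gdist G x u)"
    using gdist_relpow[OF G x] uv by auto
  then show ?thesis by (rule gdist_le)
qed

lemma bipartite_gdist_neq:
  assumes G: "connected_graph G" and bip: "bipartite G" and x: "x \<in> pverts G" and uv: "(u, v) \<in> parcs G"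
  shows "gdist G x u \<noteq> gdist G x v"
proof
  assume eq: "gdist G x u = gdist G x v"
  have uvG: "u \<in> pverts G" "v \<in> pverts G" using connected_graphD(1)[OF G] uv by blast+
  obtain A B where AB: "A \<inter> B = {}" "parcs G \<subseteq> A \<times> B \<union> B \<times> A"
    using bip unfolding bipartite_def by blast
  have "(x \<in> A \<longleftrightarrow> u \<in> A) \<longleftrightarrow> (x \<in> A \<longleftrightarrow> v \<in> A)"
    using bipartite_walk_parity[OF AB gdist_relpow[OF G x uvG(1)]]
      bipartite_walk_parity[OF AB gdist_relpow[OF G x uvG(2)]] eq by simp
  then show False using uv AB by blast
qed

text \<open>By bipartiteness one end of an arc is strictly nearer to a given vertex, hence on a geodesic
  to the other end. So a vertex of the convex set cannot be nearer to the end outside it.\<close>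

lemma convex_halfspace_eq:
  assumes G: "connected_graph G" and bip: "bipartite G"
    and H: "geo_convex G H" "geo_convex G (pverts G - H)"
    and uv: "(u, v) \<in> parcs G" "u \<in> H" "v \<notin> H"
  shows "H = halfspace_W G u v"
proof -
  have uvG: "u \<in> pverts G" "v \<in> pverts G" using connected_graphD(1)[OF G] uv by blast+
  have vu: "(v, u) \<in> parcs G" using connected_graphD(2)[OF G] uv(1) by (auto simp: sym_def)
  have one: "gdist G u v = 1" "gdist G v u = 1"
    using gdist_eq_1_iff[OF G uvG] gdist_eq_1_iff[OF G uvG(2,1)] uv vu by auto
  have near: "gdist G x u < gdist G x v" if x: "x \<in> H" for x
  proof (rule ccontr)
    assume neg: "\<not> gdist G x u < gdist G x v"
    have xG: "x \<in> pverts G" using x H by (auto simp: geo_convex_def)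
    have "gdist G x u = Suc (gdist G x v)"
      using neg bipartite_gdist_neq[OF G bip xG uv(1)] gdist_triangle_arc[OF G xG vu] by linarith
    then have "v \<in> interval G x u" using one uvG by (simp add: interval_def)
    then show False using geo_convexD[OF H(1) x uv(2)] uv(3) by blast
  qed
  have far: "gdist G x v < gdist G x u" if x: "x \<in> pverts G - H" for x
  proof (rule ccontr)
    assume neg: "\<not> gdist G x v < gdist G x u"
    have xG: "x \<in> pverts G" using x by simp
    have "gdist G x v = Suc (gdist G x u)"
      using neg bipartite_gdist_neq[OF G bip xG uv(1)] gdist_triangle_arc[OF G xG uv(1)] by linarith
    then have "u \<in> interval G x v" using one uvG by (simp add: interval_def)
    moreover have "v \<in> pverts G - H" using uvG uv by simp
    ultimately show False using geo_convexD[OF H(2) x] uv(2) by blast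
  qed
  show ?thesis
    using near far H(1) unfolding halfspace_W_def geo_convex_def by force
qed

lemma geo_convex_singleton:
  assumes G: "connected_graph G" and u: "u \<in> pverts G"
  shows "geo_convex G {u}"
proof -
  have "gdist G u u = 0" using gdist_eq_0_iff[OF G u u] by simp
  then have "x = u" if "x \<in> interval G u u" for x
    using that gdist_eq_0_iff[OF G u, of x] by (simp add: interval_def)
  then show ?thesis using u by (auto simp: geo_convex_def)
qed

text \<open>The coordinates are the halfspaces, that is, the convex sets with convex complement; of each
  complementary pair only the one that avoids a base vertex is used. An arc is crossed by exactly
  one of them: one exists by separating its ends, and it is unique by \<open>convex_halfspace_eq\<close>. A
  geodesic crosses none of them twice.\<close>

lemma S4_coords:
  fixes G :: "'a pair_pre_digraph"
  assumes S4: "G \<in> S4"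
  obtains f :: "'a \<Rightarrow> 'a set set" where "cube_coords G f"
    "\<And>A B. geo_convex G A \<Longrightarrow> geo_convex G B \<Longrightarrow> A \<inter> B = {} \<Longrightarrow>
      \<exists>i s. (\<forall>x\<in>A. (i \<in> f x) = s) \<and> (\<forall>x\<in>B. (i \<in> f x) = (\<not> s))"
proof -
  let ?V = "pverts G"
  have "?V \<noteq> {}" using S4 connected_graphD(4) by (auto simp: S4_def)
  then obtain b where b: "b \<in> ?V" by blast
  define HS where "HS = {H. geo_convex G H \<and> geo_convex G (?V - H)}"
  define f where "f x = {H \<in> HS. b \<notin> H \<and> x \<in> H}" for x
  have G: "connected_graph G" and bip: "bipartite G"
    and sep: "\<And>A B. geo_convex G A \<and> geo_convex G B \<and> A \<inter> B = {} \<Longrightarrow>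
       \<exists>H' H''. geo_convex G H' \<and> geo_convex G H'' \<and> H' \<inter> H'' = {} \<and> H' \<union> H'' = ?V \<and>
          A \<subseteq> H' \<and> B \<subseteq> H''"
    using S4 unfolding S4_def by blast+
  have HS_compl: "?V - H \<in> HS" if "H \<in> HS" for H
  proof -
    have "?V - (?V - H) = H" using that by (auto simp: HS_def geo_convex_def)
    then show ?thesis using that by (simp add: HS_def)
  qed
  have sep': "\<exists>H\<in>HS. A \<subseteq> H \<and> B \<subseteq> ?V - H" if AB: "geo_convex G A" "geo_convex G B" "A \<inter> B = {}" for A B
  proof -
    obtain H' H'' where H: "geo_convex G H'" "geo_convex G H''" "H' \<inter> H'' = {}" "H' \<union> H'' = ?V"
      "A \<subseteq> H'" "B \<subseteq> H''"
      using sep[of A B] AB by blast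
    have "H'' = ?V - H'" using H(3,4) by auto
    then show ?thesis using H by (auto simp: HS_def)
  qed
  have separating: "\<exists>i s. (\<forall>x\<in>A. (i \<in> f x) = s) \<and> (\<forall>x\<in>B. (i \<in> f x) = (\<not> s))"
    if AB: "geo_convex G A" "geo_convex G B" "A \<inter> B = {}" for A B
  proof -
    obtain H where H: "H \<in> HS" "A \<subseteq> H" "B \<subseteq> ?V - H" using sep'[OF AB] by blast
    have Hc: "?V - H \<in> HS" using HS_compl H(1) by blast
    have AV: "A \<subseteq> ?V" using AB by (auto simp: geo_convex_def)
    show ?thesis
    proof (cases "b \<in> H")
      case False
      then show ?thesis using H by (intro exI[of _ H] exI[of _ True]) (auto simp: f_def)
    next
      case True
      then show ?thesis using H Hc AV by (intro exI[of _ "?V - H"] exI[of _ False]) (auto simp: f_def)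
    qed
  qed
  have step: "\<exists>H0\<in>HS. separators f u w = {H0}" if uw: "(u, w) \<in> parcs G" for u w
  proof -
    have uwG: "u \<in> ?V" "w \<in> ?V" using connected_graphD(1)[OF G] uw by blast+
    have wu: "(w, u) \<in> parcs G" using connected_graphD(2)[OF G] uw by (auto simp: sym_def)
    have "u \<noteq> w" using uw connected_graphD(3)[OF G] by (auto simp: irrefl_def)
    then obtain H where H: "H \<in> HS" "u \<in> H" "w \<notin> H"
      using sep'[of "{u}" "{w}"] geo_convex_singleton[OF G] uwG by auto
    have Hc: "?V - H \<in> HS" "w \<in> ?V - H" "u \<notin> ?V - H" using HS_compl H uwG by auto
    have uniq: "K = H \<or> K = ?V - H" if K: "K \<in> HS" "u \<in> K \<longleftrightarrow> w \<notin> K" for K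
    proof (cases "u \<in> K")
      case True
      then show ?thesis
        using convex_halfspace_eq[OF G bip _ _ uw, of K] convex_halfspace_eq[OF G bip _ _ uw, of H] K H
        by (auto simp: HS_def)
    next
      case False
      then show ?thesis
        using convex_halfspace_eq[OF G bip _ _ wu, of K] convex_halfspace_eq[OF G bip _ _ wu, of "?V - H"] K Hc
        by (auto simp: HS_def)
    qed
    let ?H0 = "if b \<in> H then ?V - H else H"
    have H0: "?H0 \<in> HS" "b \<notin> ?H0" "u \<in> ?H0 \<longleftrightarrow> w \<notin> ?H0" using H Hc by auto
    have "separators f u w = {?H0}"
    proof
      show "{?H0} \<subseteq> separators f u w" using H0 by (auto simp: separators_iff f_def)
      show "separators f u w \<subseteq> {?H0}"
      proof
        fix K assume "K \<in> separators f u w"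
        then have K: "K \<in> HS" "b \<notin> K" "u \<in> K \<longleftrightarrow> w \<notin> K" by (auto simp: separators_iff f_def)
        then show "K \<in> {?H0}" using uniq[OF K(1,3)] b by auto
      qed
    qed
    then show ?thesis using H0 by blast
  qed
  have "finite (separators f x y) \<and> n = card (separators f x y)"
    if "x \<in> ?V" "y \<in> ?V" "gdist G x y = n" for x y n
    using that
  proof (induction n arbitrary: x)
    case 0
    then have "x = y" using gdist_eq_0_iff[OF G] by simp
    then show ?case by simp
  next
    case (Suc n)
    obtain w where w: "(x, w) \<in> parcs G" "w \<in> ?V" "gdist G w y = n"
      using gdist_step[OF G Suc.prems] .
    obtain H0 where H0: "H0 \<in> HS" "separators f x w = {H0}" using step[OF w(1)] by blast
    have wI: "w \<in> interval G x y"
      using w Suc.prems gdist_eq_1_iff[OF G Suc.prems(1) w(2)] by (auto simp: interval_def)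
    have "H0 \<notin> separators f w y"
    proof
      assume "H0 \<in> separators f w y"
      moreover have "H0 \<in> separators f x w" using H0 by simp
      ultimately have mem: "x \<in> H0 \<longleftrightarrow> w \<notin> H0" "w \<in> H0 \<longleftrightarrow> y \<notin> H0"
        by (auto simp: separators_iff f_def)
      have conv: "geo_convex G H0" "geo_convex G (?V - H0)" using H0(1) by (auto simp: HS_def)
      show False
      proof (cases "w \<in> H0")
        case True
        then show False using geo_convexD[OF conv(2) _ _ wI] mem Suc.prems by auto
      next
        case False
        then show False using geo_convexD[OF conv(1) _ _ wI] mem by auto
      qed
    qed
    moreover have "separators f x y = sym_diff {H0} (separators f w y)"
      using separators_trans[of f x y w] H0(2) by simp
    ultimately have "separators f x y = insert H0 (separators f w y)" by auto
    then show ?case using Suc.IH[OF w(2) Suc.prems(2) w(3)] \<open>H0 \<notin> separators f w y\<close> by simp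
  qed
  then have "cube_coords G f" using G by (simp add: cube_coords_def)
  then show thesis using that separating by blast
qed

section \<open>Minors in coordinates\<close>

lemma graph_isoI:
  assumes bij: "bij_betw g (pverts H) (pverts K)"
    and wf: "parcs H \<subseteq> pverts H \<times> pverts H" "parcs K \<subseteq> pverts K \<times> pverts K"
    and arcs: "\<And>x y. x \<in> pverts H \<Longrightarrow> y \<in> pverts H \<Longrightarrow> (x, y) \<in> parcs H \<longleftrightarrow> (g x, g y) \<in> parcs K"
  shows "graph_iso H K"
proof -
  let ?i = "\<lparr>iso_verts = g, iso_arcs = map_prod g g, iso_head = snd, iso_tail = fst\<rparr>"
  have inj: "inj_on g (pverts H)" using bij by (auto simp: bij_betw_def)
  have "wf_digraph (with_proj H)" using wf by unfold_locales auto
  moreover have "inj_on (map_prod g g) (parcs H)"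
    using map_prod_inj_on[OF inj inj] wf(1) by (rule inj_on_subset)
  ultimately have "pre_digraph.digraph_isomorphism (with_proj H) ?i"
    using inj by (auto simp: pre_digraph.digraph_isomorphism_def)
  moreover have "map_prod g g ` parcs H = parcs K"
  proof
    show "map_prod g g ` parcs H \<subseteq> parcs K"
    proof
      fix e assume "e \<in> map_prod g g ` parcs H"
      then obtain x y where xy: "e = (g x, g y)" "(x, y) \<in> parcs H" by auto
      then have "x \<in> pverts H" "y \<in> pverts H" using wf(1) by auto
      then show "e \<in> parcs K" using arcs[of x y] xy by simp
    qed
    show "parcs K \<subseteq> map_prod g g ` parcs H"
    proof
      fix e assume e: "e \<in> parcs K"
      then have "e \<in> g ` pverts H \<times> g ` pverts H"
        using wf(2) bij_betw_imp_surj_on[OF bij] by blast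
      then obtain x y where xy: "e = (g x, g y)" "x \<in> pverts H" "y \<in> pverts H" by auto
      then have "(x, y) \<in> parcs H" using arcs[OF xy(2,3)] e by simp
      then show "e \<in> map_prod g g ` parcs H" using xy(1) by (intro image_eqI[of _ _ "(x, y)"]) auto
    qed
  qed
  moreover have "g ` pverts H = pverts K" using bij by (simp add: bij_betw_def)
  ultimately show ?thesis
    unfolding digraph_iso_def by (intro exI[of _ ?i]) (simp add: app_iso_def with_proj_def)
qed

lemma graph_isoE:
  assumes "graph_iso H K"
  obtains g where "bij_betw g (pverts H) (pverts K)"
    "\<And>x y. x \<in> pverts H \<Longrightarrow> y \<in> pverts H \<Longrightarrow> (x, y) \<in> parcs H \<longleftrightarrow> (g x, g y) \<in> parcs K"
proof -
  obtain i where i: "pre_digraph.digraph_isomorphism (with_proj H) i" "with_proj K = app_iso i (with_proj H)"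
    using assms unfolding digraph_iso_def by blast
  let ?g = "iso_verts i"
  have wf: "wf_digraph (with_proj H)" and inj: "inj_on ?g (pverts H)"
    using i(1) by (auto simp: pre_digraph.digraph_isomorphism_def)
  have V: "pverts K = ?g ` pverts H" and A: "parcs K = iso_arcs i ` parcs H"
    and t: "iso_tail i = fst" and h: "iso_head i = snd"
    using i(2) by (auto simp: with_proj_def app_iso_def)
  have ia: "iso_arcs i a = map_prod ?g ?g a" if "a \<in> parcs H" for a
    using i(1) that unfolding pre_digraph.digraph_isomorphism_def t h by (cases a) (auto simp: prod_eq_iff)
  have wfH: "parcs H \<subseteq> pverts H \<times> pverts H"
    using wf_digraph.tail_in_verts[OF wf] wf_digraph.head_in_verts[OF wf] by force
  have PK: "parcs K = map_prod ?g ?g ` parcs H" using A ia by (metis image_cong)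
  have "(x, y) \<in> parcs H \<longleftrightarrow> (?g x, ?g y) \<in> parcs K" if "x \<in> pverts H" "y \<in> pverts H" for x y
  proof
    assume "(?g x, ?g y) \<in> parcs K"
    then obtain x' y' where xy': "(x', y') \<in> parcs H" "?g x = ?g x'" "?g y = ?g y'" using PK by auto
    then have "x' = x" "y' = y" using inj that wfH by (auto dest: inj_onD)
    then show "(x, y) \<in> parcs H" using xy' by simp
  qed (use PK in force)
  moreover have "bij_betw ?g (pverts H) (pverts K)" using inj V by (simp add: bij_betw_def)
  ultimately show thesis using that by blast
qed

lemma cube_coords_induced:
  assumes C: "cube_coords G f" and S: "geo_convex G S" "S \<noteq> {}"
  shows "cube_coords (induced G S) f"
proof (rule cube_coordsI)
  have SV: "S \<subseteq> pverts G" using S by (auto simp: geo_convex_def)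
  show "(x, y) \<in> parcs (induced G S) \<longleftrightarrow> x \<in> pverts (induced G S) \<and> y \<in> pverts (induced G S)
    \<and> card (separators f x y) = 1" for x y
    using cube_coords_arc_iff[OF C, of x y] SV by (auto simp: induced_def)
  show "finite (separators f x y)" if "x \<in> pverts (induced G S)" "y \<in> pverts (induced G S)" for x y
    using cube_coordsD(2)[OF C] that SV by (auto simp: induced_def)
  show "\<exists>z\<in>pverts (induced G S). \<exists>i\<in>separators f x y. separators f x z = {i}"
    if xy: "x \<in> pverts (induced G S)" "y \<in> pverts (induced G S)" "x \<noteq> y" for x y
  proof -
    have xyS: "x \<in> S" "y \<in> S" using xy by (auto simp: induced_def)
    then have xyG: "x \<in> pverts G" "y \<in> pverts G" using SV by auto
    obtain z i where z: "z \<in> pverts G" "i \<in> separators f x y" "separators f x z = {i}"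
      using cube_coords_step[OF C xyG xy(3)] by metis
    then have "z \<in> interval G x y" using interval_iff_separators[OF C xyG] by auto
    then have "z \<in> S" using geo_convexD[OF S(1)] xyS by blast
    then show ?thesis using z by (auto simp: induced_def)
  qed
qed (use S in \<open>auto simp: induced_def\<close>)

lemma crossing_arc:
  assumes C: "cube_coords G f" and xy: "x \<in> pverts G" "y \<in> pverts G" and e: "e \<in> separators f x y"
  shows "\<exists>u v. (u, v) \<in> parcs G \<and> separators f u v = {e}"
  using xy(1) e
proof (induction "card (separators f x y)" arbitrary: x rule: less_induct)
  case less
  have "x \<noteq> y" using less.prems(2) by auto
  then obtain z k where z: "z \<in> pverts G" "(x, z) \<in> parcs G" "k \<in> separators f x y"
    "separators f x z = {k}" "separators f z y = separators f x y - {k}"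
    using cube_coords_step[OF C less.prems(1) xy(2)] by blast
  show ?case
  proof (cases "k = e")
    case True
    then show ?thesis using z by blast
  next
    case False
    have "card (separators f z y) < card (separators f x y)"
      unfolding z(5) using cube_coordsD(2)[OF C less.prems(1) xy(2)] z(3) by (rule card_Diff1_less)
    moreover have "e \<in> separators f z y" using z(5) False less.prems(2) by auto
    ultimately show ?thesis using less.hyps[OF _ z(1)] by blast
  qed
qed

text \<open>An arc changes a single coordinate \<open>e\<close>, and its two sides are the vertices nearer to one
  or the other end. So two arcs are related iff they change the same coordinate.\<close>

lemma Theta_class_coords:
  assumes C: "cube_coords G f" and uv: "(u, v) \<in> parcs G" "separators f u v = {e}"
  shows "{(x, y) \<in> parcs G. separators f x y = {e}} \<in> Theta_classes G"
proof -
  have uvG: "u \<in> pverts G" "v \<in> pverts G" using uv cube_coords_arc_iff[OF C] by blast+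
  have W: "x \<in> halfspace_W G u v \<longleftrightarrow> e \<notin> separators f x u"
    if x: "x \<in> pverts G" and uv: "u \<in> pverts G" "v \<in> pverts G" "separators f u v = {e}" for x u v
  proof -
    have eq: "separators f x v = sym_diff (separators f x u) {e}"
      using separators_trans[of f x v u] uv by simp
    have fin: "finite (separators f x u)" using cube_coordsD(2)[OF C x uv(1)] .
    have W_iff: "x \<in> halfspace_W G u v \<longleftrightarrow> card (separators f x u) < card (separators f x v)"
      using cube_coordsD(3)[OF C] x uv by (simp add: halfspace_W_def)
    show ?thesis
    proof (cases "e \<in> separators f x u")
      case True
      then have "separators f x v = separators f x u - {e}" using eq by auto
      then show ?thesis using W_iff True fin by (simp add: card_Diff1_le not_less)
    next
      case False
      then have "separators f x v = insert e (separators f x u)" using eq by auto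
      then show ?thesis using W_iff False fin by simp
    qed
  qed
  have vu: "separators f v u = {e}" using uv(2) separators_sym[of f v u] by simp
  have "(x, y) \<in> Theta G `` {(u, v)} \<longleftrightarrow> (x, y) \<in> parcs G \<and> separators f x y = {e}" for x y
  proof (cases "(x, y) \<in> parcs G")
    case True
    then have xy: "x \<in> pverts G" "y \<in> pverts G" "card (separators f x y) = 1"
      using cube_coords_arc_iff[OF C] by blast+
    then obtain i where i: "separators f x y = {i}" by (meson card_1_singletonE)
    have euv: "e \<in> f u \<longleftrightarrow> e \<notin> f v" using uv(2) by (auto simp: set_eq_iff separators_iff)
    have "(x, y) \<in> Theta G `` {(u, v)} \<longleftrightarrow> e \<in> separators f x y"
      using True uv(1) W[OF xy(1) uvG uv(2)] W[OF xy(2) uvG uv(2)] W[OF xy(1) uvG(2,1) vu]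
        W[OF xy(2) uvG(2,1) vu] euv
      by (auto simp: Theta_def separators_iff)
    then show ?thesis using i True by auto
  qed (auto simp: Theta_def)
  then have "{(x, y) \<in> parcs G. separators f x y = {e}} = Theta G `` {(u, v)}" by auto
  then show ?thesis unfolding Theta_classes_def using uv(1) by (auto intro: quotientI)
qed

text \<open>Needed for contractions: classes whose vertices differ in \<open>c\<close> only, up to the contracted
  coordinate \<open>e\<close>, contain adjacent vertices. If the given vertices differ in both coordinates, the
  middle vertex of a geodesic is in one of the two classes.\<close>

lemma arc_up_to_coord:
  assumes C: "cube_coords G f" and xy: "x \<in> pverts G" "y \<in> pverts G" and c: "separators f x y - {e} = {c}"
  shows "\<exists>a b. (a, b) \<in> parcs G \<and> separators f x a \<subseteq> {e} \<and> separators f b y \<subseteq> {e}"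
proof (cases "separators f x y = {c}")
  case True
  then have "(x, y) \<in> parcs G" using cube_coords_arc_iff[OF C] xy by simp
  then show ?thesis by (intro exI[of _ x] exI[of _ y]) simp
next
  case False
  have ce: "c \<noteq> e" "separators f x y = {c, e}" using c False by auto
  then obtain z where z: "z \<in> interval G x y" "c \<in> separators f x z \<longleftrightarrow> e \<notin> separators f x z"
    using interval_switch_one[OF C xy, of c e] by blast
  have zG: "z \<in> pverts G" and zs: "separators f x z \<subseteq> {c, e}"
    using z(1) interval_iff_separators[OF C xy] ce(2) by auto
  have zy: "separators f z y = sym_diff (separators f x z) {c, e}"
    using separators_trans[of f z y x] ce(2) separators_sym[of f z x] by simp
  show ?thesis
  proof (cases "c \<in> separators f x z")
    case True
    then have s: "separators f x z = {c}" using z(2) zs by auto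
    then have "(x, z) \<in> parcs G" using cube_coords_arc_iff[OF C] zG xy by simp
    moreover have "separators f z y = {e}" using zy s ce(1) by auto
    ultimately show ?thesis by (intro exI[of _ x] exI[of _ z]) simp
  next
    case False
    then have s: "separators f x z = {e}" using z(2) zs by auto
    then have "separators f z y = {c}" using zy ce(1) by auto
    then have "(z, y) \<in> parcs G" using cube_coords_arc_iff[OF C] zG xy by simp
    then show ?thesis using s by (intro exI[of _ z] exI[of _ y]) simp
  qed
qed

text \<open>Contracting a class deletes its coordinate. The copy over the original vertices lives on
  one representative of each class.\<close>

lemma contraction_coords:
  fixes H :: "'a pair_pre_digraph"
  assumes C: "cube_coords H f" and e: "x0 \<in> pverts H" "y0 \<in> pverts H" "e \<in> separators f x0 y0"
  defines "g \<equiv> \<lambda>x. f x - {e}"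
  shows "\<exists>E\<in>Theta_classes H. \<exists>K :: 'a pair_pre_digraph. graph_iso (contract H E) K \<and>
    cube_coords K g \<and> g ` pverts K = g ` pverts H"
proof -
  let ?V = "pverts H"
  obtain u v where uv: "(u, v) \<in> parcs H" "separators f u v = {e}" using crossing_arc[OF C e] by blast
  define E where "E = {(x, y) \<in> parcs H. separators f x y = {e}}"
  have E: "E \<in> Theta_classes H" unfolding E_def by (rule Theta_class_coords[OF C uv])
  have sg: "separators g x y = separators f x y - {e}" for x y
    by (auto simp: g_def separators_def)
  have arc: "(x, y) \<in> parcs H \<longleftrightarrow> x \<in> ?V \<and> y \<in> ?V \<and> card (separators f x y) = 1" for x y
    by (rule cube_coords_arc_iff[OF C])
  have g_eq: "g x = g y \<longleftrightarrow> separators g x y = {}" for x y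
    by (auto simp: separators_def)
  have "(x, y) \<in> E\<^sup>* \<longleftrightarrow> y \<in> ?V \<and> g x = g y" if x: "x \<in> ?V" for x y
  proof
    assume "(x, y) \<in> E\<^sup>*"
    then show "y \<in> ?V \<and> g x = g y"
    proof induction
      case (step y z)
      then have "separators f y z = {e}" "z \<in> ?V" using arc by (auto simp: E_def)
      then have "separators g y z = {}" by (simp add: sg)
      then show ?case using step.IH g_eq \<open>z \<in> ?V\<close> by metis
    qed (use x in simp)
  next
    assume y: "y \<in> ?V \<and> g x = g y"
    then have "separators f x y \<subseteq> {e}" using g_eq[of x y] sg[of x y] by auto
    then have "separators f x y = {} \<or> separators f x y = {e}" by auto
    then show "(x, y) \<in> E\<^sup>*"
    proof
      assume "separators f x y = {}"
      then show ?thesis using cube_coords_inj[OF C x] y by auto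
    next
      assume "separators f x y = {e}"
      then have "(x, y) \<in> E" using arc x y by (simp add: E_def)
      then show ?thesis by blast
    qed
  qed
  then have cl: "E\<^sup>* `` {x} = {y \<in> ?V. g y = g x}" if "x \<in> ?V" for x using that by auto
  \<comment> \<open>The representatives of the classes carry the copy of the contraction.\<close>
  define r where "r A = (SOME x. x \<in> A)" for A :: "'a set"
  have cls: "r A \<in> ?V" "A = {y \<in> ?V. g y = g (r A)}" "r A \<in> A" if A: "A \<in> ?V // E\<^sup>*" for A
  proof -
    obtain x where x: "x \<in> ?V" "A = {y \<in> ?V. g y = g x}"
      using A cl by (auto elim!: quotientE)
    then have "x \<in> A" by simp
    then show "r A \<in> A" unfolding r_def by (rule someI)
    then show "r A \<in> ?V" "A = {y \<in> ?V. g y = g (r A)}" using x by auto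
  qed
  have cl_mem: "{y \<in> ?V. g y = g x} \<in> ?V // E\<^sup>*" if "x \<in> ?V" for x
    using that cl[OF that] by (metis quotientI)
  define R where "R = r ` (?V // E\<^sup>*)"
  have RV: "R \<subseteq> ?V" using cls by (auto simp: R_def)
  have R_inj: "x = y" if xy: "x \<in> R" "y \<in> R" "g x = g y" for x y
  proof -
    obtain A B where AB: "A \<in> ?V // E\<^sup>*" "B \<in> ?V // E\<^sup>*" "x = r A" "y = r B"
      using xy(1,2) unfolding R_def by blast
    have "A = B" using cls(2)[OF AB(1)] cls(2)[OF AB(2)] xy(3) AB(3,4) by simp
    then show ?thesis using AB by simp
  qed
  have rep: "\<exists>z\<in>R. g z = g x" if "x \<in> ?V" for x
  proof (rule bexI)
    show "g (r {y \<in> ?V. g y = g x}) = g x" using cls(3)[OF cl_mem[OF that]] by blast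
    show "r {y \<in> ?V. g y = g x} \<in> R" unfolding R_def using cl_mem[OF that] by (rule imageI)
  qed
  define K where "K = \<lparr>pverts = R, parcs = {(x, y). x \<in> R \<and> y \<in> R \<and> card (separators g x y) = 1}\<rparr>"
  have "g ` R = g ` ?V"
  proof
    show "g ` R \<subseteq> g ` ?V" using RV by (rule image_mono)
    show "g ` ?V \<subseteq> g ` R"
    proof
      fix X assume "X \<in> g ` ?V"
      then obtain x where "x \<in> ?V" "X = g x" by (rule imageE)
      then obtain z where "z \<in> R" "g z = X" using rep[of x] by blast
      then show "X \<in> g ` R" by blast
    qed
  qed
  then have img: "g ` pverts K = g ` ?V" by (simp add: K_def)
  have "graph_iso (contract H E) K"
  proof (rule graph_isoI)
    have "inj_on r (?V // E\<^sup>*)"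
    proof (rule inj_onI)
      fix A B assume AB: "A \<in> ?V // E\<^sup>*" "B \<in> ?V // E\<^sup>*" "r A = r B"
      show "A = B" using cls(2)[OF AB(1)] cls(2)[OF AB(2)] AB(3) by simp
    qed
    then show "bij_betw r (pverts (contract H E)) (pverts K)"
      by (simp add: bij_betw_def contract_def K_def R_def)
    fix A B assume "A \<in> pverts (contract H E)" "B \<in> pverts (contract H E)"
    then have AB: "A \<in> ?V // E\<^sup>*" "B \<in> ?V // E\<^sup>*" by (auto simp: contract_def)
    note cA = cls[OF AB(1)] and cB = cls[OF AB(2)]
    have sep_eq: "separators g a b = separators g (r A) (r B)" if "a \<in> A" "b \<in> B" for a b
    proof -
      have "g a = g (r A)" "g b = g (r B)" using that cA(2) cB(2) by blast+
      then show ?thesis by (simp add: separators_def)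
    qed
    have mem: "a \<in> D" if "a \<in> ?V" "D = {y \<in> ?V. g y = g z}" "separators g z a = {}" for a z D
    proof -
      have "g a = g z" using that(3) g_eq by metis
      then show ?thesis using that(1) unfolding that(2) by simp
    qed
    have "(A \<noteq> B \<and> (\<exists>a\<in>A. \<exists>b\<in>B. (a, b) \<in> parcs H)) \<longleftrightarrow> card (separators g (r A) (r B)) = 1"
    proof
      assume L: "A \<noteq> B \<and> (\<exists>a\<in>A. \<exists>b\<in>B. (a, b) \<in> parcs H)"
      then obtain a b where ab: "a \<in> A" "b \<in> B" "(a, b) \<in> parcs H" by blast
      obtain i where i: "separators f a b = {i}" using ab(3) arc by (meson card_1_singletonE)
      have "separators g (r A) (r B) \<noteq> {}"
      proof
        assume "separators g (r A) (r B) = {}"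
        then have "g (r A) = g (r B)" using g_eq by blast
        then show False using L cA(2) cB(2) by simp
      qed
      moreover have "separators g (r A) (r B) = {i} - {e}"
        using sep_eq[OF ab(1,2)] sg[of a b] i by simp
      ultimately show "card (separators g (r A) (r B)) = 1" by (cases "i = e") auto
    next
      assume card1: "card (separators g (r A) (r B)) = 1"
      then obtain c where c: "separators g (r A) (r B) = {c}" by (meson card_1_singletonE)
      then have "A \<noteq> B" using separators_self by auto
      obtain a b where ab: "(a, b) \<in> parcs H" "separators f (r A) a \<subseteq> {e}" "separators f b (r B) \<subseteq> {e}"
        using arc_up_to_coord[OF C cA(1) cB(1)] c unfolding sg by blast
      have "a \<in> A" using ab(1,2) arc by (intro mem[OF _ cA(2)]) (auto simp: sg)
      moreover have "b \<in> B"
        using ab(1,3) arc by (intro mem[OF _ cB(2)]) (auto simp: sg separators_sym[of f "r B"])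
      ultimately have "\<exists>a\<in>A. \<exists>b\<in>B. (a, b) \<in> parcs H" using ab(1) by blast
      then show "A \<noteq> B \<and> (\<exists>a\<in>A. \<exists>b\<in>B. (a, b) \<in> parcs H)" using \<open>A \<noteq> B\<close> by blast
    qed
    then show "(A, B) \<in> parcs (contract H E) \<longleftrightarrow> (r A, r B) \<in> parcs K"
      using AB by (simp add: contract_def K_def R_def)
  qed (auto simp: contract_def K_def)
  moreover have "cube_coords K g"
  proof (rule cube_coordsI)
    show "(x, y) \<in> parcs K \<longleftrightarrow> x \<in> pverts K \<and> y \<in> pverts K \<and> card (separators g x y) = 1" for x y
      by (simp add: K_def)
    show "pverts K \<noteq> {}" using rep[OF e(1)] by (auto simp: K_def)
    show "finite (separators g x y)" if "x \<in> pverts K" "y \<in> pverts K" for x y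
      using cube_coordsD(2)[OF C, of x y] that RV by (auto simp: K_def sg)
    show "\<exists>z\<in>pverts K. \<exists>i\<in>separators g x y. separators g x z = {i}"
      if xy: "x \<in> pverts K" "y \<in> pverts K" "x \<noteq> y" for x y
    proof -
      have xyR: "x \<in> R" "y \<in> R" using xy by (auto simp: K_def)
      then have xyV: "x \<in> ?V" "y \<in> ?V" using RV by auto
      have gne: "g x \<noteq> g y" using R_inj xyR xy(3) by blast
      have "\<exists>z\<in>?V. \<exists>i\<in>separators g x y. separators g x z = {i}"
      proof -
        obtain z i where z: "z \<in> ?V" "i \<in> separators f x y" "separators f x z = {i}"
            "separators f z y = separators f x y - {i}"
          using cube_coords_step[OF C xyV xy(3)] by metis
        show ?thesis
        proof (cases "i = e")
          case False
          then show ?thesis using z sg[of x y] sg[of x z] by auto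
        next
          case True
          then have gz: "g x = g z" using z(3) sg[of x z] g_eq by simp
          then have "z \<noteq> y" using gne by auto
          then obtain w j where w: "w \<in> ?V" "j \<in> separators f z y" "separators f z w = {j}"
            using cube_coords_step[OF C z(1) xyV(2)] by metis
          have "j \<noteq> e" using w(2) z(4) True by auto
          have "separators g x w = separators g z w" using gz by (simp add: separators_def)
          then have "separators g x w = {j}" using sg[of z w] w(3) \<open>j \<noteq> e\<close> by auto
          moreover have "j \<in> separators g x y" using w(2) z(4) \<open>j \<noteq> e\<close> sg[of x y] by auto
          ultimately show ?thesis using w(1) by blast
        qed
      qed
      then obtain z i where z: "z \<in> ?V" "i \<in> separators g x y" "separators g x z = {i}" by blast
      obtain z' where z': "z' \<in> R" "g z' = g z" using rep[OF z(1)] by blast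
      then have "separators g x z' = {i}" using z(3) by (simp add: separators_def)
      moreover have "z' \<in> pverts K" using z'(1) by (simp add: K_def)
      ultimately show ?thesis using z(2) by blast
    qed
  qed
  ultimately show ?thesis using E img by blast
qed

text \<open>A coordinate that is constant on the graph has no class to contract; then the graph itself serves.\<close>

lemma pc_minor_delete_coord:
  fixes G :: "'a pair_pre_digraph"
  assumes H: "pc_minor G H" "cube_coords H f"
  shows "\<exists>K. pc_minor G K \<and> cube_coords K (\<lambda>x. f x - {e}) \<and>
    (\<lambda>x. f x - {e}) ` pverts K = (\<lambda>x. f x - {e}) ` pverts H"
proof (cases "\<exists>x\<in>pverts H. \<exists>y\<in>pverts H. e \<in> separators f x y")
  case True
  then obtain x y where "x \<in> pverts H" "y \<in> pverts H" "e \<in> separators f x y" by blast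
  from contraction_coords[OF H(2) this] obtain E and K :: "'a pair_pre_digraph"
    where EK: "E \<in> Theta_classes H" "graph_iso (contract H E) K" "cube_coords K (\<lambda>x. f x - {e})"
      "(\<lambda>x. f x - {e}) ` pverts K = (\<lambda>x. f x - {e}) ` pverts H"
    by (elim bexE exE conjE)
  show ?thesis using pc_minor.contraction[OF H(1) EK(1,2)] EK(3,4) by (intro exI[of _ K] conjI)
next
  case False
  have "separators (\<lambda>x. f x - {e}) x y = separators f x y" if "x \<in> pverts H" "y \<in> pverts H" for x y
  proof -
    have "separators (\<lambda>x. f x - {e}) x y = separators f x y - {e}" by (auto simp: separators_def)
    moreover have "e \<notin> separators f x y" using False that by blast
    ultimately show ?thesis by simp
  qed
  then have "cube_coords H (\<lambda>x. f x - {e})" using H(2) by (simp add: cube_coords_def)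
  then show ?thesis using H(1) by (intro exI[of _ H] conjI) simp_all
qed

lemma pc_minor_delete_coords:
  fixes G :: "'a pair_pre_digraph"
  assumes "finite N" "pc_minor G H" "cube_coords H f"
  shows "\<exists>K. pc_minor G K \<and> cube_coords K (\<lambda>x. f x - N) \<and>
    (\<lambda>x. f x - N) ` pverts K = (\<lambda>x. f x - N) ` pverts H"
  using assms(1)
proof induction
  case empty
  then show ?case using assms by auto
next
  case (insert e N)
  then obtain K where K: "pc_minor G K" "cube_coords K (\<lambda>x. f x - N)"
    "(\<lambda>x. f x - N) ` pverts K = (\<lambda>x. f x - N) ` pverts H" by blast
  obtain K' where K': "pc_minor G K'" "cube_coords K' (\<lambda>x. f x - N - {e})"
    "(\<lambda>x. f x - N - {e}) ` pverts K' = (\<lambda>x. f x - N - {e}) ` pverts K"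
    using pc_minor_delete_coord[OF K(1,2), of e] by blast
  have eq: "f x - N - {e} = f x - insert e N" for x by blast
  have "(\<lambda>x. f x - N - {e}) ` pverts K = (\<lambda>X. X - {e}) ` (\<lambda>x. f x - N) ` pverts K"
    by (simp add: image_image)
  also have "\<dots> = (\<lambda>x. f x - N - {e}) ` pverts H" unfolding K(3) by (simp add: image_image)
  finally show ?case using K' unfolding eq by auto
qed

text \<open>Delete all coordinates but three. What remains is a cube without one vertex; complementing
  coordinates moves the missing vertex to the top, as in \<open>Q3_minus\<close>.\<close>

lemma seven_octants_minor:
  fixes G :: "'a pair_pre_digraph"
  assumes C: "cube_coords G f" and M: "geo_convex G M" and K0: "finite K0" "\<And>x. x \<in> M \<Longrightarrow> f x \<subseteq> K0"
    and ijk: "i \<noteq> j" "i \<noteq> k" "j \<noteq> k" and T: "T \<subseteq> {i, j, k}"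
    and img: "(\<lambda>x. f x \<inter> {i, j, k}) ` M = Pow {i, j, k} - {T}"
  shows "has_pc_minor G Q3_minus"
proof -
  let ?U = "{i, j, k}"
  define N where "N = K0 - ?U"
  have ne: "M \<noteq> {}"
  proof
    assume "M = {}"
    then have "Pow ?U \<subseteq> {T}" using img by auto
    then have "?U = {}" by (metis Pow_bottom Pow_top singletonD subsetD)
    then show False by simp
  qed
  have "finite N" using K0 by (simp add: N_def)
  then obtain K where K: "pc_minor G K" "cube_coords K (\<lambda>x. f x - N)"
    "(\<lambda>x. f x - N) ` pverts K = (\<lambda>x. f x - N) ` pverts (induced G M)"
    using pc_minor_delete_coords[OF _ pc_minor.convex_subgraph[OF M] cube_coords_induced[OF C M ne]]
    by blast
  define h where "h = (\<lambda>x. f x - N)"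
  have "f x - N = f x \<inter> ?U" if "x \<in> M" for x
    using K0(2)[OF that] by (auto simp: N_def)
  then have "(\<lambda>x. f x - N) ` M = (\<lambda>x. f x \<inter> ?U) ` M" by (intro image_cong) simp_all
  then have "(\<lambda>x. f x - N) ` M = Pow ?U - {T}" unfolding img .
  then have h_img: "h ` pverts K = Pow ?U - {T}"
    using K(3) by (simp add: h_def induced_def)
  have hC: "cube_coords K h" using K(2) by (simp add: h_def)
  have h_inj: "inj_on h (pverts K)"
  proof (rule inj_onI)
    fix x y assume xy: "x \<in> pverts K" "y \<in> pverts K" "h x = h y"
    then have "separators h x y = {}" by (auto simp: separators_def)
    then show "x = y" using cube_coords_inj[OF hC] xy by blast
  qed
  have h_sub: "h x \<subseteq> ?U" "h x \<noteq> T" if "x \<in> pverts K" for x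
  proof -
    have "h x \<in> h ` pverts K" using that by (rule imageI)
    then have mem: "h x \<in> Pow ?U - {T}" unfolding h_img .
    show "h x \<subseteq> ?U" using DiffD1[OF mem] by (rule PowD)
    show "h x \<noteq> T" using DiffD2[OF mem] by blast
  qed
  define w :: "_ \<Rightarrow> nat" where "w = (\<lambda>l. if l = i then 0 else if l = j then 1 else 2)"
  have w_inj: "inj_on w ?U" using ijk by (auto simp: w_def inj_on_def)
  have w_img: "w ` ?U = {0, 1, 2}" using ijk by (auto simp: w_def)
  \<comment> \<open>Reflect so that the missing pattern \<open>T\<close> becomes the full set.\<close>
  define p where "p x = {l \<in> ?U. l \<in> h x \<longleftrightarrow> l \<in> T}" for x
  define q where "q x = w ` p x" for x
  have p_sub: "p x \<subseteq> ?U" for x unfolding p_def by blast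
  have q_eq: "q x = q y \<longleftrightarrow> p x = p y" for x y
    unfolding q_def by (rule inj_on_image_eq_iff[OF w_inj p_sub p_sub])
  have p_diff: "sym_diff (p x) (p y) = separators h x y" if "x \<in> pverts K" "y \<in> pverts K" for x y
    using h_sub(1)[OF that(1)] h_sub(1)[OF that(2)] unfolding p_def separators_def by blast
  have q_mem: "q x \<in> Pow {0, 1, 2} - {{0, 1, 2}}" if x: "x \<in> pverts K" for x
  proof -
    have "p x \<noteq> ?U" using h_sub[OF x] T unfolding p_def by blast
    then have "q x \<noteq> {0, 1, 2}"
      unfolding q_def w_img[symmetric] using inj_on_image_eq_iff[OF w_inj p_sub subset_refl] by simp
    moreover have "q x \<subseteq> {0, 1, 2}" unfolding q_def w_img[symmetric] using p_sub by (rule image_mono)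
    ultimately show ?thesis by simp
  qed
  have V: "pverts Q3_minus = Pow {0, 1, 2} - {{0, 1, 2}}"
    by (simp add: Q3_minus_def induced_def)
  have "bij_betw q (pverts K) (pverts Q3_minus)"
  proof (rule bij_betw_imageI)
    show q_inj: "inj_on q (pverts K)"
    proof (rule inj_onI)
      fix x y assume xy: "x \<in> pverts K" "y \<in> pverts K" "q x = q y"
      then have "separators h x y = {}" using p_diff[OF xy(1,2)] q_eq by simp
      then show "x = y" by (rule cube_coords_inj[OF hC xy(1,2)])
    qed
    have "card (Pow ?U) = 8" using ijk by (simp add: card_Pow)
    then have "card (Pow ?U - {T}) = 7" using T by (subst card_Diff_singleton) simp_all
    then have "card (q ` pverts K) = 7"
      using card_image[OF h_inj] card_image[OF q_inj] h_img by simp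
    moreover have "card (pverts Q3_minus) = 7" unfolding V by (subst card_Diff_singleton) (simp_all add: card_Pow)
    moreover have "q ` pverts K \<subseteq> pverts Q3_minus" unfolding V using q_mem by blast
    moreover have "finite (pverts Q3_minus)" unfolding V by simp
    ultimately show "q ` pverts K = pverts Q3_minus" by (intro card_subset_eq) simp_all
  qed
  moreover have "(x, y) \<in> parcs K \<longleftrightarrow> (q x, q y) \<in> parcs Q3_minus" if xy: "x \<in> pverts K" "y \<in> pverts K" for x y
  proof -
    have diff: "w ` (p x - p y) = q x - q y" for x y
      unfolding q_def using p_sub by (intro inj_on_image_set_diff[OF w_inj]) blast+
    have "q x - q y \<union> (q y - q x) = w ` separators h x y"
      unfolding p_diff[OF xy, symmetric] image_Un diff ..
    moreover have "separators h x y \<subseteq> ?U" using p_diff[OF xy] p_sub by blast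
    ultimately have card_eq: "card (q x - q y \<union> (q y - q x)) = card (separators h x y)"
      using card_image[OF inj_on_subset[OF w_inj]] by metis
    have "(q x, q y) \<in> parcs Q3_minus \<longleftrightarrow> card (q x - q y \<union> (q y - q x)) = 1"
      using q_mem[OF xy(1)] q_mem[OF xy(2)] finite_subset[of "q x" "{0, 1, 2}"]
        finite_subset[of "q y" "{0, 1, 2}"]
      unfolding Q3_minus_def induced_def hypercube_def by simp
    then show ?thesis using card_eq cube_coords_arc_iff[OF hC] xy by simp
  qed
  moreover have "parcs K \<subseteq> pverts K \<times> pverts K"
    using cube_coords_arc_iff[OF hC] by auto
  moreover have "parcs Q3_minus \<subseteq> pverts Q3_minus \<times> pverts Q3_minus"
    by (auto simp: Q3_minus_def induced_def)
  ultimately have "graph_iso K Q3_minus" by (intro graph_isoI[of q]) auto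
  then show ?thesis using K(1) unfolding has_pc_minor_def by blast
qed

lemma no_seven_octants_coords:
  fixes G :: "'a pair_pre_digraph"
  assumes C: "cube_coords G f" and no: "\<not> has_pc_minor G Q3_minus" and K: "finite K"
  shows "no_seven_octants (coord_box G f K) (coord_halfspaces f K)"
proof -
  let ?V = "coord_box G f K" and ?H = "coord_halfspaces f K"
  have V: "geo_convex G ?V" by (rule geo_convex_coord_box[OF C])
  interpret halfspace_system ?V ?H by (rule halfspace_system_coords[OF C V])
  show ?thesis
  proof
    fix a b c \<tau>
    assume abc: "a \<in> ?H" "b \<in> ?H" "c \<in> ?H" and \<tau>: "\<tau> \<subseteq> ?H"
      and feas: "feasible ({- a, b, c} \<union> \<tau>)" "feasible ({a, - b, c} \<union> \<tau>)"
      "feasible ({a, b, - c} \<union> \<tau>)" "feasible ({a, - b, - c} \<union> \<tau>)" "feasible ({- a, b, - c} \<union> \<tau>)"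
      "feasible ({- a, - b, c} \<union> \<tau>)" "feasible ({- a, - b, - c} \<union> \<tau>)"
    show "feasible ({a, b, c} \<union> \<tau>)"
    proof (rule ccontr)
      assume inf: "\<not> feasible ({a, b, c} \<union> \<tau>)"
      obtain i s where i: "i \<in> K" "\<forall>x. x \<in> a \<longleftrightarrow> (i \<in> f x) = s" using coord_halfspacesE[OF abc(1)] .
      obtain j t where j: "j \<in> K" "\<forall>x. x \<in> b \<longleftrightarrow> (j \<in> f x) = t" using coord_halfspacesE[OF abc(2)] .
      obtain k r where k: "k \<in> K" "\<forall>x. x \<in> c \<longleftrightarrow> (k \<in> f x) = r" using coord_halfspacesE[OF abc(3)] .
      define M where "M = {x \<in> ?V. \<forall>h\<in>\<tau>. x \<in> h}"
      have M: "geo_convex G M" unfolding M_def by (rule geo_convex_Int_halfspaces[OF C V \<tau>])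
      have "\<exists>x\<in>M. (x \<in> a) = \<alpha> \<and> (x \<in> b) = \<beta> \<and> (x \<in> c) = \<gamma>" if "\<not> (\<alpha> \<and> \<beta> \<and> \<gamma>)" for \<alpha> \<beta> \<gamma>
        using that feas by (cases \<alpha>; cases \<beta>; cases \<gamma>) (auto simp: feasible_def M_def)
      then have oct: "\<exists>x\<in>M. ((i \<in> f x) = s) = \<alpha> \<and> ((j \<in> f x) = t) = \<beta> \<and> ((k \<in> f x) = r) = \<gamma>"
        if "\<not> (\<alpha> \<and> \<beta> \<and> \<gamma>)" for \<alpha> \<beta> \<gamma>
        using that i(2) j(2) k(2) by simp
      have full: "\<not> ((i \<in> f x) = s \<and> (j \<in> f x) = t \<and> (k \<in> f x) = r)" if "x \<in> M" for x
        using inf that i(2) j(2) k(2) by (auto simp: feasible_def M_def)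
      have ijk: "i \<noteq> j" "i \<noteq> k" "j \<noteq> k"
        using oct[of True False False] oct[of False True False] oct[of False False True]
          oct[of True True False] oct[of True False True] oct[of False True True] by auto
      define T where "T = {l. l = i \<and> s \<or> l = j \<and> t \<or> l = k \<and> r}"
      have "has_pc_minor G Q3_minus"
      proof (rule seven_octants_minor[OF C M K _ ijk])
        show "f x \<subseteq> K" if "x \<in> M" for x using that by (simp add: M_def coord_box_def)
        show "T \<subseteq> {i, j, k}" by (auto simp: T_def)
        show "(\<lambda>x. f x \<inter> {i, j, k}) ` M = Pow {i, j, k} - {T}"
        proof
          show "(\<lambda>x. f x \<inter> {i, j, k}) ` M \<subseteq> Pow {i, j, k} - {T}"
          proof
            fix X assume "X \<in> (\<lambda>x. f x \<inter> {i, j, k}) ` M"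
            then obtain x where x: "x \<in> M" "X = f x \<inter> {i, j, k}" by blast
            have "(i \<in> T) = s" "(j \<in> T) = t" "(k \<in> T) = r" using ijk by (auto simp: T_def)
            then have "X \<noteq> T" using full[OF x(1)] x(2) by auto
            then show "X \<in> Pow {i, j, k} - {T}" using x by auto
          qed
          show "Pow {i, j, k} - {T} \<subseteq> (\<lambda>x. f x \<inter> {i, j, k}) ` M"
          proof
            fix X assume X: "X \<in> Pow {i, j, k} - {T}"
            have "\<not> ((i \<in> X) = s \<and> (j \<in> X) = t \<and> (k \<in> X) = r)"
              using X ijk by (auto simp: T_def)
            from oct[OF this] obtain x where x: "x \<in> M" "((i \<in> f x) = s) = ((i \<in> X) = s)"
              "((j \<in> f x) = t) = ((j \<in> X) = t)" "((k \<in> f x) = r) = ((k \<in> X) = r)"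
              by (elim bexE conjE)
            have U: "(l \<in> f x) = (l \<in> X)" if "l \<in> {i, j, k}" for l
              using that x(2-4) by (elim insertE emptyE; cases s; cases t; cases r; simp)
            have "f x \<inter> {i, j, k} = X"
            proof
              show "f x \<inter> {i, j, k} \<subseteq> X" using U by blast
              show "X \<subseteq> f x \<inter> {i, j, k}" using U X by blast
            qed
            then show "X \<in> (\<lambda>x. f x \<inter> {i, j, k}) ` M" using x(1) by (intro image_eqI[of _ _ x]) simp_all
          qed
        qed
      qed
      then show False using no by blast
    qed
  qed
qed

section \<open>Isometric cycles in coordinates\<close>

text \<open>The number \<open>j\<close> counts forward minus backward steps of the walk.\<close>

lemma cycle_walk_dvd:
  assumes "(s, t) \<in> parcs (cycle_graph m) ^^ k"
  shows "\<exists>j. \<bar>j\<bar> \<le> int k \<and> int m dvd int t - int s - j"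
  using assms
proof (induction k arbitrary: t)
  case 0
  then show ?case by (intro exI[of _ 0]) simp
next
  case (Suc k)
  obtain u where u: "(s, u) \<in> parcs (cycle_graph m) ^^ k" "(u, t) \<in> parcs (cycle_graph m)"
    using Suc.prems by auto
  obtain j where j: "\<bar>j\<bar> \<le> int k" "int m dvd int u - int s - j" using Suc.IH[OF u(1)] by blast
  have wrap: "int m dvd int (Suc a mod m) - int a - 1" for a
    by (simp add: mod_eq_dvd_iff[symmetric] zmod_int diff_diff_eq algebra_simps)
  consider "t = Suc u mod m" | "u = Suc t mod m" using u(2) by (auto simp: cycle_graph_def)
  then show ?case
  proof cases
    case 1
    then have "int m dvd int t - int u - 1" using wrap[of u] by simp
    from dvd_add[OF this j(2)] have "int m dvd int t - int s - (j + 1)" by (simp add: algebra_simps)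
    then show ?thesis using j(1) by (intro exI[of _ "j + 1"]) auto
  next
    case 2
    then have "int m dvd int u - int t - 1" using wrap[of t] by simp
    from dvd_diff[OF j(2) this] have "int m dvd int t - int s - (j - 1)" by (simp add: algebra_simps)
    then show ?thesis using j(1) by (intro exI[of _ "j - 1"]) auto
  qed
qed

lemma cycle_antipodal_walk:
  assumes "((s mod (2 * n)), ((s + n) mod (2 * n))) \<in> parcs (cycle_graph (2 * n)) ^^ k"
  shows "n \<le> k"
proof (rule ccontr)
  assume "\<not> n \<le> k"
  obtain j where j: "\<bar>j\<bar> \<le> int k" "int (2 * n) dvd int ((s + n) mod (2 * n)) - int (s mod (2 * n)) - j"
    using cycle_walk_dvd[OF assms] by blast
  have d1: "int (2 * n) dvd int (s + n) - int ((s + n) mod (2 * n))"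
    "int (2 * n) dvd int s - int (s mod (2 * n))"
    by (simp_all only: zmod_int dvd_minus_mod)
  from dvd_diff[OF dvd_add[OF j(2) d1(1)] d1(2)] have "int (2 * n) dvd int n - j"
    by (simp add: algebra_simps)
  moreover have "0 < int n - j" "int n - j < int (2 * n)" using j(1) \<open>\<not> n \<le> k\<close> by auto
  ultimately show False by (auto dest: zdvd_imp_le)
qed

text \<open>The step from \<open>c t\<close> to \<open>c (Suc t)\<close> flips one coordinate \<open>fl t\<close>. Since parity alternates, the length is
  even, and since opposite vertices have distance \<open>n\<close>, any \<open>n\<close> consecutive flips are distinct.
  All these windows of flips have the same set of values, hence \<open>fl\<close> has period \<open>n\<close>.\<close>

lemma isometric_cycle_coords:
  fixes G :: "'a pair_pre_digraph"
  assumes coords: "cube_coords G f" and cyc: "isometric_cycle C G"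
  obtains c :: "nat \<Rightarrow> 'a" and e n where "2 \<le> n" "pverts C = c ` {..<2 * n}" "range c \<subseteq> pverts G"
    "inj_on e {..<n}"
    "\<forall>t\<le>n. separators f (c 0) (c t) = e ` {..<t}"
    "\<forall>t\<le>n. separators f (c 0) (c (n + t)) = e ` {t..<n}"
proof -
  obtain m where m: "3 \<le> m" "graph_iso C (cycle_graph m)" and iso: "isometric_subgraph C G"
    using cyc unfolding isometric_cycle_def by blast
  have sub: "pverts C \<subseteq> pverts G" "parcs C \<subseteq> parcs G" and CC: "connected_graph C"
    and dist: "\<And>u v. u \<in> pverts C \<Longrightarrow> v \<in> pverts C \<Longrightarrow> gdist C u v = gdist G u v"
    using iso unfolding isometric_subgraph_def subgraph_def by auto
  obtain g where g: "bij_betw g (pverts C) (pverts (cycle_graph m))"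
    "\<And>x y. x \<in> pverts C \<Longrightarrow> y \<in> pverts C \<Longrightarrow> (x, y) \<in> parcs C \<longleftrightarrow> (g x, g y) \<in> parcs (cycle_graph m)"
    using graph_isoE[OF m(2)] by metis
  have Vm: "pverts (cycle_graph m) = {..<m}" by (simp add: cycle_graph_def)
  define c where "c t = the_inv_into (pverts C) g (t mod m)" for t
  have inj: "inj_on g (pverts C)" and img: "g ` pverts C = {..<m}" using g(1) Vm by (auto simp: bij_betw_def)
  have cC: "c t \<in> pverts C" and gc: "g (c t) = t mod m" for t
  proof -
    have "t mod m \<in> g ` pverts C" using img m(1) by simp
    then show "c t \<in> pverts C" "g (c t) = t mod m"
      using the_inv_into_into[OF inj _ subset_refl] f_the_inv_into_f[OF inj] by (auto simp: c_def)
  qed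
  have pC: "pverts C = c ` {..<m}"
  proof
    show "pverts C \<subseteq> c ` {..<m}"
    proof
      fix x assume x: "x \<in> pverts C"
      then have "g x \<in> {..<m}" using img by blast
      then have "c (g x) = x" using the_inv_into_f_f[OF inj x] by (simp add: c_def)
      then show "x \<in> c ` {..<m}" using \<open>g x \<in> {..<m}\<close> by (intro image_eqI[of _ _ "g x"]) simp_all
    qed
  qed (use cC in blast)
  have cG: "c t \<in> pverts G" for t using cC sub by blast
  have arc: "(c t, c (Suc t)) \<in> parcs G" for t
  proof -
    have "(t mod m, Suc t mod m) \<in> parcs (cycle_graph m)"
      using m(1) by (simp add: cycle_graph_def mod_Suc_eq)
    then have "(c t, c (Suc t)) \<in> parcs C" using g(2)[OF cC cC] gc by simp
    then show ?thesis using sub by blast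
  qed
  have cper: "c (t + m) = c t" for t by (simp add: c_def)
  have "\<exists>i. separators f (c t) (c (Suc t)) = {i}" for t
    using arc cube_coords_arc_iff[OF coords] by (meson card_1_singletonE)
  then obtain fl where fl: "separators f (c t) (c (Suc t)) = {fl t}" for t by metis
  have sepSuc: "separators f (c s) (c (Suc t)) = sym_diff (separators f (c s) (c t)) {fl t}" for s t
    using separators_trans[of f "c s" "c (Suc t)" "c t"] fl by simp
  note fin = cube_coordsD(2)[OF coords cG cG]
  have "even (card (separators f (c 0) (c t))) \<longleftrightarrow> even t" for t
  proof (induction t)
    case (Suc t)
    let ?A = "separators f (c 0) (c t)"
    show ?case
    proof (cases "fl t \<in> ?A")
      case True
      then have "separators f (c 0) (c (Suc t)) = ?A - {fl t}" unfolding sepSuc by auto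
      moreover have "card ?A \<noteq> 0" using True fin by auto
      ultimately show ?thesis using Suc True fin by (simp add: card_Diff_singleton)
    next
      case False
      then have "separators f (c 0) (c (Suc t)) = insert (fl t) ?A" unfolding sepSuc by auto
      then show ?thesis using Suc False fin by simp
    qed
  qed simp
  from this[of m] have "even m" using cper[of 0] by simp
  then obtain n where n: "m = 2 * n" by blast
  have n2: "2 \<le> n" using m(1) n by simp
  have far: "n \<le> card (separators f (c s) (c (s + n)))" for s
  proof -
    let ?k = "gdist C (c s) (c (s + n))"
    have map: "(g u, g v) \<in> parcs (cycle_graph m) ^^ k"
      if "(u, v) \<in> parcs C ^^ k" "u \<in> pverts C" for u v k
      using that
    proof (induction k arbitrary: v)
      case (Suc k)
      then obtain w where w: "(u, w) \<in> parcs C ^^ k" "(w, v) \<in> parcs C" by auto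
      then have "w \<in> pverts C" "v \<in> pverts C" using connected_graphD(1)[OF CC] by auto
      then have "(g w, g v) \<in> parcs (cycle_graph m)" using g(2) w(2) by blast
      then show ?case using Suc.IH[OF w(1) Suc.prems(2)] by auto
    qed simp
    have "(g (c s), g (c (s + n))) \<in> parcs (cycle_graph m) ^^ ?k"
      by (rule map[OF gdist_relpow[OF CC cC cC] cC])
    then have "n \<le> ?k" unfolding gc n by (rule cycle_antipodal_walk)
    then show ?thesis using dist[OF cC cC] cube_coordsD(3)[OF coords cG cG] by simp
  qed
  have sub_fl: "separators f (c s) (c (s + k)) \<subseteq> fl ` {s..<s + k}" for s k
  proof (induction k)
    case (Suc k)
    then show ?case using sepSuc[of s "s + k"] by (auto simp: atLeastLessThanSuc)
  qed simp
  have window: "card (fl ` {s..<s + n}) = n" "separators f (c s) (c (s + n)) = fl ` {s..<s + n}" for s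
  proof -
    have "card (fl ` {s..<s + n}) \<le> n" using card_image_le[of "{s..<s + n}" fl] by simp
    moreover have le: "card (separators f (c s) (c (s + n))) \<le> card (fl ` {s..<s + n})"
      using sub_fl by (intro card_mono) auto
    ultimately show full: "card (fl ` {s..<s + n}) = n" using far[of s] by linarith
    have "card (separators f (c s) (c (s + n))) = card (fl ` {s..<s + n})"
      using full le far[of s] by linarith
    then show "separators f (c s) (c (s + n)) = fl ` {s..<s + n}"
      using sub_fl by (intro card_subset_eq) simp_all
  qed
  have fl_inj: "inj_on fl {s..<s + n}" for s
    using window(1)[of s] by (intro eq_card_imp_inj_on) auto
  have steps: "separators f (c s) (c (s + k)) = fl ` {s..<s + k}" if "k \<le> n" for s k
    using that
  proof (induction k)
    case (Suc k)
    have "fl (s + k) \<notin> fl ` {s..<s + k}"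
      using inj_on_image_mem_iff[OF fl_inj[of s], of "s + k" "{s..<s + k}"] Suc.prems by auto
    then show ?case
      using Suc sepSuc[of s "s + k"] by (auto simp: atLeastLessThanSuc)
  qed simp
  define K where "K = fl ` {..<n}"
  have K0: "fl ` {0..<n} = K" by (simp add: K_def lessThan_atLeast0)
  have K_sep: "separators f (c 0) (c n) = K" using window(2)[of 0] K0 by simp
  have "separators f (c n) (c (n + n)) = K"
  proof -
    have "c (n + n) = c 0" using cper[of 0] n by (simp add: mult_2)
    then show ?thesis using K_sep separators_sym[of f "c 0" "c n"] by simp
  qed
  then have Kn: "fl ` {n..<n + n} = K" using window(2)[of n] by simp
  have fl_K: "fl t \<in> K" if "t < n + n" for t
    using that K0 Kn by (cases "t < n") (auto simp: K_def)
  have window_K: "fl ` {t..<t + n} = K" if "t \<le> n" for t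
  proof (rule card_subset_eq)
    show "finite K" by (simp add: K_def)
    show "fl ` {t..<t + n} \<subseteq> K" using fl_K that by auto
    show "card (fl ` {t..<t + n}) = card K" using window(1)[of t] window(1)[of 0] K0 by simp
  qed
  have fl_per: "fl (t + n) = fl t" if t: "t < n" for t
  proof -
    have "fl (t + n) \<in> fl ` {t..<t + n}" using fl_K window_K[of t] t by simp
    then obtain u where u: "u \<in> {t..<t + n}" "fl (t + n) = fl u" by blast
    have "u = t"
    proof (rule ccontr)
      assume "u \<noteq> t"
      then have "u \<in> {Suc t..<Suc t + n}" "t + n \<in> {Suc t..<Suc t + n}" using u n2 by auto
      then have "u = t + n" using fl_inj[of "Suc t"] u(2) by (metis inj_onD)
      then show False using u by simp
    qed
    then show ?thesis using u by simp
  qed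
  show thesis
  proof (rule that[of n c fl])
    show "pverts C = c ` {..<2 * n}" using pC n by simp
    show "range c \<subseteq> pverts G" using cG by blast
    show "inj_on fl {..<n}" using fl_inj[of 0] by (simp add: lessThan_atLeast0)
    show "\<forall>t\<le>n. separators f (c 0) (c t) = fl ` {..<t}"
      using steps[of _ 0] by (simp add: lessThan_atLeast0)
    show "\<forall>t\<le>n. separators f (c 0) (c (n + t)) = fl ` {t..<n}"
    proof (intro allI impI)
      fix t assume t: "t \<le> n"
      have "fl ` {n..<n + t} = fl ` (\<lambda>u. u + n) ` {..<t}"
        by (simp add: image_add_atLeastLessThan lessThan_atLeast0 add.commute)
      also have "\<dots> = fl ` {..<t}"
        unfolding image_image using fl_per t by (intro image_cong) auto
      finally have shift: "separators f (c n) (c (n + t)) = fl ` {..<t}"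
        using steps[OF t, of n] by simp
      have "separators f (c 0) (c (n + t)) = sym_diff (fl ` {..<n}) (fl ` {..<t})"
        using separators_trans[of f "c 0" "c (n + t)" "c n"] K_sep shift by (simp add: K_def)
      also have "\<dots> = fl ` {..<n} - fl ` {..<t}" using t by auto
      also have "\<dots> = fl ` ({..<n} - {..<t})"
        using fl_inj[of 0] t by (intro inj_on_image_set_diff[symmetric, of fl "{..<n}"])
          (auto simp: lessThan_atLeast0)
      also have "{..<n} - {..<t} = {t..<n}" by auto
      finally show "separators f (c 0) (c (n + t)) = fl ` {t..<n}" .
    qed
  qed (rule n2)
qed

section \<open>Products of cycles as set families\<close>

text \<open>The even cycle of length \<open>2 * k\<close> inside the \<open>k\<close>-cube: the initial segments of growing length,
  followed by the final segments of shrinking length.\<close>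

definition cyclic_segment :: "nat \<Rightarrow> nat \<Rightarrow> nat set" where
  "cyclic_segment k t = {p. p < k \<and> p < t \<and> t \<le> p + k}"

lemma cyclic_segment_low: "t \<le> k \<Longrightarrow> cyclic_segment k t = {..<t}"
  and cyclic_segment_high: "k \<le> t \<Longrightarrow> cyclic_segment k t = {t - k..<k}"
  by (auto simp: cyclic_segment_def)

text \<open>The cycle is isometric in the cube.\<close>

lemma card_sym_diff_cyclic_segment:
  assumes "s \<le> t" "t < 2 * k"
  shows "card (sym_diff (cyclic_segment k s) (cyclic_segment k t)) = min (t - s) (2 * k - (t - s))"
proof -
  consider "t \<le> k" | "k < s" | "s \<le> k" "k < t" "t - s \<le> k" | "s \<le> k" "k < t" "k < t - s"
    by linarith
  then show ?thesis
  proof cases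
    case 1
    then have "sym_diff (cyclic_segment k s) (cyclic_segment k t) = {s..<t}"
      using assms by (auto simp: cyclic_segment_def)
    then show ?thesis using 1 assms by simp
  next
    case 2
    then have "sym_diff (cyclic_segment k s) (cyclic_segment k t) = {s - k..<t - k}"
      using assms by (auto simp: cyclic_segment_def)
    then show ?thesis using 2 assms by simp
  next
    case 3
    then have "sym_diff (cyclic_segment k s) (cyclic_segment k t) = {..<t - k} \<union> {s..<k}"
      using assms by (auto simp: cyclic_segment_def)
    moreover have "card ({..<t - k} \<union> {s..<k}) = (t - k) + (k - s)"
      using 3 by (subst card_Un_disjoint) auto
    ultimately show ?thesis using 3 assms by simp
  next
    case 4
    then have "sym_diff (cyclic_segment k s) (cyclic_segment k t) = {..<s} \<union> {t - k..<k}"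
      using assms by (auto simp: cyclic_segment_def)
    moreover have "card ({..<s} \<union> {t - k..<k}) = s + (k - (t - k))"
      using 4 by (subst card_Un_disjoint) auto
    ultimately show ?thesis using 4 assms by simp
  qed
qed

lemma cycle_graph_arc_iff:
  assumes "s < t" "t < m"
  shows "(s, t) \<in> parcs (cycle_graph m) \<longleftrightarrow> t = Suc s \<or> s = 0 \<and> Suc t = m"
    and "(t, s) \<in> parcs (cycle_graph m) \<longleftrightarrow> t = Suc s \<or> s = 0 \<and> Suc t = m"
proof -
  have s: "Suc s mod m = Suc s" using assms by simp
  have t: "Suc t mod m = (if Suc t = m then 0 else Suc t)" using assms by simp
  show "(s, t) \<in> parcs (cycle_graph m) \<longleftrightarrow> t = Suc s \<or> s = 0 \<and> Suc t = m"
    and "(t, s) \<in> parcs (cycle_graph m) \<longleftrightarrow> t = Suc s \<or> s = 0 \<and> Suc t = m"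
    using assms by (auto simp: cycle_graph_def s t)
qed

lemma cycle_graph_no_loop: "2 \<le> m \<Longrightarrow> (s, s) \<notin> parcs (cycle_graph m)"
  by (auto simp: cycle_graph_def mod_Suc)

lemma edge_graph_eq_cycle: "edge_graph = cycle_graph 2"
  by (auto simp: edge_graph_def cycle_graph_def less_2_cases_iff)

definition segments :: "nat set \<Rightarrow> nat set set" where
  "segments L = {A. \<exists>t. A = {p \<in> L. p < t} \<or> A = {p \<in> L. t \<le> p}}"

lemma bounded_initial_segment:
  fixes u :: "nat \<Rightarrow> nat"
  assumes "strict_mono_on {..<k} u"
  shows "\<exists>j\<le>k. {i. i < k \<and> u i < t} = {..<j}"
proof -
  let ?A = "{i. i < k \<and> u i < t}"
  have "\<exists>j. {i. i < k \<and> u i < t} = {..<j}"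
  proof (cases "\<exists>i<k. t \<le> u i")
    case True
    define j where "j = (LEAST i. i < k \<and> t \<le> u i)"
    have "j < k \<and> t \<le> u j" unfolding j_def by (rule LeastI_ex) (use True in blast)
    then have j: "j < k" "t \<le> u j" by blast+
    have least: "u i < t" if "i < j" for i
      using not_less_Least[of i "\<lambda>i. i < k \<and> t \<le> u i"] that j(1) by (auto simp: j_def[symmetric])
    have "?A = {..<j}"
    proof
      show "{..<j} \<subseteq> ?A" using least j(1) by auto
      show "?A \<subseteq> {..<j}"
      proof
        fix i assume i: "i \<in> ?A"
        have "\<not> j \<le> i"
        proof
          assume "j \<le> i"
          then have "u j \<le> u i" using strict_mono_onD[OF assms, of j i] i by (cases "j = i") auto
          then show False using i j by simp
        qed
        then show "i \<in> {..<j}" by simp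
      qed
    qed
    then show ?thesis by blast
  next
    case False
    then have "?A = {..<k}" by (auto simp: not_le)
    then show ?thesis by blast
  qed
  then obtain j where j: "?A = {..<j}" by (elim exE)
  have "?A \<subseteq> {..<k}" by auto
  then have "j \<le> k" unfolding j by simp
  then show ?thesis using j by (intro exI[of _ j] conjI)
qed

text \<open>An increasing enumeration of \<open>L\<close> carries the cyclic segments to the segments of \<open>L\<close>. A single
  element gives \<open>cycle_graph 2\<close>, which is an edge.\<close>

lemma segments_cyclic:
  assumes L: "finite L" "L \<noteq> {}"
  shows "\<exists>Q. bij_betw Q (segments L) {..<2 * card L} \<and> (\<forall>A\<in>segments L. \<forall>B\<in>segments L.
    card (sym_diff A B) = 1 \<longleftrightarrow> (Q A, Q B) \<in> parcs (cycle_graph (2 * card L)))"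
proof -
  define k where "k = card L"
  have k: "0 < k" using L by (simp add: k_def card_gt_0_iff)
  define u where "u i = sorted_list_of_set L ! i" for i
  have "strict_mono_on {..<k} u"
    unfolding u_def k_def using L sorted_wrt_nth_less[OF strict_sorted_list_of_set]
    by (intro strict_mono_onI) simp
  moreover have u_img: "u ` {..<k} = L"
    using nth_image[of k "sorted_list_of_set L"] L by (simp add: u_def k_def lessThan_atLeast0)
  ultimately have u_inj: "inj_on u {..<k}" and u_mono: "strict_mono_on {..<k} u"
    by (auto dest: strict_mono_on_imp_inj_on)
  define P where "P t = u ` cyclic_segment k t" for t
  have cs_sub: "cyclic_segment k t \<subseteq> {..<k}" for t by (auto simp: cyclic_segment_def)
  have P_diff: "card (sym_diff (P s) (P t)) = card (sym_diff (cyclic_segment k s) (cyclic_segment k t))" for s t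
  proof -
    have diff: "u ` (cyclic_segment k s - cyclic_segment k t) = u ` cyclic_segment k s - u ` cyclic_segment k t" for s t
      using cs_sub by (intro inj_on_image_set_diff[OF u_inj]) blast+
    have "sym_diff (P s) (P t) = u ` sym_diff (cyclic_segment k s) (cyclic_segment k t)"
      unfolding P_def image_Un diff ..
    moreover have "card (u ` sym_diff (cyclic_segment k s) (cyclic_segment k t)) =
        card (sym_diff (cyclic_segment k s) (cyclic_segment k t))"
      using cs_sub by (intro card_image inj_on_subset[OF u_inj]) blast
    ultimately show ?thesis by simp
  qed
  have dist: "card (sym_diff (P s) (P t)) = min (t - s) (2 * k - (t - s))" if "s \<le> t" "t < 2 * k" for s t
    using P_diff card_sym_diff_cyclic_segment[OF that] by simp
  have bij: "bij_betw P {..<2 * k} (segments L)"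
  proof -
    have "inj_on P {..<2 * k}"
    proof (rule linorder_inj_onI)
      fix s t assume "s < t" "s \<in> {..<2 * k}" "t \<in> {..<2 * k}"
      then have "card (sym_diff (P s) (P t)) \<noteq> 0" using dist[of s t] by auto
      then show "P s \<noteq> P t" by auto
    qed auto
    moreover have "P ` {..<2 * k} = segments L"
    proof
      show "P ` {..<2 * k} \<subseteq> segments L"
      proof
        fix A assume "A \<in> P ` {..<2 * k}"
        then obtain t where t: "t < 2 * k" "A = P t" by auto
        show "A \<in> segments L"
        proof (cases "t < k")
          case True
          have "A = {p \<in> L. p < u t}"
            unfolding t P_def cyclic_segment_low[OF less_imp_le[OF True]] u_img[symmetric]
            using True strict_mono_on_less[OF u_mono] by (auto simp: image_iff)
          then show ?thesis by (auto simp: segments_def)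
        next
          case False
          then have "t - k < k" using t by linarith
          have "A = {p \<in> L. u (t - k) \<le> p}"
            unfolding t P_def cyclic_segment_high[of k t, OF leI[OF False]] u_img[symmetric]
            using \<open>t - k < k\<close> strict_mono_on_less_eq[OF u_mono] by (auto simp: image_iff)
          then show ?thesis by (auto simp: segments_def)
        qed
      qed
      show "segments L \<subseteq> P ` {..<2 * k}"
      proof
        fix A assume "A \<in> segments L"
        then obtain t where t: "A = {p \<in> L. p < t} \<or> A = {p \<in> L. t \<le> p}" by (auto simp: segments_def)
        obtain j where j: "j \<le> k" "{i. i < k \<and> u i < t} = {..<j}"
          using bounded_initial_segment[OF u_mono] by blast
        have jt: "u i < t \<longleftrightarrow> i < j" if "i < k" for i using j(2) that by auto
        have low: "{p \<in> L. p < t} = P j"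
          unfolding P_def cyclic_segment_low[OF j(1)] u_img[symmetric] using jt j(1) by force
        have high: "{p \<in> L. t \<le> p} = P (k + j)"
        proof -
          have "{p \<in> L. t \<le> p} = u ` {j..<k}" unfolding u_img[symmetric] using jt by (force simp: not_less[symmetric])
          then show ?thesis unfolding P_def by (simp add: cyclic_segment_high)
        qed
        from t show "A \<in> P ` {..<2 * k}"
        proof
          assume "A = {p \<in> L. p < t}"
          then show ?thesis using low j(1) k by auto
        next
          assume A: "A = {p \<in> L. t \<le> p}"
          show ?thesis
          proof (cases "j = k")
            case True
            then have "A = P 0" using A high by (simp add: P_def cyclic_segment_high cyclic_segment_low)
            then show ?thesis using k by auto
          next
            case False
            then show ?thesis using A high j(1) by auto
          qed
        qed
      qed
    qed
    ultimately show ?thesis by (simp add: bij_betw_def)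
  qed
  have arc: "card (sym_diff (P s) (P t)) = 1 \<longleftrightarrow> (s, t) \<in> parcs (cycle_graph (2 * k))"
    if st: "s < 2 * k" "t < 2 * k" for s t
  proof (cases s t rule: linorder_cases)
    case less
    have "min (t - s) (2 * k - (t - s)) = 1 \<longleftrightarrow> t = Suc s \<or> s = 0 \<and> Suc t = 2 * k"
      using less st by (auto simp: min_def)
    then show ?thesis using dist[of s t] less st cycle_graph_arc_iff(1)[of s t "2 * k"] by simp
  next
    case equal
    then show ?thesis using cycle_graph_no_loop[of "2 * k" t] k by simp
  next
    case greater
    have "min (s - t) (2 * k - (s - t)) = 1 \<longleftrightarrow> s = Suc t \<or> t = 0 \<and> Suc s = 2 * k"
      using greater st by (auto simp: min_def)
    then show ?thesis
      using dist[of t s] greater st cycle_graph_arc_iff(2)[of t s "2 * k"] by (simp add: Un_commute)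
  qed
  let ?Q = "the_inv_into {..<2 * k} P"
  have Q: "bij_betw ?Q (segments L) {..<2 * k}" using bij by (rule bij_betw_the_inv_into)
  have "card (sym_diff A B) = 1 \<longleftrightarrow> (?Q A, ?Q B) \<in> parcs (cycle_graph (2 * k))"
    if A: "A \<in> segments L" and B: "B \<in> segments L" for A B
    using arc[of "?Q A" "?Q B"] bij_betwE[OF Q] A B
      f_the_inv_into_f_bij_betw[OF bij, of A] f_the_inv_into_f_bij_betw[OF bij, of B] by simp
  with Q show ?thesis unfolding k_def[symmetric] by (intro exI[of _ ?Q] conjI ballI)
qed

lemma card_1_partition:
  assumes sub: "D \<subseteq> (\<Union>i<N. B i)"
    and disj: "\<And>i j. i < N \<Longrightarrow> j < N \<Longrightarrow> i \<noteq> j \<Longrightarrow> B i \<inter> B j = {}"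
  shows "card D = 1 \<longleftrightarrow> (\<exists>i<N. card (D \<inter> B i) = 1 \<and> (\<forall>j<N. j \<noteq> i \<longrightarrow> D \<inter> B j = {}))"
proof
  assume "card D = 1"
  then obtain d where d: "D = {d}" by (rule card_1_singletonE)
  then obtain i where i: "i < N" "d \<in> B i" using sub by auto
  have "D \<inter> B j = {}" if "j < N" "j \<noteq> i" for j using d i disj[OF i(1) that(1)] that(2) by auto
  moreover have "D \<inter> B i = {d}" using d i by auto
  ultimately show "\<exists>i<N. card (D \<inter> B i) = 1 \<and> (\<forall>j<N. j \<noteq> i \<longrightarrow> D \<inter> B j = {})"
    using i(1) by (intro exI[of _ i]) simp
next
  assume "\<exists>i<N. card (D \<inter> B i) = 1 \<and> (\<forall>j<N. j \<noteq> i \<longrightarrow> D \<inter> B j = {})"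
  then obtain i where i: "card (D \<inter> B i) = 1" "\<forall>j<N. j \<noteq> i \<longrightarrow> D \<inter> B j = {}" by blast
  have "D \<inter> B i = D"
  proof
    show "D \<subseteq> D \<inter> B i"
    proof
      fix d assume d: "d \<in> D"
      then obtain j where j: "j < N" "d \<in> B j" using sub by blast
      then have "j = i" using i(2) d by blast
      then show "d \<in> D \<inter> B i" using d j by simp
    qed
  qed simp
  then show "card D = 1" using i(1) by simp
qed

text \<open>Two vertices are adjacent iff they differ in one block only, and there in one element. So
  recording the place of each block on its cycle is an isomorphism onto the product.\<close>

lemma product_of_segment_families:
  fixes H :: "'a pair_pre_digraph" and h :: "'a \<Rightarrow> nat set"
  assumes coords: "cube_coords H h"
    and part: "finite \<L>" "\<L> \<noteq> {}" "\<And>L. L \<in> \<L> \<Longrightarrow> finite L \<and> L \<noteq> {}" "pairwise disjnt \<L>"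
    and img: "h ` pverts H = {X. X \<subseteq> \<Union>\<L> \<and> (\<forall>L\<in>\<L>. X \<inter> L \<in> segments L)}"
  shows "product_of_edges_and_even_cycles H"
proof -
  have "\<forall>L\<in>\<L>. \<exists>Q. bij_betw Q (segments L) {..<2 * card L} \<and> (\<forall>A\<in>segments L. \<forall>B\<in>segments L.
      card (sym_diff A B) = 1 \<longleftrightarrow> (Q A, Q B) \<in> parcs (cycle_graph (2 * card L)))"
    using segments_cyclic part(3) by blast
  from bchoice[OF this] obtain Q where Q: "\<forall>L\<in>\<L>. bij_betw (Q L) (segments L) {..<2 * card L} \<and>
      (\<forall>A\<in>segments L. \<forall>B\<in>segments L.
        card (sym_diff A B) = 1 \<longleftrightarrow> (Q L A, Q L B) \<in> parcs (cycle_graph (2 * card L)))"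
    by (elim exE)
  obtain Ls where Ls: "set Ls = \<L>" "distinct Ls" using finite_distinct_list[OF part(1)] by blast
  define N where "N = length Ls"
  define B where "B i = Ls ! i" for i
  define q where "q i = Q (B i)" for i
  have mem: "B i \<in> \<L>" if "i < N" for i using Ls(1) that by (auto simp: B_def N_def)
  have index: "\<exists>i<N. B i = L" if "L \<in> \<L>" for L
    using that Ls(1) unfolding B_def N_def by (metis in_set_conv_nth)
  have union: "\<Union>\<L> = (\<Union>i<N. B i)" using mem index by blast
  have disj: "B i \<inter> B j = {}" if "i < N" "j < N" "i \<noteq> j" for i j
    using part(4) mem[OF that(1)] mem[OF that(2)] that Ls(2)
    by (auto simp: pairwise_def disjnt_def B_def N_def nth_eq_iff_index_eq)
  have q_bij: "bij_betw (q i) (segments (B i)) {..<2 * card (B i)}" if "i < N" for i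
    using bspec[OF Q mem[OF that]] by (simp add: q_def)
  have q_arc: "card (sym_diff A A') = 1 \<longleftrightarrow> (q i A, q i A') \<in> parcs (cycle_graph (2 * card (B i)))"
    if "i < N" "A \<in> segments (B i)" "A' \<in> segments (B i)" for i A A'
    using bspec[OF Q mem[OF that(1)]] that(2,3) by (simp add: q_def)
  define Fs where "Fs = map (\<lambda>L. cycle_graph (2 * card L)) Ls"
  have lenF: "length Fs = N" and nthF: "\<And>i. i < N \<Longrightarrow> Fs ! i = cycle_graph (2 * card (B i))"
    by (simp_all add: Fs_def N_def B_def)
  have "Fs \<noteq> []" using Ls part(2) by (auto simp: Fs_def)
  moreover have "set Fs \<subseteq> {edge_graph} \<union> {cycle_graph (2 * k) | k. k \<ge> 2}"
  proof
    fix F assume "F \<in> set Fs"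
    then obtain L where L: "L \<in> \<L>" "F = cycle_graph (2 * card L)" using Ls by (auto simp: Fs_def)
    then have "card L \<noteq> 0" using part(3) by auto
    then consider "card L = 1" | "card L \<ge> 2" by linarith
    then show "F \<in> {edge_graph} \<union> {cycle_graph (2 * k) | k. k \<ge> 2}"
      using L by cases (auto simp: edge_graph_eq_cycle)
  qed
  moreover have "graph_iso H (cartesian_product Fs)"
  proof -
    define g where "g x = map (\<lambda>i. q i (h x \<inter> B i)) [0..<N]" for x
    have gn: "g x ! i = q i (h x \<inter> B i)" if "i < N" for x i using that by (simp add: g_def)
    have h_seg: "h x \<inter> B i \<in> segments (B i)" if "x \<in> pverts H" "i < N" for x i
      using img mem[OF that(2)] that(1) by blast
    have h_sub: "h x \<subseteq> (\<Union>i<N. B i)" if "x \<in> pverts H" for x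
      using img that unfolding union by blast
    have g_eq: "g x ! i = g y ! i \<longleftrightarrow> h x \<inter> B i = h y \<inter> B i"
      if "x \<in> pverts H" "y \<in> pverts H" "i < N" for x y i
      unfolding gn[OF that(3)]
      by (rule inj_on_eq_iff[OF bij_betw_imp_inj_on[OF q_bij[OF that(3)]]
            h_seg[OF that(1,3)] h_seg[OF that(2,3)]])
    have pV: "xs \<in> pverts (cartesian_product Fs) \<longleftrightarrow> length xs = N \<and> (\<forall>i<N. xs ! i < 2 * card (B i))" for xs
      by (auto simp: cartesian_product_def Let_def lenF nthF cycle_graph_def)
    have gV: "g x \<in> pverts (cartesian_product Fs)" if "x \<in> pverts H" for x
      unfolding pV using bij_betwE[OF q_bij] h_seg[OF that] gn by (simp add: g_def)
    show ?thesis
    proof (rule graph_isoI[of g])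
      show "bij_betw g (pverts H) (pverts (cartesian_product Fs))"
      proof (rule bij_betw_imageI)
        show "inj_on g (pverts H)"
        proof (rule inj_onI)
          fix x y assume xy: "x \<in> pverts H" "y \<in> pverts H" "g x = g y"
          have "h x = (\<Union>i<N. h x \<inter> B i)" using h_sub[OF xy(1)] by auto
          also have "\<dots> = (\<Union>i<N. h y \<inter> B i)" using g_eq[OF xy(1,2)] xy(3) by simp
          also have "\<dots> = h y" using h_sub[OF xy(2)] by auto
          finally have "separators h x y = {}" by (simp add: separators_def)
          then show "x = y" by (rule cube_coords_inj[OF coords xy(1,2)])
        qed
        show "g ` pverts H = pverts (cartesian_product Fs)"
        proof
          show "g ` pverts H \<subseteq> pverts (cartesian_product Fs)" using gV by blast
          show "pverts (cartesian_product Fs) \<subseteq> g ` pverts H"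
          proof
            fix xs assume "xs \<in> pverts (cartesian_product Fs)"
            then have xs: "length xs = N" "\<And>i. i < N \<Longrightarrow> xs ! i < 2 * card (B i)" by (auto simp: pV)
            have "\<exists>A\<in>segments (B i). q i A = xs ! i" if "i < N" for i
              using bij_betw_imp_surj_on[OF q_bij[OF that]] xs(2)[OF that] by (metis imageE lessThan_iff)
            then obtain A where A: "\<And>i. i < N \<Longrightarrow> A i \<in> segments (B i)" "\<And>i. i < N \<Longrightarrow> q i (A i) = xs ! i"
              by metis
            have A_sub: "A i \<subseteq> B i" if "i < N" for i using A(1)[OF that] by (auto simp: segments_def)
            define X where "X = (\<Union>i<N. A i)"
            have XB: "X \<inter> B i = A i" if i: "i < N" for i
            proof
              show "A i \<subseteq> X \<inter> B i" using A_sub[OF i] i by (auto simp: X_def)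
              show "X \<inter> B i \<subseteq> A i"
              proof
                fix p assume p: "p \<in> X \<inter> B i"
                then obtain j where j: "j < N" "p \<in> A j" by (auto simp: X_def)
                then have "j = i" using disj[OF j(1) i] A_sub[OF j(1)] p by blast
                then show "p \<in> A i" using j by simp
              qed
            qed
            have "X \<inter> L \<in> segments L" if L: "L \<in> \<L>" for L
            proof -
              obtain i where i: "i < N" "B i = L" using index[OF L] by blast
              show ?thesis using XB[OF i(1)] A(1)[OF i(1)] i(2) by simp
            qed
            moreover have "X \<subseteq> \<Union>\<L>" using A_sub unfolding X_def union by (intro UN_mono) auto
            ultimately have "X \<in> h ` pverts H" using img by blast
            then obtain x where x: "x \<in> pverts H" "h x = X" by blast
            have "g x = xs"
              by (rule nth_equalityI) (use gn XB A(2) x(2) xs(1) in \<open>simp_all add: g_def\<close>)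
            then show "xs \<in> g ` pverts H" using x(1) by blast
          qed
        qed
      qed
      show "parcs H \<subseteq> pverts H \<times> pverts H" using cube_coords_arc_iff[OF coords] by auto
      show "parcs (cartesian_product Fs) \<subseteq> pverts (cartesian_product Fs) \<times> pverts (cartesian_product Fs)"
        by (auto simp: cartesian_product_def Let_def)
      fix x y assume xy: "x \<in> pverts H" "y \<in> pverts H"
      let ?D = "separators h x y"
      have D: "?D \<inter> B i = sym_diff (h x \<inter> B i) (h y \<inter> B i)" for i by (auto simp: separators_def)
      have "?D \<subseteq> (\<Union>i<N. B i)" using h_sub[OF xy(1)] h_sub[OF xy(2)] by (auto simp: separators_def)
      then have "card ?D = 1 \<longleftrightarrow> (\<exists>i<N. card (?D \<inter> B i) = 1 \<and> (\<forall>j<N. j \<noteq> i \<longrightarrow> ?D \<inter> B j = {}))"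
        using disj by (rule card_1_partition)
      also have "\<dots> \<longleftrightarrow> (\<exists>i<N. (g x ! i, g y ! i) \<in> parcs (Fs ! i) \<and> (\<forall>j<N. j \<noteq> i \<longrightarrow> g x ! j = g y ! j))"
      proof -
        have "card (?D \<inter> B i) = 1 \<longleftrightarrow> (g x ! i, g y ! i) \<in> parcs (Fs ! i)" if i: "i < N" for i
          unfolding D gn[OF i] nthF[OF i] by (rule q_arc[OF i h_seg[OF xy(1) i] h_seg[OF xy(2) i]])
        moreover have "?D \<inter> B j = {} \<longleftrightarrow> g x ! j = g y ! j" if j: "j < N" for j
          unfolding D g_eq[OF xy j] by blast
        ultimately show ?thesis by (metis (no_types, lifting))
      qed
      finally show "(x, y) \<in> parcs H \<longleftrightarrow> (g x, g y) \<in> parcs (cartesian_product Fs)"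
        using gV[OF xy(1)] gV[OF xy(2)] cube_coords_arc_iff[OF coords, of x y] xy
        by (simp add: cartesian_product_def Let_def lenF)
    qed
  qed
  ultimately show ?thesis unfolding product_of_edges_and_even_cycles_def by blast
qed

section \<open>The hull of an isometric cycle\<close>

definition separable :: "'a set \<Rightarrow> 'a set set \<Rightarrow> bool" where
  "separable V HH \<longleftrightarrow> (\<forall>\<alpha>\<subseteq>HH. \<forall>\<beta>\<subseteq>HH. halfspace_system.feasible V \<alpha> \<longrightarrow> halfspace_system.feasible V \<beta>
     \<longrightarrow> \<not> halfspace_system.feasible V (\<alpha> \<union> \<beta>)
     \<longrightarrow> (\<exists>e\<in>HH. \<not> halfspace_system.feasible V (insert (- e) \<alpha>) \<and> \<not> halfspace_system.feasible V (insert e \<beta>)))"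

lemma separableD:
  assumes "separable V HH" "\<alpha> \<subseteq> HH" "\<beta> \<subseteq> HH" "halfspace_system.feasible V \<alpha>"
    "halfspace_system.feasible V \<beta>" "\<not> halfspace_system.feasible V (\<alpha> \<union> \<beta>)"
  shows "\<exists>e\<in>HH. \<not> halfspace_system.feasible V (insert (- e) \<alpha>) \<and> \<not> halfspace_system.feasible V (insert e \<beta>)"
  using assms unfolding separable_def by simp

text \<open>The cycle starts at the vertex whose coordinate set is empty, so that \<open>f x\<close> lists the differences
  between \<open>x\<close> and the start; \<open>e p\<close> is the coordinate flipped at step \<open>p\<close> and again at step \<open>n + p\<close>.\<close>

locale cycle_coords =
  fixes G :: "'a pair_pre_digraph" and f :: "'a \<Rightarrow> 'i set" and c :: "nat \<Rightarrow> 'a"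
    and e :: "nat \<Rightarrow> 'i" and n :: nat
  assumes coords: "cube_coords G f"
    and n2: "2 \<le> n"
    and c_verts: "range c \<subseteq> pverts G"
    and e_inj: "inj_on e {..<n}"
    and prefix: "t \<le> n \<Longrightarrow> f (c t) = e ` {..<t}"
    and suffix: "t \<le> n \<Longrightarrow> f (c (n + t)) = e ` {t..<n}"
begin

definition K where "K = e ` {..<n}"

definition S where "S = coord_box G f K"

lemma finite_K: "finite K" by (simp add: K_def)

lemma S_iff: "x \<in> S \<longleftrightarrow> x \<in> pverts G \<and> f x \<subseteq> K"
  by (simp add: S_def coord_box_def)

lemma S_convex: "geo_convex G S"
  unfolding S_def by (rule geo_convex_coord_box[OF coords])

lemma c_S: "t \<le> n \<Longrightarrow> c t \<in> S" "t \<le> n \<Longrightarrow> c (n + t) \<in> S"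
  using c_verts prefix suffix by (auto simp: S_iff K_def)

lemma prefix_iff: "p < n \<Longrightarrow> t \<le> n \<Longrightarrow> e p \<in> f (c t) \<longleftrightarrow> p < t"
  unfolding prefix using inj_on_image_mem_iff[OF e_inj, of p "{..<t}"] by auto

lemma suffix_iff: "p < n \<Longrightarrow> t \<le> n \<Longrightarrow> e p \<in> f (c (n + t)) \<longleftrightarrow> t \<le> p"
  unfolding suffix by (auto dest: inj_onD[OF e_inj])

lemma f_c0: "f (c 0) = {}" using prefix[of 0] by simp

lemma separators_c0: "separators f (c 0) x = f x"
  by (auto simp: separators_def f_c0)

lemma finite_coords: "x \<in> pverts G \<Longrightarrow> finite (f x)"
  using cube_coordsD(2)[OF coords, of "c 0" x] c_verts separators_c0 by auto

text \<open>The set \<open>S\<close> is already the interval between the two opposite vertices \<open>c 0\<close> and \<open>c n\<close>.\<close>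

lemma hull_cycle: "conv G (c ` {..<2 * n}) = S"
proof (rule hull_unique)
  show "c ` {..<2 * n} \<subseteq> S"
  proof
    fix x assume "x \<in> c ` {..<2 * n}"
    then obtain t where t: "t < 2 * n" "x = c t" by auto
    show "x \<in> S"
    proof (cases "t \<le> n")
      case False
      then have "n + (t - n) = t" "t - n \<le> n" using t by auto
      then show ?thesis using c_S(2)[of "t - n"] t by simp
    qed (use c_S(1) t in simp)
  qed
  show "geo_convex G S" by (rule S_convex)
  fix T assume T: "c ` {..<2 * n} \<subseteq> T" "geo_convex G T"
  show "S \<subseteq> T"
  proof
    fix x assume x: "x \<in> S"
    have "c 0 \<in> T" "c n \<in> T" using T(1) n2 by auto
    moreover have "x \<in> interval G (c 0) (c n)"
      using interval_iff_separators[OF coords, of "c 0" "c n" x] x c_verts prefix[of n]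
      by (auto simp: separators_c0 S_iff K_def)
    ultimately show "x \<in> T" using geo_convexD[OF T(2)] by blast
  qed
qed

lemma quadrants:
  assumes "p < n" "q < n" "p \<noteq> q"
  shows "\<exists>x\<in>S. (e p \<in> f x) = s \<and> (e q \<in> f x) = t"
proof -
  have *: "\<exists>x\<in>S. (e p \<in> f x) = s \<and> (e q \<in> f x) = t" if pq: "p < q" "q < n" for p q s t
  proof -
    have m: "c 0 \<in> S" "c n \<in> S" "c (Suc p) \<in> S" "c (n + Suc p) \<in> S" using c_S(1)[of 0] c_S(1)[of n] c_S(1)[of "Suc p"] c_S(2)[of "Suc p"] pq by simp_all
    have v: "e p \<notin> f (c 0)" "e q \<notin> f (c 0)" "e p \<in> f (c n)" "e q \<in> f (c n)"
      "e p \<in> f (c (Suc p))" "e q \<notin> f (c (Suc p))" "e p \<notin> f (c (n + Suc p))" "e q \<in> f (c (n + Suc p))"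
      using prefix_iff[of p 0] prefix_iff[of q 0] prefix_iff[of p n] prefix_iff[of q n]
        prefix_iff[of p "Suc p"] prefix_iff[of q "Suc p"] suffix_iff[of p "Suc p"]
        suffix_iff[of q "Suc p"] pq by auto
    show ?thesis using m v by (cases s; cases t) blast+
  qed
  show ?thesis
  proof (cases "p < q")
    case False
    then have "q < p" using assms by simp
    then show ?thesis using *[of q p t s] assms by blast
  qed (use * assms in blast)
qed

lemma one_coord:
  assumes "p < n"
  shows "\<exists>x\<in>S. (e p \<in> f x) = s"
proof -
  obtain q where "q < n" "q \<noteq> p"
  proof (cases "p = 0")
    case True then show ?thesis using that[of 1] n2 by simp
  next
    case False then show ?thesis using that[of 0] n2 by simp
  qed
  then show ?thesis using quadrants[OF assms, of q s True] by blast
qed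

text \<open>All vertices involved lie in the box given by the coordinates of the cycle and of \<open>x\<close>, a finite
  set \<open>J\<close>, so that finitely many halfspaces suffice.\<close>

lemma gated_hull:
  assumes sep: "\<And>J. finite J \<Longrightarrow> separable (coord_box G f J) (coord_halfspaces f J)"
  shows "gated G S"
  unfolding gated_def
proof (intro conjI ballI)
  show "S \<subseteq> pverts G" by (auto simp: S_iff)
  fix x assume x: "x \<in> pverts G"
  define J where "J = K \<union> f x"
  have J: "finite J" using finite_K finite_coords[OF x] by (simp add: J_def)
  let ?V = "coord_box G f J" and ?H = "coord_halfspaces f J"
  interpret halfspace_system ?V ?H
    by (rule halfspace_system_coords[OF coords geo_convex_coord_box[OF coords]])
  have xV: "x \<in> ?V" using x by (simp add: coord_box_def J_def)
  have SV: "S \<subseteq> ?V" by (auto simp: S_iff coord_box_def J_def)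
  obtain x' where x': "x' \<in> S" "\<And>y. y \<in> S \<Longrightarrow> card (separators f x x') \<le> card (separators f x y)"
    using ex_has_least_nat[of "\<lambda>y. y \<in> S" "c 0" "\<lambda>y. card (separators f x y)"] c_S(1)[of 0] by auto
  have x'V: "x' \<in> ?V" using x' SV by blast
  have agree: "i \<in> f x \<longleftrightarrow> i \<in> f x'" if iK: "i \<in> K" for i
  proof (rule ccontr)
    assume dis: "\<not> (i \<in> f x \<longleftrightarrow> i \<in> f x')"
    obtain p where p: "p < n" "i = e p" using iK by (auto simp: K_def)
    \<comment> \<open>The halfspaces containing the interval between \<open>x\<close> and \<open>x'\<close>.\<close>
    define \<alpha> where "\<alpha> = {h \<in> ?H. x \<in> h \<and> x' \<in> h}"
    define d where "d = {y. (i \<in> f y) = (i \<notin> f x')}"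
    \<comment> \<open>The part of the hull in which coordinate \<open>i\<close> is flipped against \<open>x'\<close>.\<close>
    define \<beta> where "\<beta> = insert d ((\<lambda>j. {y. j \<notin> f y}) ` (J - K))"
    have dH: "d \<in> ?H"
      using iK by (cases "i \<in> f x'") (auto simp: d_def coord_halfspaces_def J_def)
    have \<beta>H: "\<beta> \<subseteq> ?H" using dH by (auto simp: \<beta>_def coord_halfspaces_def)
    have \<beta>I: "\<forall>h\<in>\<beta>. y \<in> h" if "y \<in> S" "(i \<in> f y) = (i \<notin> f x')" for y
      using that by (auto simp: \<beta>_def d_def S_iff)
    have f\<alpha>: "feasible \<alpha>" by (rule feasibleI[OF xV]) (simp add: \<alpha>_def)
    obtain y0 where y0: "y0 \<in> S" "(i \<in> f y0) = (i \<notin> f x')" using one_coord[OF p(1)] p(2) by blast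
    have f\<beta>: "feasible \<beta>"
      by (rule feasibleI[of y0]) (use bspec[OF \<beta>I[OF y0]] y0(1) SV in auto)
    have "\<not> feasible (\<alpha> \<union> \<beta>)"
    proof
      assume "feasible (\<alpha> \<union> \<beta>)"
      then obtain y where y: "y \<in> ?V" "\<forall>h\<in>\<alpha> \<union> \<beta>. y \<in> h" unfolding feasible_def by (elim bexE)
      have yK: "j \<in> K" if "j \<in> f y" for j
      proof (rule ccontr)
        assume "j \<notin> K"
        moreover have "j \<in> J" using y(1) that by (auto simp: coord_box_def)
        ultimately have "{y. j \<notin> f y} \<in> \<alpha> \<union> \<beta>" by (simp add: \<beta>_def)
        from bspec[OF y(2) this] show False using that by simp
      qed
      then have yS: "y \<in> S" using y(1) by (auto simp: S_iff coord_box_def)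
      have "d \<in> \<alpha> \<union> \<beta>" by (simp add: \<beta>_def)
      from bspec[OF y(2) this] have yd: "(i \<in> f y) = (i \<notin> f x')" by (simp add: d_def)
      have same: "(j \<in> f y) = (j \<in> f x)" if "(j \<in> f x) = (j \<in> f x')" for j
      proof (cases "j \<in> J")
        case True
        have "{z. (j \<in> f z) = (j \<in> f x)} \<in> ?H"
          using True by (cases "j \<in> f x") (auto simp: coord_halfspaces_def)
        then have "{z. (j \<in> f z) = (j \<in> f x)} \<in> \<alpha> \<union> \<beta>" using that by (simp add: \<alpha>_def)
        from bspec[OF y(2) this] show ?thesis by simp
      next
        case False
        then show ?thesis using yK by (auto simp: J_def)
      qed
      \<comment> \<open>A vertex of the hull in this interval with \<open>i\<close> flipped would be nearer to \<open>x\<close>.\<close>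
      have "separators f x y \<subseteq> separators f x x' - {i}"
      proof
        fix j assume j: "j \<in> separators f x y"
        have "(j \<in> f x) \<noteq> (j \<in> f x')" using j same[of j] by (auto simp: separators_iff)
        moreover have "j \<noteq> i" using j yd dis by (auto simp: separators_iff)
        ultimately show "j \<in> separators f x x' - {i}" by (auto simp: separators_iff)
      qed
      moreover have fin: "finite (separators f x x')"
        using cube_coordsD(2)[OF coords x] x' by (simp add: S_iff)
      moreover have "i \<in> separators f x x'" using dis by (simp add: separators_iff)
      ultimately have "card (separators f x y) < card (separators f x x')"
        by (meson card_Diff1_less card_mono finite_Diff le_less_trans)
      then show False using x'(2)[OF yS] by simp
    qed
    moreover have "\<alpha> \<subseteq> ?H" by (auto simp: \<alpha>_def)
    ultimately have "\<exists>h\<in>?H. \<not> feasible (insert (- h) \<alpha>) \<and> \<not> feasible (insert h \<beta>)"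
      by (intro separableD[OF sep[OF J] _ \<beta>H f\<alpha> f\<beta>])
    then obtain h where h: "h \<in> ?H" "\<not> feasible (insert (- h) \<alpha>)" "\<not> feasible (insert h \<beta>)"
      by (elim bexE conjE)
    have xh: "x \<in> h"
    proof (rule ccontr)
      assume "x \<notin> h"
      then have "feasible (insert (- h) \<alpha>)" by (intro feasibleI[OF xV]) (auto simp: \<alpha>_def)
      then show False using h(2) by simp
    qed
    have x'h: "x' \<in> h"
    proof (rule ccontr)
      assume "x' \<notin> h"
      then have "feasible (insert (- h) \<alpha>)" by (intro feasibleI[OF x'V]) (auto simp: \<alpha>_def)
      then show False using h(2) by simp
    qed
    have bad: "y \<notin> h" if "y \<in> S" "(i \<in> f y) = (i \<notin> f x')" for y
    proof
      assume "y \<in> h"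
      then have "\<forall>k\<in>insert h \<beta>. y \<in> k" using \<beta>I[OF that] by simp
      moreover have "y \<in> ?V" using that(1) SV by (rule rev_subsetD)
      ultimately have "feasible (insert h \<beta>)" unfolding feasible_def by (rule bexI)
      then show False using h(3) by simp
    qed
    obtain j s where j: "j \<in> J" "\<forall>y. y \<in> h \<longleftrightarrow> (j \<in> f y) = s" using coord_halfspacesE[OF h(1)] .
    show False
    proof (cases "j \<in> K")
      case True
      then obtain q where q: "q < n" "j = e q" by (auto simp: K_def)
      have "j \<noteq> i" using xh x'h j(2) dis by auto
      then have "p \<noteq> q" using p q by auto
      then obtain y where "y \<in> S" "(e p \<in> f y) = (i \<notin> f x')" "(e q \<in> f y) = s"
        using quadrants[OF p(1) q(1)] by blast
      then show False using bad[of y] p q j(2) by simp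
    next
      case False
      have "j \<notin> f x'" "j \<notin> f y0" using False x'(1) y0(1) by (auto simp: S_iff)
      then show False using bad[OF y0] x'h j(2) by simp
    qed
  qed
  show "\<exists>x'\<in>S. \<forall>y\<in>S. x' \<in> interval G x y"
  proof (intro bexI[OF _ x'(1)] ballI)
    fix y assume y: "y \<in> S"
    have yG: "y \<in> pverts G" "x' \<in> pverts G" using y x' by (auto simp: S_iff)
    have "separators f x x' \<subseteq> separators f x y"
    proof
      fix j assume j: "j \<in> separators f x x'"
      then have "j \<notin> K" using agree by (auto simp: separators_iff)
      then have "j \<notin> f x'" "j \<notin> f y" using x'(1) y by (auto simp: S_iff)
      then show "j \<in> separators f x y" using j by (simp add: separators_iff)
    qed
    then show "x' \<in> interval G x y" using interval_iff_separators[OF coords x yG(1)] yG by blast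
  qed
qed

sublocale halfspace_system S "coord_halfspaces f K"
  by (rule halfspace_system_coords[OF coords S_convex])

lemma S_ne: "S \<noteq> {}" using c_S(1)[of 0] by auto

lemma pairs_feasible:
  assumes "a \<in> coord_halfspaces f K" "b \<in> coord_halfspaces f K" "a \<noteq> - b"
  shows "feasible {a, b}"
proof -
  obtain i s where i: "i \<in> K" "\<forall>x. x \<in> a \<longleftrightarrow> (i \<in> f x) = s" using coord_halfspacesE[OF assms(1)] .
  obtain j t where j: "j \<in> K" "\<forall>x. x \<in> b \<longleftrightarrow> (j \<in> f x) = t" using coord_halfspacesE[OF assms(2)] .
  obtain p where p: "p < n" "i = e p" using i by (auto simp: K_def)
  obtain q where q: "q < n" "j = e q" using j by (auto simp: K_def)
  have "\<exists>x\<in>S. (i \<in> f x) = s \<and> (j \<in> f x) = t"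
  proof (cases "p = q")
    case False
    then show ?thesis using quadrants[OF p(1) q(1)] p q by blast
  next
    case True
    have "s = t"
    proof (rule ccontr)
      assume "s \<noteq> t"
      then have "a = - b" using i(2) j(2) p q True by auto
      then show False using assms by blast
    qed
    then show ?thesis using one_coord[OF p(1), of s] p q True by auto
  qed
  then show ?thesis using i(2) j(2) by (auto simp: feasible_def)
qed

text \<open>If the pattern opposite to \<open>x\<close> were not realized, neither would be, by \<open>infeasible_uminus\<close>, the
  pattern of \<open>x\<close> itself.\<close>

lemma antipode_if_no_seven:
  assumes "no_seven_octants S (coord_halfspaces f K)" and x: "x \<in> S"
  shows "\<exists>y\<in>S. f y = K - f x"
proof -
  interpret no_seven_octants S "coord_halfspaces f K" by (rule assms)
  define \<sigma> where "\<sigma> = {h \<in> coord_halfspaces f K. x \<notin> h}"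
  have "feasible (uminus ` \<sigma>)" by (rule feasibleI[OF x]) (auto simp: \<sigma>_def)
  moreover have "finite \<sigma>" using finite_K by (simp add: \<sigma>_def coord_halfspaces_def)
  moreover have "feasible {a, b}" if "a \<in> \<sigma>" "b \<in> \<sigma>" for a b
    using that by (intro pairs_feasible) (auto simp: \<sigma>_def)
  ultimately have "feasible \<sigma>"
    using infeasible_uminus[of \<sigma>] S_ne by (auto simp: \<sigma>_def)
  then obtain y where y: "y \<in> S" "\<forall>h\<in>\<sigma>. y \<in> h" unfolding feasible_def by (elim bexE)
  have "i \<in> f y \<longleftrightarrow> i \<notin> f x" if "i \<in> K" for i
  proof -
    have "{z. (i \<in> f z) = (i \<notin> f x)} \<in> coord_halfspaces f K"
      using that by (cases "i \<in> f x") (auto simp: coord_halfspaces_def)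
    then have "{z. (i \<in> f z) = (i \<notin> f x)} \<in> \<sigma>" by (simp add: \<sigma>_def)
    from bspec[OF y(2) this] show ?thesis by simp
  qed
  moreover have "f y \<subseteq> K" using y(1) by (simp add: S_iff)
  ultimately have "f y = K - f x" by blast
  then show ?thesis using y(1) by blast
qed

text \<open>If a coordinate of the cycle agreed on \<open>x\<close> and \<open>y\<close>, it would be constant on their hull, but no
  coordinate of the cycle is constant on it.\<close>

lemma antipode_if_antipodal:
  assumes "antipodal G S" and x: "x \<in> S"
  shows "\<exists>y\<in>S. f y = K - f x"
proof -
  obtain y where y: "y \<in> S" "S = conv G {x, y}" using assms unfolding antipodal_def by blast
  have "i \<in> f y \<longleftrightarrow> i \<notin> f x" if i: "i \<in> K" for i
  proof (rule ccontr)
    assume same: "\<not> (i \<in> f y \<longleftrightarrow> i \<notin> f x)"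
    let ?T = "{z \<in> S. \<forall>h\<in>{{z. (i \<in> f z) = (i \<in> f x)}}. z \<in> h}"
    have "{{z. (i \<in> f z) = (i \<in> f x)}} \<subseteq> coord_halfspaces f K"
      using i by (cases "i \<in> f x") (auto simp: coord_halfspaces_def)
    then have "geo_convex G ?T" by (rule geo_convex_Int_halfspaces[OF coords S_convex])
    moreover have "{x, y} \<subseteq> ?T" using x y(1) same by auto
    ultimately have "conv G {x, y} \<subseteq> ?T" by (intro hull_minimal)
    then have ST: "S \<subseteq> ?T" using y(2) by simp
    obtain p where p: "p < n" "i = e p" using i by (auto simp: K_def)
    then obtain z where "z \<in> S" "(i \<in> f z) = (i \<notin> f x)" using one_coord[OF p(1)] by blast
    then show False using ST by auto
  qed
  moreover have "f y \<subseteq> K" using y(1) by (simp add: S_iff)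
  ultimately have "f y = K - f x" by blast
  then show ?thesis using y(1) by blast
qed

end

locale antipodal_cycle_coords = cycle_coords +
  assumes antipodes: "x \<in> S \<Longrightarrow> \<exists>y\<in>S. f y = K - f x"
    and separable_S: "separable S (coord_halfspaces f K)"
begin

sublocale antipodal_system S "coord_halfspaces f K"
proof
  show "finite (coord_halfspaces f K)" using finite_K by (simp add: coord_halfspaces_def)
  show "\<exists>y\<in>S. \<forall>h\<in>coord_halfspaces f K. (y \<in> h) = (x \<notin> h)" if x: "x \<in> S" for x
  proof -
    obtain y where y: "y \<in> S" "f y = K - f x" using antipodes[OF x] by blast
    have "(y \<in> h) = (x \<notin> h)" if h: "h \<in> coord_halfspaces f K" for h
    proof -
      obtain i s where i: "i \<in> K" "\<forall>x. x \<in> h \<longleftrightarrow> (i \<in> f x) = s" using coord_halfspacesE[OF h] .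
      then show ?thesis using y(2) by auto
    qed
    then show ?thesis using y(1) by blast
  qed
  show "feasible {a, b}" if "a \<in> coord_halfspaces f K" "b \<in> coord_halfspaces f K" "a \<noteq> - b" for a b
    by (rule pairs_feasible[OF that])
  show "\<exists>e\<in>coord_halfspaces f K. \<not> feasible (insert (- e) \<alpha>) \<and> \<not> feasible (insert e \<beta>)"
    if "\<alpha> \<subseteq> coord_halfspaces f K" "\<beta> \<subseteq> coord_halfspaces f K" "feasible \<alpha>" "feasible \<beta>" "\<not> feasible (\<alpha> \<union> \<beta>)" for \<alpha> \<beta>
    by (rule separableD[OF separable_S that])
qed

definition hs :: "nat \<Rightarrow> 'a set" where "hs p = {x. e p \<in> f x}"

lemma hs_mem [simp]: "p < n \<Longrightarrow> hs p \<in> coord_halfspaces f K" "p < n \<Longrightarrow> - hs p \<in> coord_halfspaces f K"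
proof -
  show "p < n \<Longrightarrow> hs p \<in> coord_halfspaces f K" by (auto simp: hs_def coord_halfspaces_def K_def)
  then show "p < n \<Longrightarrow> - hs p \<in> coord_halfspaces f K" by (rule compl)
qed

lemma hs_neq:
  assumes "p < n" "q < n" "p \<noteq> q"
  shows "hs p \<noteq> hs q" "hs p \<noteq> - hs q"
  using quadrants[OF assms, of True False] quadrants[OF assms, of True True] by (auto simp: hs_def)

text \<open>The only octants of a dependent triple that the cycle does not meet are the two in which
  the middle coordinate differs from both others.\<close>

lemma dependent_between:
  assumes pqr: "p < q" "q < r" "r < n" and dep: "dependent (hs p) (hs q) (hs r)" and x: "x \<in> S"
  shows "\<not> (e q \<in> f x \<and> e p \<notin> f x \<and> e r \<notin> f x)" and "\<not> (e q \<notin> f x \<and> e p \<in> f x \<and> e r \<in> f x)"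
proof -
  have H: "hs p \<in> coord_halfspaces f K" "hs q \<in> coord_halfspaces f K" "hs r \<in> coord_halfspaces f K"
    using pqr by auto
  have oct: "feasible {if s then hs p else - hs p, if t then hs q else - hs q, if u then hs r else - hs r}"
    if "y \<in> S" "(e p \<in> f y) = s" "(e q \<in> f y) = t" "(e r \<in> f y) = u" for y s t u
    using that by (intro feasibleI[of y]) (auto simp: hs_def)
  have pre: "(e p \<in> f (c t)) = (p < t)" "(e q \<in> f (c t)) = (q < t)" "(e r \<in> f (c t)) = (r < t)" if "t \<le> n" for t
    using prefix_iff that pqr by auto
  have suf: "(e p \<in> f (c (n + t))) = (t \<le> p)" "(e q \<in> f (c (n + t))) = (t \<le> q)"
    "(e r \<in> f (c (n + t))) = (t \<le> r)" if "t \<le> n" for t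
    using suffix_iff that pqr by auto
  have six: "feasible {- hs p, - hs q, - hs r}" "feasible {hs p, - hs q, - hs r}"
    "feasible {hs p, hs q, - hs r}" "feasible {hs p, hs q, hs r}"
    "feasible {- hs p, hs q, hs r}" "feasible {- hs p, - hs q, hs r}"
    using oct[OF c_S(1)[of 0], of False False False] oct[OF c_S(1)[of "Suc p"], of True False False]
      oct[OF c_S(1)[of "Suc q"], of True True False] oct[OF c_S(1)[of n], of True True True]
      oct[OF c_S(2)[of "Suc p"], of False True True] oct[OF c_S(2)[of "Suc q"], of False False True]
      pre[of 0] pre[of "Suc p"] pre[of "Suc q"] pre[of n] suf[of "Suc p"] suf[of "Suc q"] pqr by auto
  obtain b' c' where b'c': "b' \<in> {hs q, - hs q}" "c' \<in> {hs r, - hs r}" "\<not> feasible {hs p, b', c'}"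
    using dependentE[OF dep H] .
  then have inf: "\<not> feasible {hs p, - hs q, hs r}" using six by auto
  then have inf': "\<not> feasible {- hs p, hs q, - hs r}"
    using feasible3_antipode[of "hs p" "- hs q" "hs r"] H compl by auto
  show "\<not> (e q \<in> f x \<and> e p \<notin> f x \<and> e r \<notin> f x)" "\<not> (e q \<notin> f x \<and> e p \<in> f x \<and> e r \<in> f x)"
    using inf inf' x by (auto simp: feasible3 hs_def)
qed

text \<open>Its classes are the planes into which the coordinates fall; \<open>coplanar_dependent\<close> makes it transitive.\<close>

definition coplanar :: "(nat \<times> nat) set" where
  "coplanar = {(p, q). p < n \<and> q < n \<and>
     (p = q \<or> (\<exists>r<n. r \<noteq> p \<and> r \<noteq> q \<and> dependent (hs p) (hs q) (hs r)))}"

lemma coplanar_dependent: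
  assumes "(p, q) \<in> coplanar" "(q, s) \<in> coplanar" "p \<noteq> q" "q \<noteq> s"
  shows "dependent (hs q) (hs p) (hs s)"
proof -
  obtain r where r: "r < n" "r \<noteq> p" "r \<noteq> q" "dependent (hs p) (hs q) (hs r)"
    using assms by (auto simp: coplanar_def)
  obtain r' where r': "r' < n" "r' \<noteq> q" "r' \<noteq> s" "dependent (hs q) (hs s) (hs r')"
    using assms by (auto simp: coplanar_def)
  have pqs: "p < n" "q < n" "s < n" using assms by (auto simp: coplanar_def)
  have 1: "dependent (hs q) (hs p) (hs r)" using r(4) dependent_commute(1) by blast
  have 2: "hs r \<notin> {hs q, - hs q, hs p, - hs p}"
    using hs_neq[OF r(1) pqs(2) r(3)] hs_neq[OF r(1) pqs(1) r(2)] by blast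
  have 3: "hs r' \<notin> {hs q, - hs q, hs s, - hs s}"
    using hs_neq[OF r'(1) pqs(2) r'(2)] hs_neq[OF r'(1) pqs(3) r'(3)] by blast
  show ?thesis
    by (rule dependent_merge[OF hs_mem(1)[OF pqs(2)] hs_mem(1)[OF pqs(1)] hs_mem(1)[OF r(1)]
          hs_mem(1)[OF pqs(3)] hs_mem(1)[OF r'(1)] 1 2 r'(4) 3])
qed

lemma equiv_coplanar: "equiv {..<n} coplanar"
proof (rule equivI)
  show "coplanar \<subseteq> {..<n} \<times> {..<n}" by (auto simp: coplanar_def)
  show "refl_on {..<n} coplanar" by (auto simp: refl_on_def coplanar_def)
  show "sym coplanar" unfolding sym_def coplanar_def using dependent_commute(1) by blast
  show "trans coplanar"
  proof (rule transI)
    fix p q s assume pq: "(p, q) \<in> coplanar" and qs: "(q, s) \<in> coplanar"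
    show "(p, s) \<in> coplanar"
    proof (cases "p = q \<or> q = s \<or> p = s")
      case True
      then show ?thesis using pq qs by (auto simp: coplanar_def)
    next
      case False
      then have "dependent (hs q) (hs p) (hs s)" using coplanar_dependent[OF pq qs] by blast
      then have "dependent (hs p) (hs s) (hs q)" using dependent_commute by blast
      then show ?thesis using False pq qs unfolding coplanar_def by blast
    qed
  qed
qed

definition pos :: "'a \<Rightarrow> nat set" where "pos x = {p. p < n \<and> e p \<in> f x}"

text \<open>By \<open>dependent_between\<close> no position of the plane differs from both of two positions around it.
  Whether the first position is switched on decides between an initial and a final segment.\<close>

lemma pos_segment:
  assumes x: "x \<in> S" and L: "L \<in> {..<n} // coplanar"
  shows "pos x \<inter> L \<in> segments L"
proof -
  have Ln: "L \<subseteq> {..<n}" and Lne: "L \<noteq> {}"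
    using in_quotient_imp_subset[OF equiv_coplanar L] in_quotient_imp_non_empty[OF equiv_coplanar L] by auto
  have finL: "finite L" using Ln finite_subset by blast
  have rel: "(p, q) \<in> coplanar" if "p \<in> L" "q \<in> L" for p q
    using quotient_eq_iff[OF equiv_coplanar L L that] by simp
  have btw: "\<not> (e q \<in> f x \<and> e p \<notin> f x \<and> e r \<notin> f x)" "\<not> (e q \<notin> f x \<and> e p \<in> f x \<and> e r \<in> f x)"
    if "p \<in> L" "q \<in> L" "r \<in> L" "p < q" "q < r" for p q r
  proof -
    have "dependent (hs q) (hs p) (hs r)"
      using coplanar_dependent[OF rel[OF that(1,2)] rel[OF that(2,3)]] that by simp
    then have "dependent (hs p) (hs q) (hs r)" using dependent_commute(1) by blast
    moreover have "r < n" using that Ln by blast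
    ultimately show "\<not> (e q \<in> f x \<and> e p \<notin> f x \<and> e r \<notin> f x)" "\<not> (e q \<notin> f x \<and> e p \<in> f x \<and> e r \<in> f x)"
      using dependent_between[OF that(4,5) _ _ x] by blast+
  qed
  let ?X = "pos x \<inter> L"
  have X: "?X = {p \<in> L. e p \<in> f x}" using Ln by (auto simp: pos_def)
  define m where "m = Min L"
  have m: "m \<in> L" "\<And>p. p \<in> L \<Longrightarrow> m \<le> p" using finL Lne by (auto simp: m_def)
  show ?thesis
  proof (cases "e m \<in> f x")
    case True
    show ?thesis
    proof (cases "L \<subseteq> ?X")
      case True
      then have "?X = {p \<in> L. p < n}" using Ln by auto
      then show ?thesis unfolding segments_def by blast
    next
      case False
      define t where "t = Min (L - ?X)"
      have t: "t \<in> L - ?X" "\<And>p. p \<in> L - ?X \<Longrightarrow> t \<le> p"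
        using finL False Min_in[of "L - ?X"] by (auto simp: t_def)
      have mt: "m < t" using m(2)[of t] t(1) True X m(1) by (cases "m = t") auto
      have "?X = {p \<in> L. p < t}"
      proof
        show "?X \<subseteq> {p \<in> L. p < t}"
        proof
          fix p assume p: "p \<in> ?X"
          have "\<not> t < p" using btw(2)[of m t p] m(1) mt t(1) p True X by blast
          moreover have "p \<noteq> t" using p t(1) by blast
          ultimately show "p \<in> {p \<in> L. p < t}" using p by auto
        qed
        show "{p \<in> L. p < t} \<subseteq> ?X" using t(2) by (auto simp: not_less[symmetric])
      qed
      then show ?thesis unfolding segments_def by blast
    qed
  next
    case False
    show ?thesis
    proof (cases "?X = {}")
      case True
      then have "?X = {p \<in> L. p < 0}" by simp
      then show ?thesis unfolding segments_def by blast
    next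
      case ne: False
      define t where "t = Min ?X"
      have t: "t \<in> ?X" "\<And>p. p \<in> ?X \<Longrightarrow> t \<le> p"
        using finL ne Min_in[of ?X] by (auto simp: t_def)
      have mt: "m < t" using m(2)[of t] t(1) False X m(1) by (cases "m = t") auto
      have "?X = {p \<in> L. t \<le> p}"
      proof
        show "{p \<in> L. t \<le> p} \<subseteq> ?X"
        proof
          fix p assume p: "p \<in> {p \<in> L. t \<le> p}"
          show "p \<in> ?X"
          proof (rule ccontr)
            assume np: "p \<notin> ?X"
            then have "t < p" using p t(1) by (cases "t = p") auto
            then show False using btw(1)[of m t p] m(1) mt t(1) p np False X by blast
          qed
        qed
        show "?X \<subseteq> {p \<in> L. t \<le> p}" using t(2) by blast
      qed
      then show ?thesis unfolding segments_def by blast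
    qed
  qed
qed

text \<open>By Helly it suffices to realize any three signs. Three independent coordinates admit all
  signs. Dependent ones lie in one plane, where the cycle itself shows each segment.\<close>

lemma segments_realized:
  assumes X: "X \<subseteq> {..<n}" and seg: "\<And>L. L \<in> {..<n} // coplanar \<Longrightarrow> X \<inter> L \<in> segments L"
  shows "\<exists>x\<in>S. pos x = X"
proof -
  define lit where "lit p = (if p \<in> X then hs p else - hs p)" for p
  have lit_cases: "lit p \<in> {hs p, - hs p}" for p by (simp add: lit_def)
  have lit_mem: "lit p \<in> coord_halfspaces f K" if "p < n" for p using that by (simp add: lit_def)
  have lit_iff: "x \<in> lit p \<longleftrightarrow> (e p \<in> f x \<longleftrightarrow> p \<in> X)" for x p by (auto simp: lit_def hs_def)
  have two: "feasible {lit p, lit q}" if "p < n" "q < n" for p q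
  proof (rule pairs_feasible[OF lit_mem[OF that(1)] lit_mem[OF that(2)]])
    show "lit p \<noteq> - lit q"
    proof (cases "p = q")
      case True
      then show ?thesis by auto
    next
      case False
      then show ?thesis using hs_neq[OF that False] by (auto simp: lit_def)
    qed
  qed
  have plane: "\<exists>y\<in>S. \<forall>p\<in>L. y \<in> lit p" if L: "L \<in> {..<n} // coplanar" for L
  proof -
    have Ln: "p < n" if "p \<in> L" for p using in_quotient_imp_subset[OF equiv_coplanar L] that by auto
    obtain t where t: "X \<inter> L = {p \<in> L. p < t} \<or> X \<inter> L = {p \<in> L. t \<le> p}"
      using seg[OF L] by (auto simp: segments_def)
    then show ?thesis
    proof
      assume t: "X \<inter> L = {p \<in> L. p < t}"
      have "c (min t n) \<in> lit p" if "p \<in> L" for p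
        using prefix_iff[OF Ln[OF that], of "min t n"] Ln[OF that] that
          t[unfolded set_eq_iff, THEN spec[of _ p]] by (simp add: lit_iff min_le_iff_disj)
      then show ?thesis using c_S(1)[of "min t n"] by (intro bexI[of _ "c (min t n)"] ballI) simp_all
    next
      assume t: "X \<inter> L = {p \<in> L. t \<le> p}"
      have "c (n + min t n) \<in> lit p" if "p \<in> L" for p
        using suffix_iff[OF Ln[OF that], of "min t n"] Ln[OF that] that
          t[unfolded set_eq_iff, THEN spec[of _ p]] by (simp add: lit_iff min_le_iff_disj)
      then show ?thesis
        using c_S(2)[of "min t n"] by (intro bexI[of _ "c (n + min t n)"] ballI) simp_all
    qed
  qed
  have three: "feasible {lit p, lit q, lit r}" if pqr: "p < n" "q < n" "r < n" for p q r
  proof (cases "p = q \<or> p = r \<or> q = r")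
    case True
    then have "{lit p, lit q, lit r} = {lit p, lit r} \<or> {lit p, lit q, lit r} = {lit p, lit q}"
      by (elim disjE) (simp_all add: insert_commute)
    then show ?thesis using two[OF pqr(1,2)] two[OF pqr(1,3)] by (elim disjE) simp_all
  next
    case False
    show ?thesis
    proof (cases "dependent (hs p) (hs q) (hs r)")
      case True
      then have qp: "(q, p) \<in> coplanar" and qr: "(q, r) \<in> coplanar"
        using False pqr dependent_commute unfolding coplanar_def by blast+
      have L: "coplanar `` {q} \<in> {..<n} // coplanar" using pqr by (simp add: quotientI)
      have "{p, q, r} \<subseteq> coplanar `` {q}" using qp qr pqr by (auto simp: coplanar_def)
      moreover obtain y where "y \<in> S" "\<forall>p\<in>coplanar `` {q}. y \<in> lit p" using plane[OF L] by (elim bexE)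
      ultimately show ?thesis by (intro feasibleI[of y]) auto
    next
      case indep: False
      show ?thesis
      proof (rule ccontr)
        assume "\<not> feasible {lit p, lit q, lit r}"
        then have "dependent (hs p) (hs q) (hs r)" by (rule dependentI) (rule lit_cases)+
        then show False using indep by blast
      qed
    qed
  qed
  have "feasible (lit ` {..<n})"
  proof (rule helly)
    show "lit ` {..<n} \<subseteq> coord_halfspaces f K" using lit_mem by auto
    show "S \<noteq> {}" by (rule S_ne)
    fix a b d assume "a \<in> lit ` {..<n}" "b \<in> lit ` {..<n}" "d \<in> lit ` {..<n}"
    then show "feasible {a, b, d}" using three by auto
  qed
  then obtain x where x: "x \<in> S" "\<forall>p<n. x \<in> lit p" by (auto simp: feasible_def)
  then have "pos x = X" using X by (auto simp: pos_def lit_iff)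
  then show ?thesis using x by blast
qed

lemma pos_coords: "cube_coords (induced G S) pos"
proof -
  have C: "cube_coords (induced G S) f" by (rule cube_coords_induced[OF coords S_convex S_ne])
  have "finite (separators pos x y) \<and> card (separators f x y) = card (separators pos x y)"
    if xy: "x \<in> S" "y \<in> S" for x y
  proof -
    have sub: "separators pos x y \<subseteq> {..<n}" by (auto simp: separators_def pos_def)
    have "separators f x y = e ` separators pos x y"
    proof
      show "e ` separators pos x y \<subseteq> separators f x y" by (auto simp: separators_def pos_def)
      show "separators f x y \<subseteq> e ` separators pos x y"
      proof
        fix i assume i: "i \<in> separators f x y"
        then have "i \<in> K" using xy by (auto simp: separators_iff S_iff)
        then obtain p where "p < n" "i = e p" by (auto simp: K_def)
        then show "i \<in> e ` separators pos x y" using i by (auto simp: separators_iff pos_def)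
      qed
    qed
    then have "card (separators f x y) = card (separators pos x y)"
      using card_image[OF inj_on_subset[OF e_inj sub]] by simp
    moreover have "finite (separators pos x y)" using sub finite_subset by blast
    ultimately show ?thesis by blast
  qed
  then show ?thesis using C by (simp add: cube_coords_def induced_def)
qed

lemma hull_product: "product_of_edges_and_even_cycles (induced G S)"
proof (rule product_of_segment_families[OF pos_coords])
  show "finite ({..<n} // coplanar)" by (rule finite_quotient[OF _ equiv_type[OF equiv_coplanar]]) simp
  show "{..<n} // coplanar \<noteq> {}" using n2 quotientI[of 0 "{..<n}" coplanar] by auto
  show "finite L \<and> L \<noteq> {}" if "L \<in> {..<n} // coplanar" for L
    using in_quotient_imp_subset[OF equiv_coplanar that] in_quotient_imp_non_empty[OF equiv_coplanar that]
      finite_subset by auto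
  show "pairwise disjnt ({..<n} // coplanar)"
    using quotient_disj[OF equiv_coplanar] by (auto simp: pairwise_def disjnt_def)
  have U: "\<Union>({..<n} // coplanar) = {..<n}" by (rule Union_quotient[OF equiv_coplanar])
  show "pos ` pverts (induced G S) = {X. X \<subseteq> \<Union>({..<n} // coplanar) \<and>
      (\<forall>L\<in>{..<n} // coplanar. X \<inter> L \<in> segments L)}"
  proof
    show "pos ` pverts (induced G S) \<subseteq> {X. X \<subseteq> \<Union>({..<n} // coplanar) \<and>
      (\<forall>L\<in>{..<n} // coplanar. X \<inter> L \<in> segments L)}"
      using pos_segment unfolding U by (auto simp: induced_def pos_def)
    show "{X. X \<subseteq> \<Union>({..<n} // coplanar) \<and> (\<forall>L\<in>{..<n} // coplanar. X \<inter> L \<in> segments L)}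
      \<subseteq> pos ` pverts (induced G S)"
    proof
      fix X assume "X \<in> {X. X \<subseteq> \<Union>({..<n} // coplanar) \<and> (\<forall>L\<in>{..<n} // coplanar. X \<inter> L \<in> segments L)}"
      then have "\<exists>x\<in>S. pos x = X" unfolding U by (intro segments_realized) auto
      then show "X \<in> pos ` pverts (induced G S)" by (auto simp: induced_def)
    qed
  qed
qed

end

section \<open>Both graph classes\<close>

lemma isometric_cycle_cycle_coords:
  fixes G :: "'a pair_pre_digraph"
  assumes "cube_coords G f0" "isometric_cycle C G"
  obtains b c e n where "cycle_coords G (separators f0 b) c e n" "pverts C = c ` {..<2 * n}"
proof -
  obtain c :: "nat \<Rightarrow> 'a" and e and n :: nat where c: "2 \<le> n" "pverts C = c ` {..<2 * n}" "range c \<subseteq> pverts G" "inj_on e {..<n}"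
    "\<forall>t\<le>n. separators f0 (c 0) (c t) = e ` {..<t}"
    "\<forall>t\<le>n. separators f0 (c 0) (c (n + t)) = e ` {t..<n}"
    by (rule isometric_cycle_coords[OF assms])
  have "cycle_coords G (separators f0 (c 0)) c e n"
    using c cube_coords_rebase[OF assms(1)] by unfold_locales auto
  then show thesis using that c by blast
qed

lemma separable_if_no_seven:
  assumes "no_seven_octants V HH" "finite HH"
  shows "separable V HH"
proof -
  interpret no_seven_octants V HH by (rule assms)
  show ?thesis
    unfolding separable_def
  proof (intro allI impI)
    fix \<alpha> \<beta> assume "\<alpha> \<subseteq> HH" "\<beta> \<subseteq> HH" "feasible \<alpha>" "feasible \<beta>" "\<not> feasible (\<alpha> \<union> \<beta>)"
    then show "\<exists>e\<in>HH. \<not> feasible (insert (- e) \<alpha>) \<and> \<not> feasible (insert e \<beta>)"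
      using separation[of \<alpha> \<beta>] finite_subset[OF _ assms(2)] by blast
  qed
qed

lemma separable_if_convex_separation:
  assumes coords: "cube_coords G f"
    and sep: "\<And>A B. geo_convex G A \<Longrightarrow> geo_convex G B \<Longrightarrow> A \<inter> B = {} \<Longrightarrow>
      \<exists>i s. (\<forall>x\<in>A. (i \<in> f x) = s) \<and> (\<forall>x\<in>B. (i \<in> f x) = (\<not> s))"
  shows "separable (coord_box G f J) (coord_halfspaces f J)"
proof -
  let ?V = "coord_box G f J" and ?H = "coord_halfspaces f J"
  have V: "geo_convex G ?V" by (rule geo_convex_coord_box[OF coords])
  interpret halfspace_system ?V ?H by (rule halfspace_system_coords[OF coords V])
  show ?thesis
    unfolding separable_def
  proof (intro allI impI)
    fix \<alpha> \<beta> assume \<alpha>: "\<alpha> \<subseteq> ?H" and \<beta>: "\<beta> \<subseteq> ?H" and f\<alpha>: "feasible \<alpha>" and f\<beta>: "feasible \<beta>"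
      and inf: "\<not> feasible (\<alpha> \<union> \<beta>)"
    define A where "A = {x \<in> ?V. \<forall>h\<in>\<alpha>. x \<in> h}"
    define B where "B = {x \<in> ?V. \<forall>h\<in>\<beta>. x \<in> h}"
    have conv: "geo_convex G A" "geo_convex G B"
      unfolding A_def B_def using geo_convex_Int_halfspaces[OF coords V] \<alpha> \<beta> by blast+
    have "A \<inter> B = {}"
    proof (rule ccontr)
      assume "A \<inter> B \<noteq> {}"
      then obtain x where "x \<in> A" "x \<in> B" by blast
      then have "feasible (\<alpha> \<union> \<beta>)" by (intro feasibleI[of x]) (auto simp: A_def B_def)
      then show False using inf by blast
    qed
    then obtain i s where i: "\<forall>x\<in>A. (i \<in> f x) = s" "\<forall>x\<in>B. (i \<in> f x) = (\<not> s)"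
      using sep[OF conv] by blast
    obtain x where x: "x \<in> A" using f\<alpha> by (auto simp: feasible_def A_def)
    obtain y where y: "y \<in> B" using f\<beta> by (auto simp: feasible_def B_def)
    have "i \<in> f x \<or> i \<in> f y" using i x y by blast
    then have iJ: "i \<in> J" using x y by (auto simp: A_def B_def coord_box_def)
    let ?e = "{z. (i \<in> f z) = s}"
    have "?e \<in> ?H" using iJ by (cases s) (auto simp: coord_halfspaces_def)
    moreover have "\<not> feasible (insert (- ?e) \<alpha>)"
      using i(1) unfolding feasible_def A_def by auto
    moreover have "\<not> feasible (insert ?e \<beta>)"
      using i(2) unfolding feasible_def B_def by auto
    ultimately show "\<exists>e\<in>?H. \<not> feasible (insert (- e) \<alpha>) \<and> \<not> feasible (insert e \<beta>)" by blast
  qed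
qed

theorem theorem1:
  fixes G :: "'a pair_pre_digraph"
  shows "(G \<in> F_Q3_minus \<longrightarrow>
           (\<forall>C. isometric_cycle C G \<longrightarrow>
              gated G (conv G (pverts C)) \<and>
              product_of_edges_and_even_cycles (induced G (conv G (pverts C))))) \<and>
         (G \<in> S4 \<longrightarrow>
           (\<forall>C. isometric_cycle C G \<longrightarrow>
              gated G (conv G (pverts C)) \<and>
              (antipodal G (conv G (pverts C)) \<longrightarrow>
                 product_of_edges_and_even_cycles (induced G (conv G (pverts C))))))"
proof (intro conjI impI allI)
  fix C assume G: "G \<in> F_Q3_minus" and C: "isometric_cycle C G"
  have pc: "partial_cube G" and no: "\<not> has_pc_minor G Q3_minus" using G by (auto simp: F_Q3_minus_def)
  obtain f0 :: "'a \<Rightarrow> ('a \<times> 'a) set" where f0: "cube_coords G f0" using partial_cube_coords[OF pc] .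
  obtain b c e n where cyc: "cycle_coords G (separators f0 b) c e n" "pverts C = c ` {..<2 * n}"
    by (rule isometric_cycle_cycle_coords[OF f0 C])
  interpret cycle_coords G "separators f0 b" c e n by (rule cyc)
  let ?f = "separators f0 b"
  have hull: "conv G (pverts C) = S" using hull_cycle cyc(2) by simp
  have no7: "no_seven_octants (coord_box G ?f J) (coord_halfspaces ?f J)" if "finite J" for J
    by (rule no_seven_octants_coords[OF coords no that])
  have sep: "separable (coord_box G ?f J) (coord_halfspaces ?f J)" if "finite J" for J
    using separable_if_no_seven[OF no7[OF that]] that by (simp add: coord_halfspaces_def)
  show "gated G (conv G (pverts C))" unfolding hull by (rule gated_hull[OF sep])
  have "antipodal_cycle_coords G ?f c e n"
    using antipode_if_no_seven[OF no7[OF finite_K, folded S_def]] sep[OF finite_K] 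
    by unfold_locales (simp_all add: S_def)
  then show "product_of_edges_and_even_cycles (induced G (conv G (pverts C)))"
    unfolding hull by (rule antipodal_cycle_coords.hull_product)
next
  fix C assume G: "G \<in> S4" and C: "isometric_cycle C G"
  obtain f0 :: "'a \<Rightarrow> 'a set set" where f0: "cube_coords G f0"
    and sep0: "\<And>A B. geo_convex G A \<Longrightarrow> geo_convex G B \<Longrightarrow> A \<inter> B = {} \<Longrightarrow>
      \<exists>i s. (\<forall>x\<in>A. (i \<in> f0 x) = s) \<and> (\<forall>x\<in>B. (i \<in> f0 x) = (\<not> s))"
    using S4_coords[OF G] by metis
  obtain b c e n where cyc: "cycle_coords G (separators f0 b) c e n" "pverts C = c ` {..<2 * n}"
    by (rule isometric_cycle_cycle_coords[OF f0 C])
  interpret cycle_coords G "separators f0 b" c e n by (rule cyc)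
  let ?f = "separators f0 b"
  have hull: "conv G (pverts C) = S" using hull_cycle cyc(2) by simp
  have sep: "separable (coord_box G ?f J) (coord_halfspaces ?f J)" for J
  proof (rule separable_if_convex_separation[OF coords])
    fix A B assume "geo_convex G A" "geo_convex G B" "A \<inter> B = {}"
    from sep0[OF this] obtain i s
      where i: "\<forall>x\<in>A. (i \<in> f0 x) = s" "\<forall>x\<in>B. (i \<in> f0 x) = (\<not> s)"
      by (elim exE conjE)
    have "(i \<in> ?f x) = ((i \<in> f0 b) \<noteq> s)" if "x \<in> A" for x
      using bspec[OF i(1) that] by (auto simp: separators_iff)
    moreover have "(i \<in> ?f x) = (\<not> ((i \<in> f0 b) \<noteq> s))" if "x \<in> B" for x
      using bspec[OF i(2) that] by (auto simp: separators_iff)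
    ultimately show "\<exists>i s. (\<forall>x\<in>A. (i \<in> ?f x) = s) \<and> (\<forall>x\<in>B. (i \<in> ?f x) = (\<not> s))"
      by (intro exI[of _ i] exI[of _ "(i \<in> f0 b) \<noteq> s"] conjI ballI)
  qed
  show "gated G (conv G (pverts C))" unfolding hull by (rule gated_hull[OF sep])
  show "product_of_edges_and_even_cycles (induced G (conv G (pverts C)))"
    if "antipodal G (conv G (pverts C))"
  proof -
    have "antipodal_cycle_coords G ?f c e n"
      using antipode_if_antipodal[OF that[unfolded hull]] sep[of K] by unfold_locales (simp_all add: S_def)
    then show ?thesis unfolding hull by (rule antipodal_cycle_coords.hull_product)
  qed
qed

end
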